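(* Let $t_1\in\mathbb{R}$, let $T:\mathbb{Z}\to\mathbb{R}$ be the $2$-periodic sequence with $T(2j)=0$, $T(2j+1)=t_1$, and let $\omega\in\mathbb{R}$ be such that $\omega/2\pi$ is a Diophantine number. Then there exists $\epsilon>0$ such that for every $E\in[-\epsilon,\epsilon]$ the cocycle $(2\omega,B_E)$ is almost reducible.
   Context: For $E\in\mathbb{R}$ and $h\in\{0,1\}$ let $A_E(\theta,h)=\begin{pmatrix}E-T(h)\cos\theta&-1\\1&0\end{pmatrix}$ and $B_E(\theta)=A_E(\theta+\omega,1)A_E(\theta,0)$, $\theta\in S^1=\mathbb{R}/2\pi\mathbb{Z}$; this is the two-step transfer matrix of the operator $(H_\theta u)(n)=u(n+1)+u(n-1)+T(n)\cos(\theta+n\omega)u(n)$ on $\ell^2(\mathbb{Z})$, and $(2\omega,B_E)$ denotes the cocycle $(\theta,v)\mapsto(\theta+2\omega,B_E(\theta)v)$. A number $\alpha$ is Diophantine if there exist $\gamma>0,\tau>0$ with $|q\alpha-p|\ge\gamma|q|^{-\tau}$ for all $p\in\mathbb{Z}$, $q\in\mathbb{Z}\setminus\{0\}$. An analytic cocycle $(\beta,B)$, $B:S^1\to SL(2,\mathbb{R})$, is almost reducible if there exist $h>0$ and a sequence of maps $Z_n:S^1\to PSL(2,\mathbb{R})$ extending analytically to the strip $|\mathrm{Im}\,\theta|<h$ such that $Z_n(\theta+\beta)B(\theta)Z_n(\theta)^{-1}$ converges to a constant matrix uniformly on that strip. *)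

theory Defs
  imports "HOL-Analysis.Analysis"
begin

definition Tseq :: "real \<Rightarrow> int \<Rightarrow> real" where
  "Tseq t1 n = (if even n then 0 else t1)"

definition diophantine :: "real \<Rightarrow> bool" where
  "diophantine \<alpha> \<longleftrightarrow> (\<exists>\<gamma>>0. \<exists>\<tau>>0. \<forall>p q :: int. q \<noteq> 0 \<longrightarrow>
      \<bar>real_of_int q * \<alpha> - real_of_int p\<bar> \<ge> \<gamma> * \<bar>real_of_int q\<bar> powr (- \<tau>))"

definition mat2 :: "'a::zero \<Rightarrow> 'a \<Rightarrow> 'a \<Rightarrow> 'a \<Rightarrow> 'a^2^2" where
  "mat2 a b c d = vector [vector [a, b], vector [c, d]]"

(* A_E(theta,h), with theta allowed complex (the analytic extension of the real cocycle;
   on the real axis it is the real matrix of the paper). *)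
definition Amat :: "real \<Rightarrow> real \<Rightarrow> complex \<Rightarrow> int \<Rightarrow> complex^2^2" where
  "Amat t1 E \<theta> h = mat2 (complex_of_real E - complex_of_real (Tseq t1 h) * cos \<theta>) (-1) 1 0"

definition Bmat :: "real \<Rightarrow> real \<Rightarrow> real \<Rightarrow> complex \<Rightarrow> complex^2^2" where
  "Bmat t1 \<omega> E \<theta> = Amat t1 E (\<theta> + complex_of_real \<omega>) 1 ** Amat t1 E \<theta> 0"

definition strip :: "real \<Rightarrow> complex set" where
  "strip h = {z. \<bar>Im z\<bar> < h}"

(* Z is (the analytic extension to strip h of) a map S^1 = R/2piZ -> PSL(2,R):
   entrywise holomorphic on the strip, real on the real axis, determinant 1, and
   2pi-periodic up to sign (a map to PSL lifts to SL(2,R) up to a global sign). *)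
definition psl_analytic_on_strip :: "real \<Rightarrow> (complex \<Rightarrow> complex^2^2) \<Rightarrow> bool" where
  "psl_analytic_on_strip h Z \<longleftrightarrow>
     (\<forall>i j. (\<lambda>z. Z z $ i $ j) holomorphic_on strip h) \<and>
     (\<forall>x::real. \<forall>i j. Im (Z (complex_of_real x) $ i $ j) = 0) \<and>
     (\<forall>z\<in>strip h. det (Z z) = 1) \<and>
     (\<exists>s::real. s \<in> {1, -1} \<and>
        (\<forall>z\<in>strip h. Z (z + complex_of_real (2 * pi)) = s *\<^sub>R Z z))"

(* Almost reducibility of the analytic cocycle (beta, B), B given by its analytic extension.
   Convergence is in PSL(2,.), i.e. up to a sign sigma_n. *)
definition almost_reducible :: "real \<Rightarrow> (complex \<Rightarrow> complex^2^2) \<Rightarrow> bool" where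
  "almost_reducible \<beta> B \<longleftrightarrow>
     (\<exists>h>0. \<exists>Z :: nat \<Rightarrow> complex \<Rightarrow> complex^2^2. \<exists>C :: complex^2^2. \<exists>\<sigma> :: nat \<Rightarrow> real.
        (\<forall>n. psl_analytic_on_strip h (Z n)) \<and> (\<forall>n. \<sigma> n \<in> {1, -1}) \<and>
        uniform_limit (strip h)
          (\<lambda>n z. \<sigma> n *\<^sub>R (Z n (z + complex_of_real \<beta>) ** B z ** matrix_inv (Z n z)))
          (\<lambda>z. C) sequentially)"

end

theory Submission
  imports Defs "HOL-Library.Poly_Mapping" "HOL-Real_Asymp.Real_Asymp"
begin

text \<open>At \<open>E = 0\<close> the cocycle is unipotent with a zero-mean off-diagonal entry, so it is conjugated to
  \<open>-1\<close> by an explicit trigonometric polynomial; for small \<open>E\<close> it is thus a small perturbation of a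
  constant. Each KAM step removes the modes \<open>|n| \<le> 1/x\<^sup>2\<close> of a perturbation of size \<open>x\<^sup>p\<close> by one
  linearised conjugation, unless a small divisor occurs at some mode \<open>k\<close>. In that case the constant
  part is elliptic and, by the Diophantine condition, \<open>k\<close> is the only resonance among the modes
  \<open>|n| \<le> 1/x\<^sup>4\<close>. All the other modes are removed to a precision that beats \<open>exp (2 h |k|)\<close>, and a rotation
  by \<open>k \<theta> / 2\<close> then makes the resonant term constant. As \<open>1/x\<^sup>4\<close> is much larger than
  \<open>|k| \<le> 1/x\<^sup>2\<close>, a step costs only \<open>x\<close> of the strip, so halving \<open>x\<close> leaves a fixed strip.
  The constants stay bounded, and a subsequence of them converges.

  Conjugations are products of factors \<open>1 + Y\<close> with \<open>Y\<close> a Laurent polynomial in \<open>exp (i \<theta>)\<close>, up to a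
  scalar normalisation; hence no infinite Fourier series occurs.\<close>

subsection \<open>Complex two-by-two matrices as a ring\<close>

text \<open>Almost reducibility asks nothing of the size of the conjugations, only that the
  conjugated cocycles approach a constant on one fixed strip. Infinitely many resonances are
  therefore harmless, although each one may conjugate by a large matrix: what has to be summable is
  the loss of strip, not the growth of the maps. Accordingly few data have to survive a step: the
  width of the strip, the size of the perturbation, and crude bounds on the norm and the determinant
  of the constant part. The determinant is not kept equal to 1. Using \<open>1 - Y\<close> in place
  of the inverse of \<open>1 + Y\<close> keeps everything a Laurent polynomial at the price of a
  scalar function, so the determinant may drift inside a fixed window; one square root restores it
  at the end. The constant part is not assumed elliptic either. The resonance test is a polynomial
  in its trace and determinant, so parabolic and hyperbolic constants go through the same linear
  step, and ellipticity is deduced at a resonance, exactly where a diagonalisation is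
  needed.\<close>

datatype m2 = M2 (e11: complex) (e12: complex) (e21: complex) (e22: complex)

lemma m2_eqI: "e11 X = e11 Y \<Longrightarrow> e12 X = e12 Y \<Longrightarrow> e21 X = e21 Y \<Longrightarrow> e22 X = e22 Y \<Longrightarrow> X = Y"
  by (simp add: m2.expand)

text \<open>With this instance the finitely supported maps from \<open>int\<close> to
  \<open>m2\<close> form a ring under convolution, which is the algebra of matrix-valued Laurent
  polynomials.\<close>

instantiation m2 :: ring_1
begin

definition "0 = M2 0 0 0 0"
definition "1 = M2 1 0 0 1"
definition "X + Y = M2 (e11 X + e11 Y) (e12 X + e12 Y) (e21 X + e21 Y) (e22 X + e22 Y)"
definition "X - Y = M2 (e11 X - e11 Y) (e12 X - e12 Y) (e21 X - e21 Y) (e22 X - e22 Y)"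
definition "- X = M2 (- e11 X) (- e12 X) (- e21 X) (- e22 X)"
definition "X * Y = M2 (e11 X * e11 Y + e12 X * e21 Y) (e11 X * e12 Y + e12 X * e22 Y)
  (e21 X * e11 Y + e22 X * e21 Y) (e21 X * e12 Y + e22 X * e22 Y)"

instance
  by standard (auto simp: zero_m2_def one_m2_def plus_m2_def minus_m2_def uminus_m2_def
      times_m2_def algebra_simps)

end

lemmas m2_defs = zero_m2_def one_m2_def plus_m2_def minus_m2_def uminus_m2_def times_m2_def

definition scl :: "complex \<Rightarrow> m2" where "scl c = M2 c 0 0 c"
definition tr2 :: "m2 \<Rightarrow> complex" where "tr2 X = e11 X + e22 X"
definition det2 :: "m2 \<Rightarrow> complex" where "det2 X = e11 X * e22 X - e12 X * e21 X"
definition adj2 :: "m2 \<Rightarrow> m2" where "adj2 X = M2 (e22 X) (- e12 X) (- e21 X) (e11 X)"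
text \<open>The entrywise sum norm is submultiplicative but gives the identity norm 2; several
  constants below carry this factor.\<close>

definition nm :: "m2 \<Rightarrow> real" where "nm X = norm (e11 X) + norm (e12 X) + norm (e21 X) + norm (e22 X)"

text \<open>The fixed points of \<open>sg\<close> of determinant 1 form \<open>SU(1,1)\<close>, which is conjugate to
  \<open>SL(2,R)\<close>; in these coordinates elliptic matrices can be diagonalised inside the real group.\<close>

definition sg :: "m2 \<Rightarrow> m2" where "sg X = M2 (cnj (e22 X)) (cnj (e21 X)) (cnj (e12 X)) (cnj (e11 X))"

lemma scl_comm: "X * scl c = scl c * X"
  by (simp add: scl_def times_m2_def algebra_simps)

lemma scl_mult: "scl a * scl b = scl (a * b)"
  by (simp add: scl_def times_m2_def)

lemma scl_mult_left: "scl a * (scl b * X) = scl (a * b) * X"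
  by (simp add: scl_def times_m2_def algebra_simps)

lemma scl_mult_mult: "(scl a * X) * (scl b * Y) = scl (a * b) * (X * Y)"
  by (simp add: scl_def times_m2_def algebra_simps)

lemma scl_0 [simp]: "scl 0 = 0" and scl_1 [simp]: "scl 1 = 1"
  by (simp_all add: scl_def m2_defs)

lemma scl_add: "scl (a + b) = scl a + scl b"
  by (simp add: scl_def m2_defs)

lemma det2_mult: "det2 (X * Y) = det2 X * det2 Y"
  by (simp add: det2_def times_m2_def algebra_simps)

lemma det2_scl: "det2 (scl c * X) = c\<^sup>2 * det2 X"
  by (simp add: det2_def scl_def times_m2_def algebra_simps power2_eq_square)

lemma det2_1 [simp]: "det2 1 = 1"
  by (simp add: det2_def one_m2_def)

lemma mult_adj2: "X * adj2 X = scl (det2 X)" and adj2_mult: "adj2 X * X = scl (det2 X)"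
  by (simp_all add: adj2_def det2_def scl_def times_m2_def algebra_simps)

lemma nm_nonneg [simp]: "0 \<le> nm X"
  by (simp add: nm_def)

lemma nm_0 [simp]: "nm 0 = 0" and nm_1 [simp]: "nm 1 = 2"
  by (simp_all add: nm_def m2_defs)

lemma nm_eq_0_iff [simp]: "nm X = 0 \<longleftrightarrow> X = 0"
  by (cases X) (auto simp: nm_def zero_m2_def add_nonneg_eq_0_iff)

lemma nm_entries: "norm (e11 X) \<le> nm X" "norm (e12 X) \<le> nm X" "norm (e21 X) \<le> nm X" "norm (e22 X) \<le> nm X"
  by (simp_all add: nm_def)

lemma nm_add: "nm (X + Y) \<le> nm X + nm Y"
  using norm_triangle_ineq[of "e11 X" "e11 Y"] norm_triangle_ineq[of "e12 X" "e12 Y"]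
    norm_triangle_ineq[of "e21 X" "e21 Y"] norm_triangle_ineq[of "e22 X" "e22 Y"]
  by (simp add: nm_def plus_m2_def)

lemma nm_minus [simp]: "nm (- X) = nm X"
  by (simp add: nm_def uminus_m2_def)

lemma nm_diff: "nm (X - Y) \<le> nm X + nm Y"
  using nm_add[of X "- Y"] by simp

lemma nm_sum: "nm (sum f S) \<le> (\<Sum>i\<in>S. nm (f i))"
proof (induction S rule: infinite_finite_induct)
  case (insert x F)
  then show ?case using nm_add[of "f x" "sum f F"] by simp
qed simp_all

lemma nm_mult: "nm (X * Y) \<le> nm X * nm Y"
proof -
  have t: "norm (a * b + c * d) \<le> norm a * norm b + norm c * norm d" for a b c d :: complex
    by (metis norm_mult norm_triangle_ineq)
  have "nm (X * Y) \<le> (norm (e11 X) * norm (e11 Y) + norm (e12 X) * norm (e21 Y))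
    + (norm (e11 X) * norm (e12 Y) + norm (e12 X) * norm (e22 Y))
    + (norm (e21 X) * norm (e11 Y) + norm (e22 X) * norm (e21 Y))
    + (norm (e21 X) * norm (e12 Y) + norm (e22 X) * norm (e22 Y))"
    unfolding nm_def times_m2_def by (intro add_mono) (simp_all add: t)
  also have "\<dots> \<le> nm X * nm Y"
    by (simp add: nm_def algebra_simps)
  finally show ?thesis .
qed

lemma nm_scl_mult [simp]: "nm (scl c * X) = norm c * nm X"
  by (simp add: nm_def scl_def times_m2_def norm_mult algebra_simps)

lemma nm_scl: "nm (scl c) = 2 * norm c"
  by (simp add: nm_def scl_def)

lemma nm_adj2 [simp]: "nm (adj2 X) = nm X"
  by (simp add: nm_def adj2_def)

lemma norm_tr2: "norm (tr2 X) \<le> nm X"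
  using norm_triangle_ineq[of "e11 X" "e22 X"] norm_ge_zero[of "e12 X"] norm_ge_zero[of "e21 X"]
  by (simp add: nm_def tr2_def del: norm_ge_zero)

lemma norm_det2: "norm (det2 X) \<le> (nm X)\<^sup>2"
proof -
  have "norm (det2 X) \<le> norm (e11 X) * norm (e22 X) + norm (e12 X) * norm (e21 X)"
    unfolding det2_def by (metis norm_mult norm_triangle_ineq4)
  also have "\<dots> \<le> (nm X)\<^sup>2"
    by (simp add: nm_def power2_eq_square algebra_simps)
  finally show ?thesis .
qed

lemma norm_det2_diff: "norm (det2 X - det2 Y) \<le> nm (X - Y) * (nm X + nm Y)"
proof -
  have eq: "det2 X - det2 Y = (e11 X - e11 Y) * e22 X + e11 Y * (e22 X - e22 Y)
    - ((e12 X - e12 Y) * e21 X + e12 Y * (e21 X - e21 Y))"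
    by (simp add: det2_def algebra_simps)
  have "norm (det2 X - det2 Y) \<le> norm (e11 X - e11 Y) * norm (e22 X) + norm (e11 Y) * norm (e22 X - e22 Y)
    + (norm (e12 X - e12 Y) * norm (e21 X) + norm (e12 Y) * norm (e21 X - e21 Y))"
    unfolding eq by (intro order_trans[OF norm_triangle_ineq4] add_mono order_trans[OF norm_triangle_ineq])
      (simp_all add: norm_mult)
  also have "\<dots> \<le> nm (X - Y) * nm X + nm Y * nm (X - Y)"
  proof -
    have d: "e11 X - e11 Y = e11 (X - Y)" "e12 X - e12 Y = e12 (X - Y)"
      "e21 X - e21 Y = e21 (X - Y)" "e22 X - e22 Y = e22 (X - Y)"
      by (simp_all add: minus_m2_def)
    show ?thesis unfolding d nm_def by (simp add: algebra_simps)
  qed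
  finally show ?thesis by (simp add: algebra_simps)
qed

lemma sg_0 [simp]: "sg 0 = 0" and sg_1 [simp]: "sg 1 = 1"
  by (simp_all add: sg_def m2_defs)

lemma sg_add: "sg (X + Y) = sg X + sg Y"
  and sg_diff: "sg (X - Y) = sg X - sg Y"
  and sg_minus: "sg (- X) = - sg X"
  and sg_mult: "sg (X * Y) = sg X * sg Y"
  and sg_scl: "sg (scl c) = scl (cnj c)"
  and sg_adj2: "sg (adj2 X) = adj2 (sg X)"
  and sg_sg [simp]: "sg (sg X) = X"
  by (simp_all add: sg_def m2_defs scl_def adj2_def)

lemma tr2_sg: "tr2 (sg X) = cnj (tr2 X)" and det2_sg: "det2 (sg X) = cnj (det2 X)"
  by (simp_all add: sg_def tr2_def det2_def algebra_simps)

lemma sg_sum: "sg (sum f S) = (\<Sum>i\<in>S. sg (f i))"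
  by (induction S rule: infinite_finite_induct) (auto simp: sg_add)

subsection \<open>Matrix-valued Laurent polynomials\<close>

type_synonym lpoly = "int \<Rightarrow>\<^sub>0 m2"

abbreviation cf :: "lpoly \<Rightarrow> int \<Rightarrow> m2" where "cf \<equiv> Poly_Mapping.lookup"
abbreviation sng :: "int \<Rightarrow> m2 \<Rightarrow> lpoly" where "sng \<equiv> Poly_Mapping.single"
abbreviation kys :: "lpoly \<Rightarrow> int set" where "kys \<equiv> Poly_Mapping.keys"

abbreviation cst :: "m2 \<Rightarrow> lpoly" where "cst \<equiv> sng 0"

lemma sng_expansion: "F = (\<Sum>k\<in>kys F. sng k (cf F k))"
proof (rule poly_mapping_eqI)
  fix n
  have "cf (\<Sum>k\<in>kys F. sng k (cf F k)) n = (\<Sum>k\<in>kys F. cf F k when k = n)"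
    by (simp add: lookup_sum lookup_single)
  also have "\<dots> = (\<Sum>k\<in>kys F. if k = n then cf F k else 0)"
    by (intro sum.cong) (auto simp: when_def)
  also have "\<dots> = cf F n"
    by (auto simp: in_keys_iff)
  finally show "cf F n = cf (\<Sum>k\<in>kys F. sng k (cf F k)) n" by simp
qed

lemma lpoly_mult_expansion:
  "F * G = (\<Sum>k\<in>kys F. \<Sum>l\<in>kys G. sng (k + l) (cf F k * cf G l))"
proof -
  have "F * G = (\<Sum>k\<in>kys F. sng k (cf F k)) * (\<Sum>k\<in>kys G. sng k (cf G k))"
    by (simp flip: sng_expansion)
  then show ?thesis by (simp add: sum_product mult_single)
qed

text \<open>Laurent polynomials are sums of monomials, so multiplicativity need only be checked
  there. Used for evaluation and for the reality involution.\<close>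

lemma lpoly_hom_multI:
  fixes \<Phi> :: "lpoly \<Rightarrow> 'r :: semiring_0"
  assumes add: "\<And>F G. \<Phi> (F + G) = \<Phi> F + \<Phi> G" and zero: "\<Phi> 0 = 0"
    and mono: "\<And>k l X Y. \<Phi> (sng (k + l) (X * Y)) = \<Phi> (sng k X) * \<Phi> (sng l Y)"
  shows "\<Phi> (F * G) = \<Phi> F * \<Phi> G"
proof -
  have sum: "\<Phi> (sum f S) = (\<Sum>i\<in>S. \<Phi> (f i))" for f :: "int \<Rightarrow> lpoly" and S
    by (induction S rule: infinite_finite_induct) (auto simp: add zero)
  have "\<Phi> (F * G) = (\<Sum>k\<in>kys F. \<Phi> (sng k (cf F k))) * (\<Sum>k\<in>kys G. \<Phi> (sng k (cf G k)))"
    by (simp add: lpoly_mult_expansion sum mono sum_product)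
  also have "\<dots> = \<Phi> F * \<Phi> G"
    by (simp flip: sum sng_expansion)
  finally show ?thesis .
qed

text \<open>The Wiener algebra norm of the strip of half-width \<open>h\<close>: submultiplicative,
  above the supremum on the strip, and controlled mode by mode.\<close>

definition nrm :: "real \<Rightarrow> lpoly \<Rightarrow> real" where
  "nrm h F = (\<Sum>k\<in>kys F. nm (cf F k) * exp (h * \<bar>real_of_int k\<bar>))"

lemma nrm_nonneg [simp]: "0 \<le> nrm h F"
  by (simp add: nrm_def sum_nonneg)

lemma nrm_superset:
  "finite S \<Longrightarrow> kys F \<subseteq> S \<Longrightarrow> nrm h F = (\<Sum>k\<in>S. nm (cf F k) * exp (h * \<bar>real_of_int k\<bar>))"
  unfolding nrm_def by (rule sum.mono_neutral_left) (auto simp: in_keys_iff)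

lemma nrm_0 [simp]: "nrm h 0 = 0"
  by (simp add: nrm_def)

lemma nrm_sng: "nrm h (sng k X) = nm X * exp (h * \<bar>real_of_int k\<bar>)"
  by (cases "X = 0") (simp_all add: nrm_def)

lemma nrm_cst [simp]: "nrm h (cst X) = nm X"
  by (simp add: nrm_sng)

lemma nrm_minus [simp]: "nrm h (- F) = nrm h F"
  by (simp add: nrm_def keys_def)

lemma nrm_weight_le:
  assumes "\<And>n. nm (cf G n) * exp (h' * \<bar>real_of_int n\<bar>) \<le> C * (nm (cf F n) * exp (h * \<bar>real_of_int n\<bar>))"
  shows "nrm h' G \<le> C * nrm h F"
proof -
  have fin: "finite (kys F \<union> kys G)" by simp
  show ?thesis
    unfolding nrm_superset[OF fin Un_upper2] nrm_superset[OF fin Un_upper1] sum_distrib_left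
    by (intro sum_mono assms)
qed

lemma nrm_le_mult:
  assumes "\<And>n. nm (cf G n) \<le> C * nm (cf F n)"
  shows "nrm h G \<le> C * nrm h F"
  by (rule nrm_weight_le) (use assms in \<open>simp add: mult.assoc[symmetric]\<close>)

lemma nrm_le:
  assumes "\<And>n. nm (cf G n) \<le> nm (cf F n)"
  shows "nrm h G \<le> nrm h F"
  using nrm_le_mult[of G 1 F h] assms by simp

lemma nrm_mono: "h' \<le> h \<Longrightarrow> nrm h' F \<le> nrm h F"
  using nrm_weight_le[of F h' 1 F h] by (simp add: mult_left_mono mult_right_mono)

lemma nrm_add: "nrm h (F + G) \<le> nrm h F + nrm h G"
proof -
  have fin: "finite (kys F \<union> kys G)" by simp
  have s: "kys (F + G) \<subseteq> kys F \<union> kys G" by (rule keys_add)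
  show ?thesis
    unfolding nrm_superset[OF fin Un_upper2] nrm_superset[OF fin Un_upper1] nrm_superset[OF fin s]
    unfolding sum.distrib[symmetric]
    by (intro sum_mono) (simp add: lookup_add nm_add mult_right_mono flip: distrib_right)
qed

lemma nrm_diff: "nrm h (F - G) \<le> nrm h F + nrm h G"
  using nrm_add[of h F "- G"] by simp

lemma nrm_sum: "nrm h (sum f S) \<le> (\<Sum>i\<in>S. nrm h (f i))"
proof (induction S rule: infinite_finite_induct)
  case (insert x F)
  then show ?case using nrm_add[of h "f x" "sum f F"] by simp
qed simp_all

lemma nrm_mult:
  assumes "0 \<le> h"
  shows "nrm h (F * G) \<le> nrm h F * nrm h G"
proof -
  have "nrm h (F * G) \<le> (\<Sum>k\<in>kys F. \<Sum>l\<in>kys G. nrm h (sng (k + l) (cf F k * cf G l)))"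
    unfolding lpoly_mult_expansion by (intro order_trans[OF nrm_sum] sum_mono nrm_sum)
  also have "\<dots> \<le> (\<Sum>k\<in>kys F. \<Sum>l\<in>kys G. (nm (cf F k) * exp (h * \<bar>real_of_int k\<bar>)) *
      (nm (cf G l) * exp (h * \<bar>real_of_int l\<bar>)))"
  proof (intro sum_mono)
    fix k l
    have "nrm h (sng (k + l) (cf F k * cf G l)) \<le>
      (nm (cf F k) * nm (cf G l)) * exp (h * \<bar>real_of_int k\<bar> + h * \<bar>real_of_int l\<bar>)"
      unfolding nrm_sng
    proof (intro mult_mono nm_mult)
      show "exp (h * \<bar>real_of_int (k + l)\<bar>) \<le> exp (h * \<bar>real_of_int k\<bar> + h * \<bar>real_of_int l\<bar>)"
        using mult_left_mono[OF abs_triangle_ineq assms] by (simp add: distrib_left)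
    qed simp_all
    then show "nrm h (sng (k + l) (cf F k * cf G l)) \<le> (nm (cf F k) * exp (h * \<bar>real_of_int k\<bar>)) *
      (nm (cf G l) * exp (h * \<bar>real_of_int l\<bar>))"
      by (simp add: exp_add mult_ac)
  qed
  also have "\<dots> = nrm h F * nrm h G"
    by (simp add: nrm_def sum_product)
  finally show ?thesis .
qed

lemma nm_cf_le_nrm:
  assumes "0 \<le> h"
  shows "nm (cf F n) \<le> nrm h F"
proof (cases "n \<in> kys F")
  case True
  have "nm (cf F n) * 1 \<le> nm (cf F n) * exp (h * \<bar>real_of_int n\<bar>)"
    by (intro mult_left_mono) (simp_all add: assms)
  also have "\<dots> \<le> nrm h F"
    unfolding nrm_def by (rule member_le_sum) (use True in auto)
  finally show ?thesis by simp
qed (simp add: in_keys_iff)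

section \<open>Evaluation of Laurent polynomials on a strip\<close>

definition ev :: "lpoly \<Rightarrow> complex \<Rightarrow> m2" where
  "ev F z = (\<Sum>k\<in>kys F. scl (exp (\<i> * of_int k * z)) * cf F k)"

lemma ev_superset:
  "finite S \<Longrightarrow> kys F \<subseteq> S \<Longrightarrow> ev F z = (\<Sum>k\<in>S. scl (exp (\<i> * of_int k * z)) * cf F k)"
  unfolding ev_def by (rule sum.mono_neutral_left) (auto simp: in_keys_iff)

lemma ev_0 [simp]: "ev 0 z = 0"
  by (simp add: ev_def)

lemma ev_sng: "ev (sng k X) z = scl (exp (\<i> * of_int k * z)) * X"
  by (cases "X = 0") (simp_all add: ev_def)

lemma ev_cst [simp]: "ev (cst X) z = X"
  by (simp add: ev_sng)

lemma ev_1 [simp]: "ev 1 z = 1"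
  using ev_cst[of 1] by (simp del: ev_cst)

lemma ev_add: "ev (F + G) z = ev F z + ev G z"
proof -
  have fin: "finite (kys F \<union> kys G)" by simp
  have s: "kys (F + G) \<subseteq> kys F \<union> kys G" by (rule keys_add)
  show ?thesis
    unfolding ev_superset[OF fin Un_upper2] ev_superset[OF fin Un_upper1] ev_superset[OF fin s]
    by (simp add: lookup_add distrib_left sum.distrib)
qed

lemma ev_minus: "ev (- F) z = - ev F z"
  using ev_add[of F "- F" z] by (simp add: eq_neg_iff_add_eq_0 add.commute)

lemma ev_diff: "ev (F - G) z = ev F z - ev G z"
  using ev_add[of F "- G" z] by (simp add: ev_minus)

lemma ev_mult: "ev (F * G) z = ev F z * ev G z"
proof (rule lpoly_hom_multI[of "\<lambda>F. ev F z"])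
  fix k l X Y
  show "ev (sng (k + l) (X * Y)) z = ev (sng k X) z * ev (sng l Y) z"
    unfolding ev_sng scl_mult_mult exp_add[symmetric] by (simp add: distrib_left distrib_right)
qed (simp_all add: ev_add)

lemma nm_ev_le:
  assumes "\<bar>Im z\<bar> \<le> h"
  shows "nm (ev F z) \<le> nrm h F"
proof -
  have "nm (ev F z) \<le> (\<Sum>k\<in>kys F. nm (scl (exp (\<i> * of_int k * z)) * cf F k))"
    unfolding ev_def by (rule nm_sum)
  also have "\<dots> \<le> nrm h F"
    unfolding nrm_def
  proof (intro sum_mono)
    fix k
    have "- (real_of_int k * Im z) \<le> \<bar>real_of_int k\<bar> * \<bar>Im z\<bar>"
      by (metis abs_ge_minus_self abs_mult)
    also have "\<dots> \<le> h * \<bar>real_of_int k\<bar>"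
      using mult_left_mono[OF assms, of "\<bar>real_of_int k\<bar>"] by (simp add: mult.commute)
    finally have "norm (exp (\<i> * of_int k * z)) \<le> exp (h * \<bar>real_of_int k\<bar>)"
      by simp
    then show "nm (scl (exp (\<i> * of_int k * z)) * cf F k) \<le> nm (cf F k) * exp (h * \<bar>real_of_int k\<bar>)"
      by (simp add: mult.commute mult_left_mono)
  qed
  finally show ?thesis .
qed

text \<open>Laurent polynomials that are \<open>SU(1,1)\<close>-real on the real axis.\<close>

definition rl :: "lpoly \<Rightarrow> bool" where
  "rl F \<longleftrightarrow> (\<forall>n. cf F (- n) = sg (cf F n))"

lemma rl_cst: "rl (cst X) \<longleftrightarrow> sg X = X"
  by (auto simp: rl_def lookup_single when_def)

lemma rl_1 [simp]: "rl 1"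
  using rl_cst[of 1] by simp

lemma rl_add: "rl F \<Longrightarrow> rl G \<Longrightarrow> rl (F + G)"
  and rl_diff: "rl F \<Longrightarrow> rl G \<Longrightarrow> rl (F - G)"
  and rl_minus: "rl F \<Longrightarrow> rl (- F)"
  by (simp_all add: rl_def lookup_add lookup_minus sg_add sg_diff sg_minus)

lemma rl_keys: "rl F \<Longrightarrow> - n \<in> kys F \<longleftrightarrow> n \<in> kys F"
  unfolding in_keys_iff rl_def by (metis sg_0 sg_sg)

text \<open>The involution whose fixed points are the real polynomials; its multiplicativity makes
  \<open>rl\<close> closed under products.\<close>

definition br :: "lpoly \<Rightarrow> lpoly" where
  "br F = (\<Sum>k\<in>kys F. sng (- k) (sg (cf F k)))"

lemma cf_br: "cf (br F) n = sg (cf F (- n))"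
proof -
  have "cf (br F) n = (\<Sum>k\<in>kys F. if k = - n then sg (cf F k) else 0)"
    unfolding br_def lookup_sum by (intro sum.cong) (auto simp: lookup_single when_def)
  then show ?thesis by (auto simp: in_keys_iff)
qed

lemma rl_iff_br: "rl F \<longleftrightarrow> br F = F"
  unfolding rl_def poly_mapping_eq_iff fun_eq_iff cf_br by (metis sg_sg minus_minus)

lemma br_sng [simp]: "br (sng k X) = sng (- k) (sg X)"
  by (rule poly_mapping_eqI) (auto simp: cf_br lookup_single when_def)

lemma br_add: "br (F + G) = br F + br G"
  by (rule poly_mapping_eqI) (simp add: cf_br lookup_add sg_add)

lemma br_mult: "br (F * G) = br F * br G"
proof (rule lpoly_hom_multI)
  show "br 0 = 0" by (rule poly_mapping_eqI) (simp add: cf_br)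
qed (simp_all add: br_add mult_single sg_mult)

lemma rl_mult: "rl F \<Longrightarrow> rl G \<Longrightarrow> rl (F * G)"
  by (simp add: rl_iff_br br_mult)

lemma sg_ev: "rl F \<Longrightarrow> sg (ev F (complex_of_real x)) = ev F (complex_of_real x)"
proof -
  assume rl: "rl F"
  have "sg (ev F (of_real x)) = (\<Sum>k\<in>kys F. scl (exp (\<i> * of_int (- k) * of_real x)) * cf F (- k))"
    using rl unfolding ev_def by (auto simp: sg_sum sg_mult sg_scl exp_cnj rl_def intro!: sum.cong)
  also have "\<dots> = ev F (of_real x)"
    unfolding ev_def using rl_keys[OF rl]
    by (intro sum.reindex_bij_witness[of _ "uminus" "uminus"]) auto
  finally show ?thesis .
qed

section \<open>Mode-wise operators and translation\<close>

definition mapc :: "(int \<Rightarrow> m2 \<Rightarrow> m2) \<Rightarrow> lpoly \<Rightarrow> lpoly" where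
  "mapc \<phi> F = Poly_Mapping.mapp \<phi> F"

lemma cf_mapc: "(\<And>n. \<phi> n 0 = 0) \<Longrightarrow> cf (mapc \<phi> F) n = \<phi> n (cf F n)"
  by (auto simp: mapc_def lookup_mapp when_def in_keys_iff)

lemma rl_mapc:
  assumes "\<And>n. \<phi> n 0 = 0" "\<And>n X. \<phi> (- n) (sg X) = sg (\<phi> n X)" "rl F"
  shows "rl (mapc \<phi> F)"
  using assms by (simp add: rl_def cf_mapc)

lemma cf_cst_mult: "cf (cst A * F) n = A * cf F n" "cf (F * cst A) n = cf F n * A"
proof -
  have "cst A * F = (\<Sum>k\<in>kys F. sng k (A * cf F k))" "F * cst A = (\<Sum>k\<in>kys F. sng k (cf F k * A))"
    unfolding lpoly_mult_expansion by (cases "A = 0"; simp)+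
  moreover have "cf (\<Sum>k\<in>kys F. sng k (f (cf F k))) n = f (cf F n)" if "f 0 = 0" for f
  proof -
    have "cf (\<Sum>k\<in>kys F. sng k (f (cf F k))) n = (\<Sum>k\<in>kys F. if k = n then f (cf F k) else 0)"
      unfolding lookup_sum by (intro sum.cong) (auto simp: lookup_single when_def)
    then show ?thesis using that by (auto simp: in_keys_iff)
  qed
  from this[of "\<lambda>X. A * X"] this[of "\<lambda>X. X * A"]
  have "cf (\<Sum>k\<in>kys F. sng k (A * cf F k)) n = A * cf F n" "cf (\<Sum>k\<in>kys F. sng k (cf F k * A)) n = cf F n * A"
    by simp_all
  ultimately show "cf (cst A * F) n = A * cf F n" "cf (F * cst A) n = cf F n * A"
    by simp_all
qed

text \<open>Translation by \<beta> in Fourier coordinates; its phases are the source of the small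
  divisors.\<close>

definition shift :: "real \<Rightarrow> lpoly \<Rightarrow> lpoly" where
  "shift \<beta> = mapc (\<lambda>n X. scl (cis (of_int n * \<beta>)) * X)"

lemma cf_shift: "cf (shift \<beta> F) n = scl (cis (of_int n * \<beta>)) * cf F n"
  by (simp add: shift_def cf_mapc)

lemma shift_sng: "shift \<beta> (sng k X) = sng k (scl (cis (of_int k * \<beta>)) * X)"
  by (rule poly_mapping_eqI) (auto simp: cf_shift lookup_single when_def)

lemma ev_shift: "ev (shift \<beta> F) z = ev F (z + of_real \<beta>)"
proof -
  have "kys (shift \<beta> F) \<subseteq> kys F"
    by (auto simp: in_keys_iff cf_shift)
  then have "ev (shift \<beta> F) z = (\<Sum>k\<in>kys F. scl (exp (\<i> * of_int k * z)) * (scl (cis (of_int k * \<beta>)) * cf F k))"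
    by (simp add: ev_superset[where S = "kys F"] cf_shift)
  also have "\<dots> = ev F (z + of_real \<beta>)"
    unfolding ev_def
    by (intro sum.cong refl) (simp add: scl_mult_left cis_conv_exp exp_add[symmetric] algebra_simps)
  finally show ?thesis .
qed

lemma nrm_shift [simp]: "nrm h (shift \<beta> F) = nrm h F"
  by (intro antisym nrm_le) (simp_all add: cf_shift)

lemma rl_shift: "rl F \<Longrightarrow> rl (shift \<beta> F)"
  by (simp add: rl_def cf_shift sg_mult sg_scl cis_cnj)

lemma ev_periodic: "ev F (z + 2 * of_real pi) = ev F z"
  unfolding ev_def
proof (intro sum.cong refl arg_cong2[where f = "(*)"] arg_cong[where f = scl])
  fix k
  have "exp (\<i> * of_int k * (z + 2 * of_real pi)) = exp (\<i> * of_int k * z) * exp (2 * of_int k * pi * \<i>)"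
    by (simp add: exp_add[symmetric] algebra_simps)
  also have "exp (2 * of_int k * pi * \<i>) = 1"
    using exp_integer_2pi[of "of_int k"] by simp
  finally show "exp (\<i> * of_int k * (z + 2 * of_real pi)) = exp (\<i> * of_int k * z)" by simp
qed

subsection \<open>Conjugation up to scalar functions\<close>

text \<open>The \<open>SU(1,1)\<close> form of \<open>psl_analytic_on_strip\<close>. The sign is
  needed for rotations by an odd multiple of half the angle.\<close>

definition sl_on :: "real \<Rightarrow> (complex \<Rightarrow> m2) \<Rightarrow> bool" where
  "sl_on h Z \<longleftrightarrow>
     (\<lambda>z. e11 (Z z)) holomorphic_on strip h \<and> (\<lambda>z. e12 (Z z)) holomorphic_on strip h \<and>
     (\<lambda>z. e21 (Z z)) holomorphic_on strip h \<and> (\<lambda>z. e22 (Z z)) holomorphic_on strip h \<and>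
     (\<forall>x. sg (Z (complex_of_real x)) = Z (complex_of_real x)) \<and>
     (\<forall>z\<in>strip h. det2 (Z z) = 1) \<and>
     (\<exists>s\<in>{1, -1}. \<forall>z\<in>strip h. Z (z + 2 * of_real pi) = scl s * Z z)"

text \<open>The scalar factor \<open>g\<close> frees the conjugated cocycle from the constraint that its
  determinant be 1; it is removed once, at the very end.\<close>

definition cj :: "real \<Rightarrow> real \<Rightarrow> (complex \<Rightarrow> m2) \<Rightarrow> (complex \<Rightarrow> m2) \<Rightarrow> bool" where
  "cj \<beta> h B B' \<longleftrightarrow> (\<exists>Z g. sl_on h Z \<and> continuous_on (strip h) g \<and>
     (\<forall>z\<in>strip h. Z (z + of_real \<beta>) * B z = scl (g z) * (B' z * Z z)))"

lemma strip_mono: "h' \<le> h \<Longrightarrow> strip h' \<subseteq> strip h"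
  by (auto simp: strip_def)

lemma strip_add_real [simp]: "z + of_real x \<in> strip h \<longleftrightarrow> z \<in> strip h"
  by (simp add: strip_def)

lemma strip_add_2pi [simp]: "z + 2 * of_real pi \<in> strip h \<longleftrightarrow> z \<in> strip h"
  by (simp add: strip_def)

lemma m2_mult_sel:
  "e11 (X * Y) = e11 X * e11 Y + e12 X * e21 Y" "e12 (X * Y) = e11 X * e12 Y + e12 X * e22 Y"
  "e21 (X * Y) = e21 X * e11 Y + e22 X * e21 Y" "e22 (X * Y) = e21 X * e12 Y + e22 X * e22 Y"
  by (simp_all add: times_m2_def)

lemma sl_on_mult:
  assumes "sl_on h Z" "sl_on h W"
  shows "sl_on h (\<lambda>z. Z z * W z)"
proof -
  obtain s where s: "s \<in> {1, -1}" "\<forall>z\<in>strip h. Z (z + 2 * of_real pi) = scl s * Z z"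
    using assms(1) unfolding sl_on_def by blast
  obtain r where r: "r \<in> {1, -1}" "\<forall>z\<in>strip h. W (z + 2 * of_real pi) = scl r * W z"
    using assms(2) unfolding sl_on_def by blast
  have "s * r \<in> {1, -1}" "\<forall>z\<in>strip h. Z (z + 2 * of_real pi) * W (z + 2 * of_real pi) = scl (s * r) * (Z z * W z)"
    using s r by (auto simp: scl_mult_mult)
  then have "\<exists>s\<in>{1, -1}. \<forall>z\<in>strip h. Z (z + 2 * of_real pi) * W (z + 2 * of_real pi) = scl s * (Z z * W z)"
    by blast
  with assms show ?thesis
    unfolding sl_on_def m2_mult_sel det2_mult sg_mult
    by (intro conjI allI ballI holomorphic_intros) (simp_all only: mult_1)
qed

lemma sl_on_mono: "sl_on h Z \<Longrightarrow> h' \<le> h \<Longrightarrow> sl_on h' Z"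
  using strip_mono[of h' h] unfolding sl_on_def by (meson holomorphic_on_subset subsetD)

lemma sl_on_const: "sg P = P \<Longrightarrow> det2 P = 1 \<Longrightarrow> sl_on h (\<lambda>_. P)"
  by (auto simp: sl_on_def intro!: bexI[of _ 1])

lemma cj_trans:
  assumes "cj \<beta> h B B'" "cj \<beta> h B' B''"
  shows "cj \<beta> h B B''"
proof -
  obtain Z g where Z: "sl_on h Z" "continuous_on (strip h) g"
    "\<And>z. z \<in> strip h \<Longrightarrow> Z (z + of_real \<beta>) * B z = scl (g z) * (B' z * Z z)"
    using assms(1) unfolding cj_def by blast
  obtain W k where W: "sl_on h W" "continuous_on (strip h) k"
    "\<And>z. z \<in> strip h \<Longrightarrow> W (z + of_real \<beta>) * B' z = scl (k z) * (B'' z * W z)"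
    using assms(2) unfolding cj_def by blast
  have "W (z + of_real \<beta>) * Z (z + of_real \<beta>) * B z = scl (k z * g z) * (B'' z * (W z * Z z))"
    if z: "z \<in> strip h" for z
  proof -
    have "W (z + of_real \<beta>) * Z (z + of_real \<beta>) * B z = W (z + of_real \<beta>) * (scl (g z) * (B' z * Z z))"
      by (simp add: mult.assoc Z(3)[OF z])
    also have "\<dots> = scl (g z) * (W (z + of_real \<beta>) * B' z * Z z)"
      by (metis mult.assoc scl_comm)
    also have "\<dots> = scl (k z * g z) * (B'' z * (W z * Z z))"
      by (simp add: W(3)[OF z] mult.assoc scl_mult_left mult.commute)
    finally show ?thesis .
  qed
  then show ?thesis
    unfolding cj_def
    by (intro exI[of _ "\<lambda>z. W z * Z z"] exI[of _ "\<lambda>z. k z * g z"])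
       (auto intro!: sl_on_mult W Z continuous_intros)
qed

lemma cj_mono: "cj \<beta> h B B' \<Longrightarrow> h' \<le> h \<Longrightarrow> cj \<beta> h' B B'"
  unfolding cj_def using strip_mono[of h' h]
  by (meson continuous_on_subset sl_on_mono subsetD)

lemma cj_sl_on:
  assumes "sl_on h Z" "\<And>z. z \<in> strip h \<Longrightarrow> Z (z + of_real \<beta>) * B z = B' z * Z z"
  shows "cj \<beta> h B B'"
  unfolding cj_def using assms by (intro exI[of _ Z] exI[of _ "\<lambda>_. 1"]) auto

lemma cj_refl: "cj \<beta> h B B"
  by (rule cj_sl_on[OF sl_on_const[of 1]]) simp_all

section \<open>Conjugations close to the identity\<close>

lemma holomorphic_ev:
  "(\<lambda>z. e11 (ev F z)) holomorphic_on S" "(\<lambda>z. e12 (ev F z)) holomorphic_on S"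
  "(\<lambda>z. e21 (ev F z)) holomorphic_on S" "(\<lambda>z. e22 (ev F z)) holomorphic_on S"
proof -
  have s: "e11 (sum f K) = (\<Sum>k\<in>K. e11 (f k))" "e12 (sum f K) = (\<Sum>k\<in>K. e12 (f k))"
    "e21 (sum f K) = (\<Sum>k\<in>K. e21 (f k))" "e22 (sum f K) = (\<Sum>k\<in>K. e22 (f k))"
    for f :: "int \<Rightarrow> m2" and K
    by (induction K rule: infinite_finite_induct) (auto simp: zero_m2_def plus_m2_def)
  show "(\<lambda>z. e11 (ev F z)) holomorphic_on S" "(\<lambda>z. e12 (ev F z)) holomorphic_on S"
  "(\<lambda>z. e21 (ev F z)) holomorphic_on S" "(\<lambda>z. e22 (ev F z)) holomorphic_on S"
    unfolding ev_def s by (auto simp: scl_def times_m2_def intro!: holomorphic_intros)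
qed

text \<open>By Cayley-Hamilton a traceless matrix squares to minus its determinant, so
  \<open>1 - X\<close> inverts \<open>1 + X\<close> up to a scalar: a polynomial substitute for the
  inverse.\<close>

lemma one_plus_traceless_mult:
  assumes "tr2 X = 0"
  shows "(1 - X) * (1 + X) = scl (1 + det2 X)" "det2 (1 + X) = 1 + det2 X"
proof -
  have *: "e22 X = - e11 X" using assms by (simp add: tr2_def eq_neg_iff_add_eq_0 add.commute)
  show "(1 - X) * (1 + X) = scl (1 + det2 X)" "det2 (1 + X) = 1 + det2 X"
    by (simp_all add: * m2_defs scl_def det2_def algebra_simps)
qed

lemma tr2_ev: "(\<And>n. tr2 (cf Y n) = 0) \<Longrightarrow> tr2 (ev Y z) = 0"
proof -
  assume *: "\<And>n. tr2 (cf Y n) = 0"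
  have "tr2 (sum f K) = (\<Sum>k\<in>K. tr2 (f k))" for f :: "int \<Rightarrow> m2" and K
    by (induction K rule: infinite_finite_induct) (auto simp: zero_m2_def plus_m2_def tr2_def)
  moreover have "tr2 (scl a * cf Y k) = a * tr2 (cf Y k)" for a k
    by (simp add: tr2_def scl_def times_m2_def distrib_left)
  ultimately show ?thesis by (simp add: ev_def *)
qed

definition scalar :: "lpoly \<Rightarrow> bool" where
  "scalar C \<longleftrightarrow> (\<forall>n. \<exists>a. cf C n = scl a)"

lemma ev_scalar: "scalar C \<Longrightarrow> ev C z = scl (e11 (ev C z))"
proof -
  assume *: "scalar C"
  have "\<exists>a. (\<Sum>k\<in>K. scl (f k) * cf C k) = scl a" for f K
  proof (induction K rule: infinite_finite_induct)
    case (insert k K)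
    obtain a b where "cf C k = scl a" "(\<Sum>k\<in>K. scl (f k) * cf C k) = scl b"
      using insert * unfolding scalar_def by blast
    with insert(1,2) have "(\<Sum>k\<in>insert k K. scl (f k) * cf C k) = scl (f k * a + b)"
      by (simp add: scl_mult scl_add)
    then show ?case ..
  qed (auto intro: exI[of _ 0])
  then obtain a where "ev C z = scl a" unfolding ev_def by meson
  then show ?thesis by (simp add: scl_def)
qed

text \<open>The conjugation is \<open>1 + Y\<close> divided by the root of its determinant. That
  root, the defect of \<open>1 - Y\<close> as an inverse, and the nonvanishing scalar
  \<open>1 + C\<close> all go into the factor \<open>g\<close>, so the new cocycle is again a
  Laurent polynomial.\<close>

lemma cj_near_identity:
  assumes h: "0 \<le> h" and Y: "rl Y" "\<And>n. tr2 (cf Y n) = 0" "nrm h Y < 1"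
    and C: "scalar C" "nrm h C < 1"
  shows "cj \<beta> h (ev B) (ev ((1 + C) * (1 + shift \<beta> Y) * B * (1 - Y)))"
proof -
  define d where "d z = 1 + det2 (ev Y z)" for z
  define c where "c z = e11 (ev C z)" for z
  define Z where "Z z = scl (1 / csqrt (d z)) * (1 + ev Y z)" for z
  define g where "g z = 1 / (csqrt (d (z + of_real \<beta>)) * (1 + c z) * csqrt (d z))" for z
  \<comment> \<open>Puts \<open>d\<close> into the right half-plane, where \<open>csqrt\<close> is
    holomorphic and commutes with conjugation.\<close>
  have det_small: "norm (det2 (ev Y z)) < 1" if "z \<in> strip h" for z
  proof -
    have "norm (det2 (ev Y z)) \<le> (nm (ev Y z))\<^sup>2" by (rule norm_det2)
    also have "\<dots> \<le> (nrm h Y)\<^sup>2"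
      using that by (intro power_mono nm_ev_le) (auto simp: strip_def)
    also have "\<dots> < 1" using Y(3) by (simp add: abs_square_less_1)
    finally show ?thesis .
  qed
  have Re_d: "0 < Re (d z)" if "z \<in> strip h" for z
    using det_small[OF that] abs_Re_le_cmod[of "det2 (ev Y z)"] by (simp add: d_def)
  have dnz: "d z \<noteq> 0" "d z \<notin> \<real>\<^sub>\<le>\<^sub>0" if "z \<in> strip h" for z
    using Re_d[OF that] by (auto simp: complex_nonpos_Reals_iff)
  have c1: "1 + c z \<noteq> 0" if "z \<in> strip h" for z
  proof -
    have "norm (c z) < 1"
      using nm_entries(1)[of "ev C z"] nm_ev_le[of z h C] that C(2) by (auto simp: c_def strip_def)
    then show ?thesis by (metis add_eq_0_iff norm_minus_cancel norm_one less_irrefl)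
  qed
  have hol_d: "d holomorphic_on strip h"
    unfolding d_def det2_def by (intro holomorphic_intros holomorphic_ev)
  have hol_s: "(\<lambda>z. csqrt (d z)) holomorphic_on strip h"
    using dnz(2) by (intro holomorphic_on_csqrt' hol_d) auto
  have hol_i: "(\<lambda>z. 1 / csqrt (d z)) holomorphic_on strip h"
    by (intro holomorphic_intros hol_s) (use dnz in auto)
  have ev1: "e11 (1 + ev Y z) = 1 + e11 (ev Y z)" "e12 (1 + ev Y z) = e12 (ev Y z)"
    "e21 (1 + ev Y z) = e21 (ev Y z)" "e22 (1 + ev Y z) = 1 + e22 (ev Y z)" for z
    by (simp_all add: m2_defs)
  have sZ: "e11 (Z z) = 1 / csqrt (d z) * e11 (1 + ev Y z)" "e12 (Z z) = 1 / csqrt (d z) * e12 (1 + ev Y z)"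
    "e21 (Z z) = 1 / csqrt (d z) * e21 (1 + ev Y z)" "e22 (Z z) = 1 / csqrt (d z) * e22 (1 + ev Y z)" for z
    by (simp_all add: Z_def scl_def times_m2_def)
  have "sl_on h Z"
    unfolding sl_on_def
  proof (intro conjI allI ballI)
    show "(\<lambda>z. e11 (Z z)) holomorphic_on strip h" "(\<lambda>z. e12 (Z z)) holomorphic_on strip h"
      "(\<lambda>z. e21 (Z z)) holomorphic_on strip h" "(\<lambda>z. e22 (Z z)) holomorphic_on strip h"
      unfolding sZ ev1 by (intro holomorphic_intros holomorphic_ev hol_i)+
  next
    fix x :: real
    have "cnj (d x) = d x"
      unfolding d_def by (simp add: sg_ev[OF Y(1)] flip: det2_sg)
    moreover have "of_real x \<in> strip h \<or> h = 0" using h by (auto simp: strip_def)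
    moreover have "cnj (csqrt w) = csqrt w" if w: "cnj w = w" "0 < Re w" for w
    proof -
      have "w = of_real (Re w)" using w(1) by (simp add: complex_eq_iff)
      then obtain r where "w = of_real r" "r > 0" using w(2) by metis
      then show ?thesis by (simp add: csqrt_of_real)
    qed
    \<comment> \<open>Reality is demanded at every real point, even for \<open>h = 0\<close>, when
      the strip is empty; hence the bound is derived again without membership in the strip.\<close>
    moreover have "0 < Re (d x)"
    proof -
      have "norm (det2 (ev Y x)) \<le> (nm (ev Y x))\<^sup>2" by (rule norm_det2)
      also have "\<dots> \<le> (nrm h Y)\<^sup>2"
        by (intro power_mono nm_ev_le) (auto simp: h)
      also have "\<dots> < 1" using Y(3) by (simp add: abs_square_less_1)
      finally show ?thesis using abs_Re_le_cmod[of "det2 (ev Y x)"] by (simp add: d_def)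
    qed
    ultimately show "sg (Z x) = Z x"
      by (simp add: Z_def sg_mult sg_scl sg_add sg_ev[OF Y(1)])
  next
    fix z assume z: "z \<in> strip h"
    have "det2 (Z z) = (1 / csqrt (d z))\<^sup>2 * d z"
      by (simp add: Z_def det2_scl one_plus_traceless_mult(2)[OF tr2_ev[OF Y(2)]] d_def)
    then show "det2 (Z z) = 1" using dnz[OF z] by (simp add: power_divide)
  next
    show "\<exists>s\<in>{1, -1}. \<forall>z\<in>strip h. Z (z + 2 * of_real pi) = scl s * Z z"
      by (intro bexI[of _ 1]) (auto simp: Z_def d_def ev_periodic)
  qed
  moreover have "continuous_on (strip h) g"
  proof -
    have 1: "(\<lambda>z. csqrt (d (z + of_real \<beta>))) holomorphic_on strip h"
      by (rule holomorphic_on_compose_gen[of "\<lambda>z. z + of_real \<beta>" "strip h", OF _ hol_s, unfolded o_def])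
         (auto intro!: holomorphic_intros)
    have "g holomorphic_on strip h"
      unfolding g_def c_def
      by (intro holomorphic_intros 1 holomorphic_ev hol_s) (use dnz c1 in \<open>auto simp: c_def\<close>)
    then show ?thesis by (rule holomorphic_on_imp_continuous_on)
  qed
  moreover have "Z (z + of_real \<beta>) * ev B z =
      scl (g z) * (ev ((1 + C) * (1 + shift \<beta> Y) * B * (1 - Y)) z * Z z)" if z: "z \<in> strip h" for z
  proof -
    define X where "X = (1 + ev Y (z + of_real \<beta>)) * ev B z"
    have "ev ((1 + C) * (1 + shift \<beta> Y) * B * (1 - Y)) z * Z z =
      scl (1 + c z) * X * (1 - ev Y z) * (scl (1 / csqrt (d z)) * (1 + ev Y z))"
      unfolding Z_def X_def ev_mult ev_add ev_diff ev_1 ev_shift scl_add scl_1 c_def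
      by (subst ev_scalar[OF C(1)]) (simp add: mult.assoc)
    also have "\<dots> = scl ((1 + c z) * (1 / csqrt (d z))) * (X * ((1 - ev Y z) * (1 + ev Y z)))"
      using scl_mult_mult[of "1 + c z" "X * (1 - ev Y z)"] by (simp add: mult.assoc)
    also have "\<dots> = scl ((1 + c z) * (1 / csqrt (d z)) * d z) * X"
      unfolding one_plus_traceless_mult(1)[OF tr2_ev[OF Y(2)]] d_def[symmetric] scl_comm
      by (simp add: scl_mult_left)
    also have "(1 + c z) * (1 / csqrt (d z)) * d z = (1 + c z) * csqrt (d z)"
      using dnz[OF z] by (simp add: field_simps flip: power2_eq_square)
    finally have *: "ev ((1 + C) * (1 + shift \<beta> Y) * B * (1 - Y)) z * Z z = scl ((1 + c z) * csqrt (d z)) * X" .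
    have "g z * ((1 + c z) * csqrt (d z)) = 1 / csqrt (d (z + of_real \<beta>))"
      using dnz[OF z] c1[OF z] by (simp add: g_def)
    then show ?thesis
      unfolding * scl_mult_left by (simp add: Z_def X_def mult.assoc)
  qed
  ultimately show ?thesis unfolding cj_def by blast
qed

text \<open>The subtracted bracket is the linearisation in \<open>C\<close>, \<open>Y\<close>,
  \<open>Y'\<close> and \<open>F\<close>. Every other term contains two small factors, at least one
  of them bounded by \<open>y\<close>; the expansion gives
  \<open>5 * y * f + 42 * y * y\<close>.\<close>

lemma near_identity_remainder:
  assumes h: "0 \<le> h" and n: "nrm h Y \<le> y" "nrm h Y' \<le> y" "nrm h C \<le> y" "nrm h F \<le> f" "nrm h A \<le> 10"
    and le: "y \<le> 1" "f \<le> 1"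
  shows "nrm h ((1 + C) * (1 + Y') * (A + F) * (1 - Y) - A - (F + C * A + Y' * A - A * Y)) \<le> 50 * y * (y + f)"
proof -
  have y0: "0 \<le> y" and f0: "0 \<le> f" using n(1,4) nrm_nonneg order_trans by blast+
  note mm = order_trans[OF nrm_mult[OF h] mult_mono]
  define R where "R = Y' * F - F * Y - Y' * (A + F) * Y"
  have eq: "(1 + C) * (1 + Y') * (A + F) * (1 - Y) - A - (F + C * A + Y' * A - A * Y) =
    R + C * (F + Y' * A - A * Y + R)"
    by (simp add: R_def algebra_simps)
  have t1: "nrm h (Y' * F) \<le> y * f" "nrm h (F * Y) \<le> f * y"
    by (intro mm; use n y0 f0 in simp)+
  have t2: "nrm h (Y' * A) \<le> y * 10" "nrm h (A * Y) \<le> 10 * y"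
    by (intro mm; use n y0 f0 in simp)+
  have AF: "nrm h (A + F) \<le> 11" using nrm_add[of h A F] n le by simp
  have "nrm h (Y' * (A + F)) \<le> y * 11"
    by (intro mm n(2) AF y0 nrm_nonneg)
  then have t3: "nrm h (Y' * (A + F) * Y) \<le> y * 11 * y"
    by (rule mm) (use n y0 in simp_all)
  have R: "nrm h R \<le> 2 * (y * f) + 11 * (y * y)"
    using nrm_diff[of h "Y' * F - F * Y" "Y' * (A + F) * Y"] nrm_diff[of h "Y' * F" "F * Y"] t1 t3
    unfolding R_def by (simp add: mult_ac)
  have "nrm h (F + Y' * A - A * Y + R) \<le> f + 20 * y + nrm h R"
    using nrm_add[of h "F + Y' * A - A * Y" R] nrm_diff[of h "F + Y' * A" "A * Y"] nrm_add[of h F "Y' * A"] n(4) t2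
    by simp
  also have "\<dots> \<le> 3 * f + 31 * y"
  proof -
    have "y * f \<le> 1 * f" "y * y \<le> 1 * y" using y0 f0 le by (intro mult_right_mono; simp)+
    then show ?thesis using R by simp
  qed
  finally have "nrm h (C * (F + Y' * A - A * Y + R)) \<le> y * (3 * f + 31 * y)"
    by (intro mm) (use n y0 f0 in simp_all)
  then have "nrm h (R + C * (F + Y' * A - A * Y + R)) \<le> 5 * (y * f) + 42 * (y * y)"
    using nrm_add[of h R "C * (F + Y' * A - A * Y + R)"] R by (simp add: algebra_simps)
  also have "\<dots> \<le> 50 * y * (y + f)"
    using mult_nonneg_nonneg[OF y0 f0] mult_nonneg_nonneg[OF y0 y0] by (simp add: algebra_simps)
  finally show ?thesis unfolding eq .
qed

subsection \<open>The linearised equation\<close>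

text \<open>For eigenvalues \<mu> and \<nu> of \<open>A\<close> this is
  \<open>(\<mu> - q * \<nu>) * (\<nu> - q * \<mu>)\<close>, written symmetrically so that it makes
  sense without diagonalising, in particular at a double eigenvalue.\<close>

definition gap :: "m2 \<Rightarrow> complex \<Rightarrow> complex" where
  "gap A q = (1 + q)\<^sup>2 * det2 A - q * (tr2 A)\<^sup>2"

definition sylv :: "m2 \<Rightarrow> complex \<Rightarrow> m2 \<Rightarrow> m2" where
  "sylv A q G = (let H = (scl (tr2 A) * adj2 A - scl ((1 + q) * det2 A)) * G
     in scl (1 / ((1 - q) * det2 A * gap A q)) * (A * H - scl q * (H * adj2 A)))"

text \<open>Write \<open>L(X), R(X)\<close> for left and right multiplication by \<open>X\<close>. By Cayley--Hamilton
  \<open>(L(A) - q R(A)) (L(A) - q R(adj A))\<close> is left multiplication by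
  \<open>(1 - q) (tr(A) A - (1 + q) det A)\<close>, whose determinant is a multiple of \<open>gap A q\<close>.\<close>

lemma sylv_eq:
  assumes "q \<noteq> 1" "det2 A \<noteq> 0" "gap A q \<noteq> 0"
  shows "A * sylv A q G - scl q * (sylv A q G * A) = G"
proof -
  define H where "H = (scl (tr2 A) * adj2 A - scl ((1 + q) * det2 A)) * G"
  define N where "N = A * H - scl q * (H * adj2 A)"
  have "A * N - scl q * (N * A) = scl (1 - q) * ((scl (tr2 A) * A - scl ((1 + q) * det2 A)) * H)"
    unfolding N_def
    by (rule m2_eqI; simp add: m2_defs scl_def adj2_def tr2_def det2_def algebra_simps)
  also have "(scl (tr2 A) * A - scl ((1 + q) * det2 A)) * H = scl (det2 A * gap A q) * G"
  proof -
    have "(scl (tr2 A) * A - scl ((1 + q) * det2 A)) * (scl (tr2 A) * adj2 A - scl ((1 + q) * det2 A))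
        = scl (det2 A * gap A q)"
      by (rule m2_eqI; simp add: m2_defs scl_def adj2_def tr2_def det2_def gap_def power2_eq_square algebra_simps)
    then show ?thesis by (simp add: H_def flip: mult.assoc)
  qed
  finally have N: "A * N - scl q * (N * A) = scl ((1 - q) * det2 A * gap A q) * G"
    by (simp add: scl_mult_left mult.assoc)
  define k where "k = 1 / ((1 - q) * det2 A * gap A q)"
  have S: "sylv A q G = scl k * N"
    by (simp add: sylv_def H_def N_def k_def Let_def)
  have "A * (scl k * N) - scl q * (scl k * N * A) = scl k * (A * N - scl q * (N * A))"
    by (simp add: right_diff_distrib scl_mult_left mult.commute[of k] mult.assoc) (metis mult.assoc scl_comm)
  also have "\<dots> = G"
    using assms by (simp add: N scl_mult_left k_def)
  finally show ?thesis by (simp add: S)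
qed

text \<open>Mode \<open>- n\<close> has the conjugate phase, so this symmetry keeps the mode-wise
  solution real.\<close>

lemma sylv_sg:
  assumes "sg A = A"
  shows "sylv A (cnj q) (sg G) = sg (sylv A q G)"
proof -
  have t: "cnj (tr2 A) = tr2 A" and d: "cnj (det2 A) = det2 A"
    using tr2_sg[of A] det2_sg[of A] assms by simp_all
  have g: "gap A (cnj q) = cnj (gap A q)"
    by (simp add: gap_def t d)
  show ?thesis
    by (simp add: sylv_def Let_def sg_mult sg_diff sg_scl sg_adj2 assms t d g)
qed

lemma sylv_0 [simp]: "sylv A q 0 = 0"
  by (simp add: sylv_def)

lemma nm_sylv:
  assumes "nm A \<le> 10" "norm q = 1" "1/2 \<le> norm (det2 A)" "norm (det2 A) \<le> 2"
  shows "nm (sylv A q G) \<le> 5000 / (norm (1 - q) * norm (gap A q)) * nm G"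
proof -
  define H where "H = (scl (tr2 A) * adj2 A - scl ((1 + q) * det2 A)) * G"
  have "norm (1 + q) \<le> 2" using norm_triangle_ineq[of 1 q] assms(2) by simp
  then have "norm (1 + q) * norm (det2 A) \<le> 2 * 2" using assms by (intro mult_mono) auto
  moreover have "norm (tr2 A) * nm A \<le> 10 * 10"
    using norm_tr2[of A] assms by (intro mult_mono) auto
  ultimately have "nm (scl (tr2 A) * adj2 A - scl ((1 + q) * det2 A)) \<le> 108"
    using nm_diff[of "scl (tr2 A) * adj2 A" "scl ((1 + q) * det2 A)"] by (simp add: nm_scl norm_mult)
  then have H: "nm H \<le> 108 * nm G"
    unfolding H_def by (intro order_trans[OF nm_mult mult_mono]) auto
  have "nm (A * H) \<le> 10 * (108 * nm G)" "nm (H * adj2 A) \<le> (108 * nm G) * 10"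
    using H assms by (intro order_trans[OF nm_mult mult_mono]; simp)+
  then have N: "nm (A * H - scl q * (H * adj2 A)) \<le> 2160 * nm G"
    using nm_diff[of "A * H" "scl q * (H * adj2 A)"] assms(2) by simp
  have "1 / norm (det2 A) \<le> 2" using frac_le[of 1 1 "1/2" "norm (det2 A)"] assms(3) by simp
  then have "nm (sylv A q G) \<le> 2 * (1 / (norm (1 - q) * norm (gap A q))) * (2160 * nm G)"
    using mult_mono[OF mult_right_mono[of "1 / norm (det2 A)" 2 "1 / (norm (1 - q) * norm (gap A q))"] N]
    by (simp add: sylv_def Let_def H_def norm_mult norm_divide mult_ac)
  also have "\<dots> \<le> 5000 / (norm (1 - q) * norm (gap A q)) * nm G"
    by (simp add: divide_right_mono mult_right_mono)
  finally show ?thesis .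
qed

text \<open>The conjugation needs a traceless \<open>Y\<close>. Subtracting half the trace from the
  solution leaves an error \<open>(1 - q)\<close> times a multiple of \<open>A\<close>, which the
  scalar correction \<open>solC\<close> cancels.\<close>

definition solY :: "m2 \<Rightarrow> complex \<Rightarrow> m2 \<Rightarrow> m2" where
  "solY A q G = sylv A q G - scl (tr2 (sylv A q G) / 2)"

definition solC :: "m2 \<Rightarrow> complex \<Rightarrow> m2 \<Rightarrow> m2" where
  "solC A q G = scl (- ((1 - q) * tr2 (sylv A q G) / 2))"

lemma tr2_solY: "tr2 (solY A q G) = 0"
  by (simp add: solY_def tr2_def minus_m2_def scl_def)

lemma sol_eq:
  assumes "q \<noteq> 1" "det2 A \<noteq> 0" "gap A q \<noteq> 0"
  shows "G + solC A q G * A + scl q * solY A q G * A - A * solY A q G = 0"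
proof -
  define W where "W = sylv A q G"
  have "A * solY A q G - scl q * solY A q G * A - solC A q G * A = A * W - scl q * (W * A)"
    unfolding solY_def solC_def W_def[symmetric]
    by (rule m2_eqI; simp add: m2_defs scl_def tr2_def field_simps)
  then show ?thesis
    using sylv_eq[OF assms, of G] by (simp add: W_def algebra_simps)
qed

lemma sol_sg:
  assumes "sg A = A"
  shows "solY A (cnj q) (sg G) = sg (solY A q G)" "solC A (cnj q) (sg G) = sg (solC A q G)"
  using assms by (simp_all add: solY_def solC_def sylv_sg sg_diff sg_scl tr2_sg)

lemma nm_sol:
  assumes "nm A \<le> 10" "norm q = 1" "1/2 \<le> norm (det2 A)" "norm (det2 A) \<le> 2"
  shows "nm (solY A q G) \<le> 10000 / (norm (1 - q) * norm (gap A q)) * nm G"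
    and "nm (solC A q G) \<le> 10000 / (norm (1 - q) * norm (gap A q)) * nm G"
proof -
  have *: "nm (solY A q G) \<le> 2 * nm (sylv A q G)"
    using nm_diff[of "sylv A q G" "scl (tr2 (sylv A q G) / 2)"] norm_tr2[of "sylv A q G"]
    by (simp add: solY_def nm_scl)
  have "norm (1 - q) \<le> 2" using norm_triangle_ineq4[of 1 q] assms(2) by simp
  then have "norm (1 - q) * norm (tr2 (sylv A q G)) \<le> 2 * nm (sylv A q G)"
    using norm_tr2[of "sylv A q G"] by (intro mult_mono) auto
  then have **: "nm (solC A q G) \<le> 2 * nm (sylv A q G)"
    by (simp add: solC_def nm_scl norm_mult)
  show "nm (solY A q G) \<le> 10000 / (norm (1 - q) * norm (gap A q)) * nm G"
    "nm (solC A q G) \<le> 10000 / (norm (1 - q) * norm (gap A q)) * nm G"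
    using * ** nm_sylv[OF assms, of G] by simp_all
qed

lemma sol_0 [simp]: "solY A q 0 = 0" "solC A q 0 = 0"
  by (simp_all add: solY_def solC_def tr2_def zero_m2_def[symmetric]) (simp_all add: zero_m2_def)

subsection \<open>The KAM step\<close>

text \<open>\<open>\<phi>\<close> and \<open>\<psi>\<close> solve the linearised equation mode by mode for the part \<open>\<pi>\<close> of the perturbation.\<close>

lemma elimination_step:
  assumes h: "0 \<le> h" and A: "sg A = A" "nm A \<le> 10" and F: "rl F" "nrm h F \<le> f" "f \<le> 1"
    and y: "m * nrm h (mapc \<pi> F) \<le> y" "y < 1"
    and zero: "\<And>n. \<pi> n 0 = 0" "\<And>n. \<phi> n 0 = 0" "\<And>n. \<psi> n 0 = 0"
    and tr: "\<And>n X. tr2 (\<phi> n X) = 0" and sc: "\<And>n X. \<exists>a. \<psi> n X = scl a"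
    and sg: "\<And>n X. \<phi> (- n) (sg X) = sg (\<phi> n X)" "\<And>n X. \<psi> (- n) (sg X) = sg (\<psi> n X)"
    and bound: "\<And>n X. nm (\<phi> n X) \<le> m * nm (\<pi> n X)" "\<And>n X. nm (\<psi> n X) \<le> m * nm (\<pi> n X)"
    and eq: "\<And>n X. \<pi> n X + \<psi> n X * A + scl (cis (of_int n * \<beta>)) * \<phi> n X * A - A * \<phi> n X = 0"
  obtains B' where "rl B'" "cj \<beta> h (ev (cst A + F)) (ev B')"
    "nrm h (B' - cst A - (F - mapc \<pi> F)) \<le> 50 * y * (y + f)"
proof -
  define Y where "Y = mapc \<phi> F"
  define C where "C = mapc \<psi> F"
  define B' where "B' = (1 + C) * (1 + shift \<beta> Y) * (cst A + F) * (1 - Y)"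
  have Yn: "nrm h Y \<le> y" "nrm h C \<le> y"
    unfolding Y_def C_def using bound y
    by (auto intro!: order_trans[OF nrm_le_mult[where C = m and F = "mapc \<pi> F"] y(1)] simp: cf_mapc zero)
  have rl: "rl Y" "rl C" "rl (shift \<beta> Y)"
    unfolding Y_def C_def by (intro rl_mapc rl_shift zero sg F(1))+
  have lin: "F + C * cst A + shift \<beta> Y * cst A - cst A * Y = F - mapc \<pi> F"
  proof (rule poly_mapping_eqI)
    fix n
    show "cf (F + C * cst A + shift \<beta> Y * cst A - cst A * Y) n = cf (F - mapc \<pi> F) n"
      using eq[of n "cf F n"]
      by (simp add: lookup_add lookup_minus cf_cst_mult cf_shift Y_def C_def cf_mapc zero algebra_simps)
  qed
  show ?thesis
  proof
    show "rl B'"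
      unfolding B'_def by (intro rl_mult rl_add rl_diff rl rl_1 F(1)) (simp add: rl_cst A)
    show "cj \<beta> h (ev (cst A + F)) (ev B')"
      unfolding B'_def using rl Yn y(2) tr sc
      by (intro cj_near_identity h) (auto simp: Y_def C_def cf_mapc zero scalar_def)
    show "nrm h (B' - cst A - (F - mapc \<pi> F)) \<le> 50 * y * (y + f)"
      unfolding lin[symmetric] B'_def using Yn y(2) F A(2)
      by (intro near_identity_remainder h) auto
  qed
qed

text \<open>In a step the inverse divisors are of order \<open>x\<close> to the power \<open>-(10 \<tau> + 2)\<close>, and the quadratic
  remainder carries their square; this dictates the exponent \<open>20 \<tau> + 10\<close>.\<close>

definition admissible :: "nat \<Rightarrow> real \<Rightarrow> real \<Rightarrow> lpoly \<Rightarrow> bool" where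
  "admissible \<tau> h x B \<longleftrightarrow> rl B \<and> nm (cf B 0) \<le> 10 - x \<and>
     1/2 + x \<le> Re (det2 (cf B 0)) \<and> Re (det2 (cf B 0)) \<le> 2 - x \<and>
     nrm h (B - cst (cf B 0)) \<le> x ^ (20 * \<tau> + 10)"

lemma sg_fixed_real:
  assumes "sg A = A"
  shows "det2 A = of_real (Re (det2 A))" "tr2 A = of_real (Re (tr2 A))"
  using det2_sg[of A] tr2_sg[of A] assms by (simp_all add: complex_eq_iff)

lemma nm_cf_0_diff: "0 \<le> h \<Longrightarrow> nm (cf B 0 - A) \<le> nrm h (B - cst A)"
  using nm_cf_le_nrm[of h "B - cst A" 0] by (simp add: lookup_minus)

text \<open>The steps use this at \<open>x / 2\<close>. Then the norm condition on \<open>A\<close>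
  is just the old slack \<open>x\<close>, while the determinant needs only slack
  \<open>3/4 * x\<close>, leaving \<open>x / 4\<close> by which a resonant step may move it. Passing
  from \<open>A\<close> to the mean of \<open>B\<close> costs at most \<open>20 * r\<close> in the
  determinant.\<close>

lemma admissible_approx:
  assumes h: "0 \<le> h" and "rl B" and r: "nrm h (B - cst A) \<le> r" "r \<le> x ^ (20 * \<tau> + 10)" "40 * r \<le> x"
    and A: "nm A \<le> 10 - 2 * x" "1/2 + 3/2 * x \<le> Re (det2 A)" "Re (det2 A) \<le> 2 - 3/2 * x"
  shows "admissible \<tau> h x B"
proof -
  have d: "nm (cf B 0 - A) \<le> r"
    using nm_cf_0_diff[OF h] r(1) by (rule order_trans)
  have r0: "0 \<le> r" using r(1) nrm_nonneg order_trans by blast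
  have n0: "nm (cf B 0) \<le> 10 - x"
    using nm_add[of A "cf B 0 - A"] d A(1) r(3) r0 by simp
  have "norm (det2 (cf B 0) - det2 A) \<le> r * 20"
    by (intro order_trans[OF norm_det2_diff mult_mono]) (use n0 d A(1) r0 r(3) in auto)
  then have "\<bar>Re (det2 (cf B 0)) - Re (det2 A)\<bar> \<le> x / 2"
    using abs_Re_le_cmod[of "det2 (cf B 0) - det2 A"] r(3) by simp
  moreover have "nrm h (B - cst (cf B 0)) \<le> nrm h (B - cst A)"
    by (rule nrm_le) (auto simp: lookup_minus lookup_single when_def)
  ultimately show ?thesis
    using assms n0 by (auto simp: admissible_def abs_if split: if_splits)
qed

lemma admissible_mono: "admissible \<tau> h x B \<Longrightarrow> h' \<le> h \<Longrightarrow> admissible \<tau> h' x B"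
  unfolding admissible_def using nrm_mono[of h' h "B - cst (cf B 0)"] by auto

text \<open>Shrinking the strip by \<open>x\<close> multiplies the weight of mode \<open>n\<close>
  by the exponential of \<open>- x\<close> times its modulus.\<close>

lemma nrm_high_modes:
  assumes "\<And>n. \<bar>real_of_int n\<bar> * b \<le> 1 \<Longrightarrow> cf G n = 0" "\<And>n. nm (cf G n) \<le> nm (cf F n)" "0 < b" "0 < x"
  shows "nrm (h - x) G \<le> exp (- x / b) * nrm h F"
proof (rule nrm_weight_le)
  fix n
  show "nm (cf G n) * exp ((h - x) * \<bar>real_of_int n\<bar>) \<le> exp (- x / b) * (nm (cf F n) * exp (h * \<bar>real_of_int n\<bar>))"
  proof (cases "\<bar>real_of_int n\<bar> * b \<le> 1")
    case True
    then show ?thesis by (simp add: assms)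
  next
    case False
    then have "1 / b \<le> \<bar>real_of_int n\<bar>" using assms(3) by (simp add: field_simps)
    then have "x / b \<le> x * \<bar>real_of_int n\<bar>"
      using mult_left_mono[of "1 / b" "\<bar>real_of_int n\<bar>" x] assms(4) by simp
    then have "exp ((h - x) * \<bar>real_of_int n\<bar>) \<le> exp (- x / b + h * \<bar>real_of_int n\<bar>)"
      by (simp add: algebra_simps)
    then have "nm (cf G n) * exp ((h - x) * \<bar>real_of_int n\<bar>) \<le> nm (cf F n) * exp (- x / b + h * \<bar>real_of_int n\<bar>)"
      by (intro mult_mono assms) auto
    then show ?thesis unfolding exp_add by (simp only: mult_ac)
  qed
qed

lemma small_power:
  fixes x :: real
  assumes "0 < x" "200 * x \<le> 1" "2 \<le> p"
  shows "40 * (x / 2) ^ p \<le> x / 2"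
proof -
  have "(x / 2) ^ p \<le> (x / 2) ^ 2"
    using assms by (intro power_decreasing) auto
  also have "40 * \<dots> \<le> x / 2"
    using mult_right_mono[OF assms(2), of x] assms(1) by (simp add: power2_eq_square)
  finally show ?thesis by simp
qed

text \<open>The Diophantine condition on the circle, with a natural exponent so that all scales
  below are integer powers of \<open>x\<close>.\<close>

locale small_divisors =
  fixes \<beta> \<kappa> :: real and \<tau> :: nat
  assumes kpos: "0 < \<kappa>"
    and small_divisor: "\<And>n::int. n \<noteq> 0 \<Longrightarrow> \<kappa> \<le> norm (1 - cis (of_int n * \<beta>)) * \<bar>real_of_int n\<bar> ^ \<tau>"
begin

lemma divisor_lower_bound:
  assumes "n \<noteq> 0" "\<bar>real_of_int n\<bar> * b \<le> 1" "0 < b"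
  shows "\<kappa> * b ^ \<tau> \<le> norm (1 - cis (of_int n * \<beta>))"
proof -
  have "\<kappa> * b ^ \<tau> \<le> norm (1 - cis (of_int n * \<beta>)) * \<bar>real_of_int n\<bar> ^ \<tau> * b ^ \<tau>"
    using small_divisor[OF assms(1)] assms(3) by (intro mult_right_mono) auto
  also have "\<dots> = norm (1 - cis (of_int n * \<beta>)) * (\<bar>real_of_int n\<bar> * b) ^ \<tau>"
    by (simp add: power_mult_distrib mult.assoc)
  also have "\<dots> \<le> norm (1 - cis (of_int n * \<beta>)) * 1"
    using assms by (intro mult_left_mono power_le_one) auto
  finally show ?thesis by simp
qed

text \<open>The new size \<open>(x / 2) ^ p\<close> is shared equally by two errors: the modes
  beyond the cutoff, which the loss of strip shrinks by \<open>exp (- 1 / x)\<close>, and the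
  quadratic remainder.\<close>

lemma nonresonant_step:
  assumes x: "0 < x" "x \<le> h" and B: "admissible \<tau> h x B"
    and S: "10000 / \<kappa> * x \<le> 1" "200 * 2 ^ (20 * \<tau> + 10) * x \<le> 1" "exp (- 1 / x) * 2 ^ (20 * \<tau> + 11) \<le> 1"
    and nonres: "\<And>n. n \<noteq> 0 \<Longrightarrow> \<bar>real_of_int n\<bar> * x\<^sup>2 \<le> 1 \<Longrightarrow> x ^ (8 * \<tau> + 2) \<le> norm (gap (cf B 0) (cis (of_int n * \<beta>)))"
  shows "\<exists>B'. cj \<beta> (h - x) (ev B) (ev B') \<and> admissible \<tau> (h - x) (x / 2) B'"
proof -
  define A where "A = cf B 0"
  define F where "F = B - cst A"
  define p where "p = 20 * \<tau> + 10"
  define q where "q n = cis (of_int n * \<beta>)" for n :: int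
  define low where "low n \<longleftrightarrow> n \<noteq> 0 \<and> \<bar>real_of_int n\<bar> * x\<^sup>2 \<le> 1" for n :: int
  define m where "m = 10000 / (\<kappa> * x ^ (10 * \<tau> + 2))"
  have "200 * x * 1 \<le> 200 * x * 2 ^ p" using x(1) by (intro mult_left_mono) auto
  then have x200: "200 * x \<le> 1" using S(2) by (simp add: p_def mult_ac del: power_add)
  have h0: "0 \<le> h" "0 \<le> h - x" using x by auto
  have rlB: "rl B" and sgA: "sg A = A"
    using B unfolding admissible_def A_def rl_def by (auto dest: spec[of _ 0])
  have A: "nm A \<le> 10 - x" "1/2 + x \<le> Re (det2 A)" "Re (det2 A) \<le> 2 - x" and F: "nrm h F \<le> x ^ p"
    using B by (auto simp: admissible_def A_def F_def p_def)
  have rlF: "rl F" unfolding F_def by (intro rl_diff rlB) (simp add: rl_cst sgA)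
  have detA: "norm (det2 A) = Re (det2 A)"
    using A x(1) by (subst sg_fixed_real(1)[OF sgA]) simp
  have f1: "x ^ p \<le> 1" using x x200 by (intro power_le_one) auto
  have low: "\<kappa> * x ^ (2 * \<tau>) \<le> norm (1 - q n)" "x ^ (8 * \<tau> + 2) \<le> norm (gap A (q n))" if "low n" for n
    using divisor_lower_bound[of n "x\<^sup>2"] nonres[of n] that x(1)
    unfolding q_def low_def A_def by (simp_all add: power_mult)
  have prod: "\<kappa> * x ^ (10 * \<tau> + 2) \<le> norm (1 - q n) * norm (gap A (q n))" if "low n" for n
  proof -
    have "\<kappa> * x ^ (10 * \<tau> + 2) = (\<kappa> * x ^ (2 * \<tau>)) * x ^ (8 * \<tau> + 2)"
      by (simp add: mult.assoc flip: power_add)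
    also have "\<dots> \<le> norm (1 - q n) * norm (gap A (q n))"
      using low[OF that] x(1) kpos by (intro mult_mono) auto
    finally show ?thesis .
  qed
  have mq: "10000 / (norm (1 - q n) * norm (gap A (q n))) \<le> m" if "low n" for n
  proof -
    have "0 < \<kappa> * x ^ (10 * \<tau> + 2)" using kpos x(1) by simp
    then show ?thesis
      unfolding m_def using prod[OF that] by (intro frac_le) auto
  qed
  have nz: "q n \<noteq> 1" "gap A (q n) \<noteq> 0" if "low n" for n
  proof -
    have "0 < \<kappa> * x ^ (10 * \<tau> + 2)" using kpos x(1) by simp
    then have "0 < norm (1 - q n) * norm (gap A (q n))" using prod[OF that] by (rule less_le_trans)
    then show "q n \<noteq> 1" "gap A (q n) \<noteq> 0" by auto
  qed
  have m0: "0 \<le> m" using kpos x(1) by (simp add: m_def)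
  define \<pi> where "\<pi> n X = (if low n then X else 0)" for n and X :: m2
  define \<phi> where "\<phi> n X = (if low n then solY A (q n) X else 0)" for n X
  define \<psi> where "\<psi> n X = (if low n then solC A (q n) X else 0)" for n X
  \<comment> \<open>From the exponent \<open>20 * \<tau> + 10\<close> of the perturbation,
    \<open>10 * \<tau> + 2\<close> is lost to the divisors and one power absorbs
    \<open>10000 / \<kappa>\<close>. The square of \<open>y\<close> is then four powers of
    \<open>x\<close> better than \<open>x ^ p\<close>, which pays for the constants and for halving
    \<open>x\<close>.\<close>
  define y where "y = x ^ (10 * \<tau> + 7)"
  have low_minus: "low (- n) \<longleftrightarrow> low n" and q_minus: "q (- n) = cnj (q n)" for n
    by (auto simp: low_def q_def cis_cnj)
  have detA2: "1/2 \<le> norm (det2 A)" "norm (det2 A) \<le> 2" "det2 A \<noteq> 0" "nm A \<le> 10"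
    using detA A x(1) by auto
  have y: "m * nrm h (mapc \<pi> F) \<le> y"
  proof -
    have "m * nrm h (mapc \<pi> F) \<le> m * x ^ p"
      by (intro mult_left_mono m0 order_trans[OF nrm_le F]) (auto simp: \<pi>_def cf_mapc)
    also have "x ^ p = x ^ (10 * \<tau> + 2) * x ^ 1 * x ^ (10 * \<tau> + 7)"
      unfolding p_def power_add[symmetric] by (rule arg_cong[where f = "power x"]) simp
    also have "m * \<dots> = (10000 / \<kappa> * x) * y"
      using x(1) kpos by (simp add: m_def y_def)
    also have "\<dots> \<le> 1 * y"
      using S(1) x(1) by (intro mult_right_mono) (auto simp: y_def)
    finally show ?thesis by simp
  qed
  have yx: "y \<le> x"
    using power_decreasing[of 1 "10 * \<tau> + 7" x] x(1) x200 by (simp add: y_def)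
  obtain B' where B': "rl B'" "cj \<beta> h (ev (cst A + F)) (ev B')"
    "nrm h (B' - cst A - (F - mapc \<pi> F)) \<le> 50 * y * (y + x ^ p)"
  proof (rule elimination_step[OF h0(1) sgA detA2(4) rlF F f1 y, where \<phi> = \<phi> and \<psi> = \<psi> and \<beta> = \<beta>])
    show "y < 1" using yx x200 x(1) by simp
    show "\<exists>a. \<psi> n X = scl a" for n X
      by (auto simp: \<psi>_def solC_def intro: exI[of _ 0])
    show "nm (\<phi> n X) \<le> m * nm (\<pi> n X)" "nm (\<psi> n X) \<le> m * nm (\<pi> n X)" for n X
      using nm_sol[OF detA2(4) _ detA2(1,2), of "q n" X] mult_right_mono[OF mq, of n "nm X"]
      by (auto simp: \<pi>_def \<phi>_def \<psi>_def q_def intro: order_trans)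
    show "\<pi> n X + \<psi> n X * A + scl (cis (of_int n * \<beta>)) * \<phi> n X * A - A * \<phi> n X = 0" for n X
      using sol_eq[OF nz(1) detA2(3) nz(2), of n X] by (auto simp: \<pi>_def \<phi>_def \<psi>_def q_def)
    show "tr2 (\<phi> n X) = 0" for n X
      by (auto simp: \<phi>_def tr2_solY) (simp add: tr2_def zero_m2_def)
  qed (auto simp: \<pi>_def \<phi>_def \<psi>_def low_minus q_minus sol_sg[OF sgA])
  have "nrm (h - x) (F - mapc \<pi> F) \<le> exp (- x / x\<^sup>2) * nrm h F"
  proof (rule nrm_high_modes)
    fix n
    show "cf (F - mapc \<pi> F) n = 0" if "\<bar>real_of_int n\<bar> * x\<^sup>2 \<le> 1"
    \<comment> \<open>Mode 0 is never removed, as its divisor vanishes; it is absent from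
      \<open>F\<close> because \<open>A\<close> is exactly the mean of \<open>B\<close>.\<close>
    proof (cases "n = 0")
      case True
      then show ?thesis by (simp add: lookup_minus cf_mapc \<pi>_def low_def F_def A_def)
    qed (use that in \<open>simp add: lookup_minus cf_mapc \<pi>_def low_def\<close>)
    show "nm (cf (F - mapc \<pi> F) n) \<le> nm (cf F n)"
      by (simp add: lookup_minus cf_mapc \<pi>_def)
  qed (use x in auto)
  also have "\<dots> \<le> exp (- 1 / x) * x ^ p"
    using x(1) F by (intro mult_mono) (auto simp: power2_eq_square)
  also have "\<dots> \<le> (1 / 2 ^ (20 * \<tau> + 11)) * x ^ p"
    using S(3) x(1) by (intro mult_right_mono) (auto simp: field_simps)
  also have "\<dots> = (x / 2) ^ p / 2"
    by (simp add: p_def power_divide power_add)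
  finally have hi: "nrm (h - x) (F - mapc \<pi> F) \<le> (x / 2) ^ p / 2" .
  have "nrm (h - x) (B' - cst A - (F - mapc \<pi> F)) \<le> 50 * y * (y + x ^ p)"
    using nrm_mono[of "h - x" h "B' - cst A - (F - mapc \<pi> F)"] B'(3) x(1) by simp
  also have "\<dots> \<le> 50 * y * (2 * y)"
  proof -
    have "x ^ p \<le> y" unfolding y_def p_def using x(1) x200 by (intro power_decreasing) auto
    then show ?thesis using x(1) by (intro mult_left_mono) (auto simp: y_def)
  qed
  also have "\<dots> = 100 * (y * y)" by simp
  also have "y * y = x ^ 3 * (x ^ 1 * x ^ p)"
    unfolding y_def p_def power_add[symmetric] by (rule arg_cong[where f = "power x"]) simp
  also have "100 * (x ^ 3 * (x ^ 1 * x ^ p)) \<le> 100 * (1 * (x ^ 1 * x ^ p))"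
    using x(1) x200 by (intro mult_left_mono mult_right_mono power_le_one) auto
  also have "\<dots> \<le> (x / 2) ^ p / 2"
    using mult_right_mono[OF S(2), of "x ^ p"] x(1) by (simp add: p_def power_divide field_simps)
  finally have "nrm (h - x) (B' - cst A - (F - mapc \<pi> F)) \<le> (x / 2) ^ p / 2" .
  then have main: "nrm (h - x) (B' - cst A) \<le> (x / 2) ^ p"
    using hi nrm_add[of "h - x" "B' - cst A - (F - mapc \<pi> F)" "F - mapc \<pi> F"] by simp
  have small: "40 * (x / 2) ^ p \<le> x / 2"
    using small_power[OF x(1) x200] by (simp add: p_def)
  have "admissible \<tau> (h - x) (x / 2) B'"
    by (rule admissible_approx[OF h0(2) B'(1) main]) (use small A x(1) in \<open>auto simp: p_def\<close>)
  moreover have "cj \<beta> (h - x) (ev B) (ev B')"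
    using cj_mono[OF B'(2), of "h - x"] x(1) by (simp add: F_def)
  ultimately show ?thesis by blast
qed

end

subsection \<open>Resonances\<close>

text \<open>Here \<open>s\<^sub>0\<close> is the modulus of the imaginary part of the eigenvalues.
  The conjugation degenerates only like the inverse root of \<open>s\<^sub>0\<close> as they
  collide.\<close>

lemma elliptic_normal_form:
  assumes A: "sg A = A" "nm A \<le> 10" and s0: "0 < s\<^sub>0" "4 * s\<^sub>0\<^sup>2 = 4 * Re (det2 A) - (Re (tr2 A))\<^sup>2"
  obtains P \<mu> where "sg P = P" "det2 P = 1" "nm P * nm P \<le> 80 / s\<^sub>0"
    "P * A * adj2 P = M2 \<mu> 0 0 (cnj \<mu>)" "\<mu> * cnj \<mu> = det2 A" "\<mu> + cnj \<mu> = tr2 A"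
proof -
  define a1 a2 b where "a1 = Re (e11 A)" and "a2 = Im (e11 A)" and "b = e12 A"
  have Aeq: "A = M2 (Complex a1 a2) b (cnj b) (Complex a1 (- a2))"
  proof -
    have "e22 A = cnj (e11 A)" "e21 A = cnj (e12 A)"
      by (subst A(1)[symmetric], simp add: sg_def)+
    then show ?thesis
      by (intro m2_eqI) (simp_all add: a1_def a2_def b_def complex_eq_iff)
  qed
  have nb: "b * cnj b = of_real ((norm b)\<^sup>2)"
    by (rule complex_norm_square[symmetric])
  have det: "Re (det2 A) = a1\<^sup>2 + a2\<^sup>2 - (norm b)\<^sup>2" and tr: "Re (tr2 A) = 2 * a1"
    by (simp_all add: arg_cong[OF Aeq, of det2] arg_cong[OF Aeq, of tr2]) (simp_all add: det2_def tr2_def nb power2_eq_square)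
  have s2: "s\<^sub>0\<^sup>2 = a2\<^sup>2 - (norm b)\<^sup>2"
    using s0(2) by (simp add: det tr power_mult_distrib)
  have "(norm b)\<^sup>2 \<le> \<bar>a2\<bar>\<^sup>2" "s\<^sub>0\<^sup>2 \<le> \<bar>a2\<bar>\<^sup>2" using s2 zero_le_power2[of s\<^sub>0] zero_le_power2[of "norm b"] by (simp_all del: zero_le_power2)
  then have le: "norm b \<le> \<bar>a2\<bar>" "s\<^sub>0 \<le> \<bar>a2\<bar>" by (auto intro: power2_le_imp_le)
  then have a2: "a2 \<noteq> 0" using s0(1) by auto
  \<comment> \<open>Of the two eigenvalues take the one whose imaginary part has the sign of
    \<open>a2\<close>; then \<open>w\<close> is a sum without cancellation.\<close>
  define s where "s = sgn a2 * s\<^sub>0"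
  define w where "w = s + a2"
  have s: "\<bar>s\<bar> = s\<^sub>0" "s\<^sup>2 = s\<^sub>0\<^sup>2" using a2 s0(1) by (auto simp: s_def abs_mult power_mult_distrib sgn_real_def)
  have w: "\<bar>w\<bar> = s\<^sub>0 + \<bar>a2\<bar>" using a2 s0(1) by (auto simp: s_def w_def sgn_real_def abs_if)
  have sw: "s * w = s\<^sub>0 * \<bar>w\<bar>" using a2 s0(1) by (auto simp: s_def w_def sgn_real_def abs_if algebra_simps)
  have w0: "0 < \<bar>w\<bar>" using w s0(1) by simp
  have pos: "0 < 2 * s * w" using sw w0 s0(1) by simp
  define c where "c = 1 / sqrt (2 * s * w)"
  have c2: "c\<^sup>2 * (2 * s * w) = 1" using pos by (auto simp: c_def power_divide)
  \<comment> \<open>The first row is a left eigenvector of \<open>A\<close>, by the identity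
    \<open>ws\<close>; the second row is forced by \<open>sg P = P\<close>, and \<open>c\<close>
    normalises the determinant.\<close>
  define P where "P = M2 (of_real (c * w)) (- \<i> * of_real c * b) (\<i> * of_real c * cnj b) (of_real (c * w))"
  define \<mu> where "\<mu> = Complex a1 s"
  have ws: "w * (a2 - s) = (norm b)\<^sup>2" using s2 s(2) by (simp add: w_def algebra_simps power2_eq_square)
  have sgP: "sg P = P" by (simp add: P_def sg_def)
  have detP: "det2 P = 1"
  proof -
    have "det2 P = of_real (c\<^sup>2 * (w\<^sup>2 - (norm b)\<^sup>2))"
      by (simp add: P_def det2_def power2_eq_square algebra_simps) (simp add: nb[unfolded power2_eq_square] flip: of_real_mult mult.assoc)
    also have "w\<^sup>2 - (norm b)\<^sup>2 = 2 * s * w"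
      unfolding ws[symmetric] by (simp add: w_def power2_eq_square algebra_simps)
    finally show ?thesis using c2 by simp
  qed
  have PA: "P * A = M2 \<mu> 0 0 (cnj \<mu>) * P"
  proof -
    have 1: "of_real w * Complex a1 a2 - \<i> * (b * cnj b) = \<mu> * of_real w"
      unfolding nb ws[symmetric] by (simp add: complex_eq_iff \<mu>_def algebra_simps)
    have 2: "of_real w - \<i> * Complex a1 (- a2) = - \<i> * \<mu>"
      by (simp add: complex_eq_iff \<mu>_def w_def)
    have e1: "e11 (P * A) = e11 (M2 \<mu> 0 0 (cnj \<mu>) * P)"
      using arg_cong[OF 1, of "\<lambda>v. of_real c * v"]
      by (subst Aeq) (simp add: P_def times_m2_def algebra_simps)
    have e2: "e12 (P * A) = e12 (M2 \<mu> 0 0 (cnj \<mu>) * P)"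
      using arg_cong[OF 2, of "\<lambda>v. of_real c * b * v"]
      by (subst Aeq) (simp add: P_def times_m2_def algebra_simps)
    have f: "sg (P * A) = P * A" "sg (M2 \<mu> 0 0 (cnj \<mu>) * P) = M2 \<mu> 0 0 (cnj \<mu>) * P"
      by (simp_all add: sg_mult sgP A) (simp add: sg_def)
    have "X = Y" if "sg X = X" "sg Y = Y" "e11 X = e11 Y" "e12 X = e12 Y" for X Y
      using that by (cases X; cases Y) (auto simp: sg_def)
    then show ?thesis using f e1 e2 by blast
  qed
  have "P * A * adj2 P = M2 \<mu> 0 0 (cnj \<mu>) * (P * adj2 P)"
    by (simp add: PA mult.assoc)
  then have PAP: "P * A * adj2 P = M2 \<mu> 0 0 (cnj \<mu>)"
    by (simp add: mult_adj2 detP)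
  have "det2 A = of_real (a1\<^sup>2 + s\<^sub>0\<^sup>2)"
    using sg_fixed_real(1)[OF A(1)] by (simp add: det s2)
  then have lam: "\<mu> * cnj \<mu> = det2 A"
    using s(2) by (simp add: \<mu>_def complex_eq_iff power2_eq_square)
  have lam2: "\<mu> + cnj \<mu> = tr2 A"
    using sg_fixed_real(2)[OF A(1)] by (simp add: \<mu>_def complex_eq_iff tr)
  have "nm P = 2 * (\<bar>c\<bar> * (\<bar>w\<bar> + norm b))"
    by (simp add: P_def nm_def norm_mult abs_mult algebra_simps)
  also have "\<dots> \<le> 2 * (\<bar>c\<bar> * (\<bar>w\<bar> + \<bar>w\<bar>))"
    using le w s0(1) by (intro mult_left_mono add_mono) auto
  finally have "nm P \<le> 4 * \<bar>c * w\<bar>" by (simp add: abs_mult)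
  then have "nm P * nm P \<le> (4 * \<bar>c * w\<bar>) * (4 * \<bar>c * w\<bar>)" by (intro mult_mono) auto
  also have "\<dots> = 16 * (c\<^sup>2 * w\<^sup>2)" by (simp add: power2_eq_square algebra_simps)
  also have "c\<^sup>2 * w\<^sup>2 = \<bar>w\<bar> / (2 * s\<^sub>0)"
  proof -
    have "2 * s * w = 2 * s\<^sub>0 * \<bar>w\<bar>" using sw by simp
    moreover have "c\<^sup>2 = 1 / (2 * s * w)" using pos by (simp add: c_def power_divide)
    ultimately have "c\<^sup>2 = 1 / (2 * s\<^sub>0 * \<bar>w\<bar>)" by metis
    then have "c\<^sup>2 * w\<^sup>2 = 1 / (2 * s\<^sub>0 * \<bar>w\<bar>) * (\<bar>w\<bar> * \<bar>w\<bar>)" by (simp add: power2_eq_square)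
    then show ?thesis using w0 by (simp del: abs_mult_self_eq)
  qed
  also have "16 * (\<bar>w\<bar> / (2 * s\<^sub>0)) \<le> 80 / s\<^sub>0"
  proof -
    have "2 * \<bar>a2\<bar> \<le> 10"
    proof -
      have "e22 A = cnj (e11 A)" by (subst A(1)[symmetric]) (simp add: sg_def)
      then have "2 * norm (e11 A) \<le> nm A" by (simp add: nm_def)
      then show ?thesis using abs_Im_le_cmod[of "e11 A"] A(2) by (simp add: a2_def)
    qed
    then have "\<bar>w\<bar> \<le> 10" using w le by simp
    then show ?thesis using s0(1) by (simp add: field_simps)
  qed
  finally have nmP: "nm P * nm P \<le> 80 / s\<^sub>0" .
  show ?thesis by (rule that[OF sgP detP nmP PAP lam lam2])
qed

text \<open>All the divisors at these modes are bounded below, so removing them loses no analyticity and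
  can be iterated at fixed \<open>h\<close>.\<close>

definition nonres_part :: "int \<Rightarrow> real \<Rightarrow> int \<Rightarrow> m2 \<Rightarrow> m2" where
  "nonres_part k b n X = (if \<bar>real_of_int n\<bar> * b \<le> 1
     then M2 (if n = 0 then 0 else e11 X) (if n = k then 0 else e12 X)
             (if n = - k then 0 else e21 X) (if n = 0 then 0 else e22 X)
     else 0)"

lemma nonres_part_props:
  "nonres_part k b n 0 = 0" "nm (nonres_part k b n X) \<le> nm X" "nm (X - nonres_part k b n X) \<le> nm X"
  "nonres_part k b n (X - nonres_part k b n X + Y) = nonres_part k b n Y"
  "nonres_part k b (- n) (sg X) = sg (nonres_part k b n X)"
  by (auto simp: nonres_part_def nm_def m2_defs sg_def)

text \<open>Convergence is only geometric. The resonant terms stay in place with size of order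
  \<epsilon>, so the remainder \<open>50 * y * (y + 2 * \<epsilon>)\<close> is linear in the part
  \<open>v\<close> still to be removed; \<open>1600 * \<epsilon> \<le> d\<^sup>2\<close> makes its
  factor at most 1/4. Any prescribed precision is still reached after finitely many rounds, and the
  total perturbation stays below \<open>2 * \<epsilon>\<close>.\<close>

lemma diagonal_iteration:
  assumes h: "0 \<le> h" and lam: "1/2 \<le> norm \<mu>" "norm \<mu> \<le> 3/2"
    and F: "rl F" "nrm h F \<le> \<epsilon>" and d: "0 < d" "d \<le> 1" "1600 * \<epsilon> \<le> d\<^sup>2"
    and div: "\<And>n. \<bar>real_of_int n\<bar> * b \<le> 1 \<Longrightarrow> n \<noteq> 0 \<Longrightarrow> d \<le> norm (1 - cis (of_int n * \<beta>))"
      "\<And>n. \<bar>real_of_int n\<bar> * b \<le> 1 \<Longrightarrow> n \<noteq> k \<Longrightarrow> d \<le> norm (\<mu> - cis (of_int n * \<beta>) * cnj \<mu>)"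
  shows "\<exists>B. rl B \<and> cj \<beta> h (ev (cst (M2 \<mu> 0 0 (cnj \<mu>)) + F)) (ev B) \<and>
    nrm h (mapc (nonres_part k b) (B - cst (M2 \<mu> 0 0 (cnj \<mu>)))) \<le> \<epsilon> / 4 ^ j \<and>
    nrm h (B - cst (M2 \<mu> 0 0 (cnj \<mu>))) \<le> 2 * \<epsilon> - \<epsilon> / 4 ^ j"
proof (induction j)
  case 0
  have "nrm h (mapc (nonres_part k b) F) \<le> \<epsilon>"
    by (intro order_trans[OF nrm_le F(2)]) (simp add: cf_mapc nonres_part_props)
  moreover have "rl (cst (M2 \<mu> 0 0 (cnj \<mu>)) + F)"
    by (intro rl_add F) (simp add: rl_cst sg_def)
  ultimately show ?case
    using F by (intro exI[of _ "cst (M2 \<mu> 0 0 (cnj \<mu>)) + F"]) (auto intro: cj_refl)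
next
  case (Suc j)
  define \<Lambda> where "\<Lambda> = M2 \<mu> 0 0 (cnj \<mu>)"
  define \<pi> where "\<pi> = nonres_part k b"
  define v where "v = \<epsilon> / 4 ^ j"
  obtain B where B: "rl B" "cj \<beta> h (ev (cst \<Lambda> + F)) (ev B)"
    "nrm h (mapc \<pi> (B - cst \<Lambda>)) \<le> v" "nrm h (B - cst \<Lambda>) \<le> 2 * \<epsilon> - v"
    using Suc unfolding \<Lambda>_def[symmetric] \<pi>_def v_def by blast
  define G where "G = B - cst \<Lambda>"
  have G: "rl G" "nrm h G \<le> 2 * \<epsilon> - v" "nrm h (mapc \<pi> G) \<le> v" "cst \<Lambda> + G = B"
    unfolding G_def using B by (auto intro!: rl_diff simp: rl_cst sg_def \<Lambda>_def)
  have e0: "0 \<le> \<epsilon>" using F(2) nrm_nonneg order_trans by blast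
  have v: "0 \<le> v" "v \<le> \<epsilon>" using e0 by (auto simp: v_def divide_le_eq mult_le_cancel_left1)
  have "d\<^sup>2 \<le> d" using d by (simp add: power2_eq_square mult_le_one)
  then have ed: "1600 * \<epsilon> \<le> d" using d by simp
  define y where "y = 2 / d * v"
  define q where "q n = cis (of_int n * \<beta>)" for n :: int
  have q_minus: "q (- n) = cnj (q n)" for n by (simp add: q_def cis_cnj)
  \<comment> \<open>Wherever a divisor may vanish its numerator is \<open>0\<close>, and \<open>0 / 0 = 0\<close>.\<close>
  define \<phi> where "\<phi> n X = (let P = \<pi> n X in
     M2 ((e11 P / \<mu> - e22 P / cnj \<mu>) / (2 * (1 - q n))) (e12 P / (\<mu> - q n * cnj \<mu>))
        (e21 P / (cnj \<mu> - q n * \<mu>)) ((e22 P / cnj \<mu> - e11 P / \<mu>) / (2 * (1 - q n))))" for n X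
  \<comment> \<open>The part of the diagonal proportional to \<Lambda> is absorbed by the scalar
    factor without any divisor; only the opposite parts of the two relative entries are divided by
    \<open>1 - q n\<close>.\<close>
  define \<psi> where "\<psi> n X = (let P = \<pi> n X in scl (- ((e11 P / \<mu> + e22 P / cnj \<mu>) / 2)))" for n X
  have lam0: "\<mu> \<noteq> 0" using lam by auto
  have neg: "(x - y) / (2 * w) = - ((y - x) / 2 / w)" for x y w :: complex
    by (metis minus_diff_eq minus_divide_left divide_divide_eq_left)
  have div21: "d \<le> norm (cnj \<mu> - q n * \<mu>)" if "\<bar>real_of_int n\<bar> * b \<le> 1" "n \<noteq> - k" for n
  proof -
    have "norm (cnj \<mu> - q n * \<mu>) = norm (\<mu> - q (- n) * cnj \<mu>)"
      by (subst complex_mod_cnj[symmetric]) (simp add: q_minus)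
    then show ?thesis using div(2)[of "- n"] that by (simp add: q_def)
  qed
  have inv: "1 / norm \<mu> \<le> 2" using frac_le[of 1 1 "1/2" "norm \<mu>"] lam(1) by simp
  have inv2: "norm (a / \<mu>) \<le> 2 * norm a" "norm (a / cnj \<mu>) \<le> 2 * norm a" for a
    using mult_left_mono[OF inv, of "norm a"] by (simp_all add: norm_divide)
  have ent: "norm (a / w) \<le> norm a / d" if "a = 0 \<or> d \<le> norm w" for a w :: complex
  proof (cases "a = 0")
    case False
    then show ?thesis using that d(1) unfolding norm_divide by (intro frac_le) auto
  qed simp
  have y1: "y < 1"
  proof -
    have "y * d = 2 * v" using d by (simp add: y_def)
    also have "\<dots> < d" using v ed e0 d(1) by linarith
    finally show ?thesis using d(1) by simp
  qed
  have small: "2 * \<epsilon> \<le> 1" using ed d(2) e0 by simp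
  obtain B' where B': "rl B'" "cj \<beta> h (ev (cst \<Lambda> + G)) (ev B')"
    "nrm h (B' - cst \<Lambda> - (G - mapc \<pi> G)) \<le> 50 * y * (y + 2 * \<epsilon>)"
  proof (rule elimination_step[where A = \<Lambda> and F = G and f = "2 * \<epsilon>" and m = "2 / d" and \<pi> = \<pi> and \<phi> = \<phi> and \<psi> = \<psi> and y = y and \<beta> = \<beta>, OF h])
    show "nm \<Lambda> \<le> 10" using lam by (simp add: \<Lambda>_def nm_def)
    show "2 / d * nrm h (mapc \<pi> G) \<le> y"
      unfolding y_def using G(3) d(1) by (intro mult_left_mono) auto
    show "\<pi> n 0 = 0" "\<phi> n 0 = 0" "\<psi> n 0 = 0" for n
      by (simp_all add: \<phi>_def \<psi>_def \<pi>_def nonres_part_props Let_def) (simp_all add: zero_m2_def)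
    show "\<phi> (- n) (sg X) = sg (\<phi> n X)" for n X
      by (simp add: \<phi>_def \<pi>_def nonres_part_props Let_def q_minus) (simp add: sg_def)
    show "\<psi> (- n) (sg X) = sg (\<psi> n X)" for n X
      by (simp add: \<psi>_def \<pi>_def nonres_part_props Let_def sg_scl) (rule arg_cong[where f = scl], simp add: sg_def field_simps)
    show "nm (\<phi> n X) \<le> 2 / d * nm (\<pi> n X)" "nm (\<psi> n X) \<le> 2 / d * nm (\<pi> n X)" for n X
    proof -
      define P where "P = \<pi> n X"
      have z: "\<bar>real_of_int n\<bar> * b \<le> 1 \<or> P = 0" "n = 0 \<Longrightarrow> e11 P = 0 \<and> e22 P = 0" "n = k \<Longrightarrow> e12 P = 0" "n = - k \<Longrightarrow> e21 P = 0"
        by (auto simp: P_def \<pi>_def nonres_part_def zero_m2_def)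
      define c where "c = (e11 P / \<mu> - e22 P / cnj \<mu>) / 2"
      have c: "norm c \<le> norm (e11 P) + norm (e22 P)"
        unfolding c_def using norm_triangle_ineq4[of "e11 P / \<mu>" "e22 P / cnj \<mu>"] inv2(1)[of "e11 P"] inv2(2)[of "e22 P"] by simp
      have "norm (c / (1 - q n)) \<le> norm c / d"
        by (rule ent, cases "n = 0") (use z div(1)[of n] in \<open>auto simp: c_def q_def zero_m2_def\<close>)
      also have "\<dots> \<le> (norm (e11 P) + norm (e22 P)) / d"
        using c d(1) by (intro divide_right_mono) auto
      finally have 1: "norm (c / (1 - q n)) \<le> (norm (e11 P) + norm (e22 P)) / d" .
      have 2: "norm (e12 P / (\<mu> - q n * cnj \<mu>)) \<le> norm (e12 P) / d"
        by (rule ent) (use z div(2)[of n] in \<open>auto simp: q_def zero_m2_def\<close>)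
      have 3: "norm (e21 P / (cnj \<mu> - q n * \<mu>)) \<le> norm (e21 P) / d"
        by (rule ent) (use z div21[of n] in \<open>auto simp: zero_m2_def\<close>)
      have phi: "\<phi> n X = M2 (c / (1 - q n)) (e12 P / (\<mu> - q n * cnj \<mu>)) (e21 P / (cnj \<mu> - q n * \<mu>)) (- (c / (1 - q n)))"
        by (simp only: \<phi>_def Let_def P_def[symmetric] c_def neg[of "e22 P / cnj \<mu>"] divide_divide_eq_left)
      have "nm (\<phi> n X) \<le> 2 * ((norm (e11 P) + norm (e22 P)) / d) + norm (e12 P) / d + norm (e21 P) / d"
        using 1 2 3 unfolding phi nm_def m2.sel norm_minus_cancel by linarith
      also have "\<dots> \<le> 2 / d * nm P"
        using d(1) by (simp add: nm_def field_simps)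
      finally show "nm (\<phi> n X) \<le> 2 / d * nm (\<pi> n X)" by (simp add: P_def)
      have "nm (\<psi> n X) = norm (e11 P / \<mu> + e22 P / cnj \<mu>)"
        by (simp add: \<psi>_def Let_def P_def nm_scl norm_divide)
      also have "\<dots> \<le> 2 * nm P"
        using norm_triangle_ineq[of "e11 P / \<mu>" "e22 P / cnj \<mu>"] inv2(1)[of "e11 P"] inv2(2)[of "e22 P"]
          norm_ge_zero[of "e12 P"] norm_ge_zero[of "e21 P"] by (simp add: nm_def del: norm_ge_zero)
      also have "\<dots> \<le> 2 / d * nm P"
        using d by (intro mult_right_mono) (auto simp: field_simps)
      finally show "nm (\<psi> n X) \<le> 2 / d * nm (\<pi> n X)" by (simp add: P_def)
    qed
    show "\<pi> n X + \<psi> n X * \<Lambda> + scl (cis (of_int n * \<beta>)) * \<phi> n X * \<Lambda> - \<Lambda> * \<phi> n X = 0" for n X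
    proof -
      define P where "P = \<pi> n X"
      have z: "\<bar>real_of_int n\<bar> * b \<le> 1 \<or> P = 0" "n = 0 \<Longrightarrow> e11 P = 0 \<and> e22 P = 0" "n = k \<Longrightarrow> e12 P = 0" "n = - k \<Longrightarrow> e21 P = 0"
        by (auto simp: P_def \<pi>_def nonres_part_def zero_m2_def)
      define c where "c = (e11 P / \<mu> - e22 P / cnj \<mu>) / 2"
      have q: "c / (1 - q n) * (1 - q n) = c"
      proof -
        have "c = 0 \<or> 1 - q n \<noteq> 0"
          by (cases "n = 0") (use z div(1)[of n] d(1) in \<open>auto simp: c_def q_def zero_m2_def\<close>)
        then show ?thesis by auto
      qed
      have e12: "e12 P / (\<mu> - q n * cnj \<mu>) * (\<mu> - q n * cnj \<mu>) = e12 P"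
        using z div(2)[of n] d(1) by (cases "\<mu> - q n * cnj \<mu> = 0") (auto simp: q_def zero_m2_def)
      have e21: "e21 P / (cnj \<mu> - q n * \<mu>) * (cnj \<mu> - q n * \<mu>) = e21 P"
        using z div21[of n] d(1) by (cases "cnj \<mu> - q n * \<mu> = 0") (auto simp: zero_m2_def)
      define u where "u = c / (1 - q n)"
      define r where "r = e12 P / (\<mu> - q n * cnj \<mu>)"
      define t where "t = e21 P / (cnj \<mu> - q n * \<mu>)"
      have phi: "\<phi> n X = M2 u r t (- u)"
        by (simp only: \<phi>_def Let_def P_def[symmetric] c_def u_def r_def t_def neg[of "e22 P / cnj \<mu>"] divide_divide_eq_left)
      have psi: "\<psi> n X = scl (- ((e11 P / \<mu> + e22 P / cnj \<mu>) / 2))"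
        by (simp add: \<psi>_def Let_def P_def)
      have 1: "e11 P - (e11 P / \<mu> + e22 P / cnj \<mu>) / 2 * \<mu> + q n * u * \<mu> - \<mu> * u = 0"
      proof -
        have "e11 P = e11 P / \<mu> * \<mu>" "q n * u * \<mu> - \<mu> * u = - (u * (1 - q n)) * \<mu>"
          using lam0 by (simp_all add: algebra_simps)
        then have "e11 P - (e11 P / \<mu> + e22 P / cnj \<mu>) / 2 * \<mu> + (q n * u * \<mu> - \<mu> * u) =
          (e11 P / \<mu> - (e11 P / \<mu> + e22 P / cnj \<mu>) / 2 - c) * \<mu>"
          unfolding u_def q by (simp add: left_diff_distrib)
        then show ?thesis by (simp add: c_def field_simps)
      qed
      have 2: "e22 P - (e11 P / \<mu> + e22 P / cnj \<mu>) / 2 * cnj \<mu> - q n * u * cnj \<mu> + cnj \<mu> * u = 0"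
      proof -
        have "e22 P = e22 P / cnj \<mu> * cnj \<mu>" "- q n * u * cnj \<mu> + cnj \<mu> * u = u * (1 - q n) * cnj \<mu>"
          using lam0 by (simp_all add: algebra_simps)
        then have "e22 P - (e11 P / \<mu> + e22 P / cnj \<mu>) / 2 * cnj \<mu> + (- q n * u * cnj \<mu> + cnj \<mu> * u) =
          (e22 P / cnj \<mu> - (e11 P / \<mu> + e22 P / cnj \<mu>) / 2 + c) * cnj \<mu>"
          unfolding u_def q by (simp add: left_diff_distrib distrib_right)
        then show ?thesis by (simp add: c_def field_simps)
      qed
      have 3: "e12 P + q n * r * cnj \<mu> - \<mu> * r = 0"
        using e12 unfolding r_def[symmetric] by (simp add: algebra_simps)
      have 4: "e21 P + q n * t * \<mu> - cnj \<mu> * t = 0"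
        using e21 unfolding t_def[symmetric] by (simp add: algebra_simps)
      show ?thesis
        unfolding phi psi P_def[symmetric] q_def[symmetric] \<Lambda>_def
        by (rule m2_eqI) (use 1 2 3 4 in \<open>simp_all add: m2_defs scl_def algebra_simps\<close>)
    qed
    show "tr2 (\<phi> n X) = 0" for n X
      by (simp add: \<phi>_def Let_def tr2_def flip: add_divide_distrib)
  qed (use G v small y1 in \<open>auto simp: \<Lambda>_def sg_def \<psi>_def Let_def\<close>)
  have "50 * y * (y + 2 * \<epsilon>) \<le> 50 * y * (4 * \<epsilon> / d)"
  proof (intro mult_left_mono)
    have "y \<le> 2 / d * \<epsilon>" unfolding y_def using v d(1) by (intro mult_left_mono) auto
    moreover have "2 * \<epsilon> \<le> 2 / d * \<epsilon>" using d e0 by (intro mult_right_mono) (auto simp: field_simps)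
    ultimately show "y + 2 * \<epsilon> \<le> 4 * \<epsilon> / d" by simp
  qed (use v d(1) in \<open>auto simp: y_def\<close>)
  also have "\<dots> = v * (400 * \<epsilon> / d\<^sup>2)" by (simp add: y_def power2_eq_square)
  also have "\<dots> \<le> v * (1/4)" using d v by (intro mult_left_mono) (auto simp: field_simps)
  finally have rest: "nrm h (B' - cst \<Lambda> - (G - mapc \<pi> G)) \<le> v / 4" using B'(3) by simp
  have "nrm h (mapc \<pi> (B' - cst \<Lambda>)) \<le> nrm h (B' - cst \<Lambda> - (G - mapc \<pi> G))"
  proof (rule nrm_le)
    fix n
    have "cf (B' - cst \<Lambda>) n = cf G n - \<pi> n (cf G n) + cf (B' - cst \<Lambda> - (G - mapc \<pi> G)) n"
      by (simp add: lookup_minus cf_mapc \<pi>_def nonres_part_props)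
    then have "\<pi> n (cf (B' - cst \<Lambda>) n) = \<pi> n (cf (B' - cst \<Lambda> - (G - mapc \<pi> G)) n)"
      unfolding \<pi>_def by (metis nonres_part_props(4))
    then show "nm (cf (mapc \<pi> (B' - cst \<Lambda>)) n) \<le> nm (cf (B' - cst \<Lambda> - (G - mapc \<pi> G)) n)"
      by (simp add: cf_mapc \<pi>_def nonres_part_props)
  qed
  then have 1: "nrm h (mapc \<pi> (B' - cst \<Lambda>)) \<le> v / 4" using rest by simp
  have "nrm h (G - mapc \<pi> G) \<le> nrm h G"
    by (rule nrm_le) (simp add: lookup_minus cf_mapc \<pi>_def nonres_part_props)
  then have 2: "nrm h (B' - cst \<Lambda>) \<le> 2 * \<epsilon> - v / 4"
    using nrm_add[of h "B' - cst \<Lambda> - (G - mapc \<pi> G)" "G - mapc \<pi> G"] rest G(2) v by simp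
  have "cj \<beta> h (ev (cst \<Lambda> + F)) (ev B')"
    using cj_trans[OF B(2)] B'(2) unfolding G(4) by blast
  then show ?case
    using 1 2 B'(1) unfolding \<Lambda>_def \<pi>_def v_def by (intro exI[of _ B']) (simp add: mult.commute)
qed

text \<open>The rotation by half of \<open>k\<close> times the angle is no Laurent polynomial for
  odd \<open>k\<close>. Multiplied by a scalar exponential it becomes this one; in
  \<open>twist\<close> the two scalar exponentials cancel up to the constant
  \<open>cis (of_int k * \<beta> / 2)\<close>.\<close>

definition rot :: "int \<Rightarrow> lpoly" where
  "rot k = sng k (M2 1 0 0 0) + cst (M2 0 0 0 1)"

definition twist :: "real \<Rightarrow> int \<Rightarrow> lpoly \<Rightarrow> lpoly" where
  "twist \<beta> k B = cst (scl (cis (of_int k * \<beta> / 2))) * shift \<beta> (rot (- k)) * B * rot k"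

lemma shift_add: "shift \<beta> (F + G) = shift \<beta> F + shift \<beta> G"
  by (rule poly_mapping_eqI) (simp add: cf_shift lookup_add distrib_left)

lemma shift_rot: "shift \<beta> (rot k) = sng k (M2 (cis (of_int k * \<beta>)) 0 0 0) + cst (M2 0 0 0 1)"
  by (simp add: rot_def shift_add shift_sng scl_def times_m2_def)

text \<open>The outer factors are real only up to the central monomial \<open>sng k 1\<close>, and
  the monomials from the two sides cancel.\<close>

lemma rl_twist: "rl B \<Longrightarrow> rl (twist \<beta> k B)"
proof -
  assume B: "rl B"
  define c where "c = cis (of_int k * \<beta> / 2)"
  have c0: "cnj c * c = 1" "c * cnj c = 1" "cis (of_int k * \<beta>) = c * c" "cis (- (of_int k * \<beta>)) = cnj c * cnj c"
    by (simp_all add: c_def cis_cnj cis_mult mult.commute)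
  have m: "sng k 1 * X = X * sng k 1" for X
    unfolding lpoly_mult_expansion by (cases "X = 0") (simp_all add: add.commute zero_neq_one[symmetric])
  have 1: "br (cst (scl c)) * br (shift \<beta> (rot (- k))) = cst (scl c) * shift \<beta> (rot (- k)) * sng k 1"
    unfolding shift_rot
    by (simp add: br_add distrib_left distrib_right mult_single c0 c_def[symmetric])
       (simp add: sg_def scl_def times_m2_def one_m2_def c0 mult.assoc[symmetric] add.commute)
  have 2: "sng k 1 * br (rot k) = rot k"
    by (simp add: rot_def br_add distrib_left mult_single) (simp add: sg_def add.commute)
  have "br (twist \<beta> k B) = cst (scl c) * shift \<beta> (rot (- k)) * (sng k 1 * B) * br (rot k)"
    using B unfolding twist_def br_mult c_def[symmetric] 1 rl_iff_br by (simp add: mult.assoc)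
  also have "\<dots> = cst (scl c) * shift \<beta> (rot (- k)) * B * (sng k 1 * br (rot k))"
    by (simp add: m mult.assoc)
  also have "\<dots> = twist \<beta> k B"
    by (simp add: 2 twist_def c_def)
  finally show ?thesis by (simp add: rl_iff_br)
qed

lemma cj_twist: "cj \<beta> h (ev B) (ev (twist \<beta> k B))"
proof (rule cj_sl_on)
  define Z where "Z z = M2 (exp (- \<i> * of_int k * z / 2)) 0 0 (exp (\<i> * of_int k * z / 2))" for z
  show "sl_on h Z"
    unfolding sl_on_def
  proof (intro conjI ballI allI)
    show "(\<lambda>z. e11 (Z z)) holomorphic_on strip h" "(\<lambda>z. e12 (Z z)) holomorphic_on strip h"
      "(\<lambda>z. e21 (Z z)) holomorphic_on strip h" "(\<lambda>z. e22 (Z z)) holomorphic_on strip h"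
      unfolding Z_def by (auto intro!: holomorphic_intros)
    show "sg (Z (of_real x)) = Z (of_real x)" for x
      by (simp add: Z_def sg_def exp_cnj)
    show "det2 (Z z) = 1" for z
      by (simp add: Z_def det2_def exp_add[symmetric])
    have e: "exp (\<i> * of_int k * of_real pi) = (if even k then 1 else - 1)"
      using cos_npi_int[of k] sin_npi_int[of k]
      by (simp add: complex_eq_iff Re_exp Im_exp mult.commute)
    have e': "exp (- (\<i> * of_int k * of_real pi)) = (if even k then 1 else - 1)"
      by (simp add: exp_minus e)
    \<comment> \<open>For odd \<open>k\<close> the rotation is antiperiodic; this is where values in
      \<open>PSL\<close> instead of \<open>SL\<close> are used.\<close>
    show "\<exists>s\<in>{1, -1}. \<forall>z\<in>strip h. Z (z + 2 * of_real pi) = scl s * Z z"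
    proof (intro bexI ballI)
      fix z
      have "exp (\<i> * of_int k * (z + 2 * of_real pi) / 2) = exp (\<i> * of_int k * z / 2) * exp (\<i> * of_int k * of_real pi)"
        "exp (- \<i> * of_int k * (z + 2 * of_real pi) / 2) = exp (- \<i> * of_int k * z / 2) * exp (- (\<i> * of_int k * of_real pi))"
        unfolding exp_add[symmetric] by (rule arg_cong[where f = exp]; simp add: field_simps)+
      then show "Z (z + 2 * of_real pi) = scl (if even k then 1 else - 1) * Z z"
        unfolding Z_def e e' by (simp add: scl_def times_m2_def)
    qed auto
  qed
  fix z
  have a: "ev (rot k) z * Z z = scl (exp (\<i> * of_int k * z / 2))"
  proof -
    have "exp (\<i> * of_int k * z) * exp (- \<i> * of_int k * z / 2) = exp (\<i> * of_int k * z / 2)"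
      by (simp add: exp_add[symmetric] field_simps)
    then show ?thesis
      by (simp add: rot_def ev_add ev_sng Z_def scl_def m2_defs)
  qed
  have b: "scl (exp (\<i> * of_int k * z / 2) * cis (of_int k * \<beta> / 2)) * ev (rot (- k)) (z + of_real \<beta>) = Z (z + of_real \<beta>)"
  proof -
    have 1: "exp (\<i> * of_int k * z / 2) * cis (of_int k * \<beta> / 2) = exp (\<i> * of_int k * (z + of_real \<beta>) / 2)"
      by (simp add: cis_conv_exp exp_add[symmetric] field_simps)
    have "exp (\<i> * of_int k * (z + of_real \<beta>) / 2) * exp (\<i> * of_int (- k) * (z + of_real \<beta>)) = exp (- \<i> * of_int k * (z + of_real \<beta>) / 2)"
      unfolding exp_add[symmetric] by (rule arg_cong[where f = exp]) (simp add: field_simps)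
    then show ?thesis
      unfolding 1 by (simp add: rot_def ev_add ev_sng Z_def scl_def m2_defs)
  qed
  have "ev (twist \<beta> k B) z * Z z = scl (cis (of_int k * \<beta> / 2)) * ev (rot (- k)) (z + of_real \<beta>) * ev B z * scl (exp (\<i> * of_int k * z / 2))"
    by (simp add: twist_def ev_mult ev_shift a mult.assoc)
  also have "\<dots> = scl (exp (\<i> * of_int k * z / 2) * cis (of_int k * \<beta> / 2)) * ev (rot (- k)) (z + of_real \<beta>) * ev B z"
    unfolding scl_comm by (simp add: mult.assoc scl_mult_left)
  finally show "Z (z + of_real \<beta>) * ev B z = ev (twist \<beta> k B) z * Z z"
    by (simp add: b)
qed

text \<open>The rotation lowers the modes of the (1,2) entry by \<open>k\<close>, raises those of
  the (2,1) entry by \<open>k\<close> and fixes those of the diagonal, so precisely the resonant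
  terms become constant.\<close>

lemma twist_resonant:
  fixes k :: int and \<beta> :: real
  defines "c \<equiv> cis (of_int k * \<beta> / 2)"
  shows "twist \<beta> k (cst (M2 a 0 0 d) + sng k (M2 0 b 0 0) + sng (- k) (M2 0 0 e 0)) =
    cst (M2 (cnj c * a) (cnj c * b) (c * e) (c * d))"
proof -
  have c1: "cis (- (of_int k * \<beta>)) = cnj c * cnj c" "c * cnj c = 1"
    by (simp_all add: c_def cis_cnj cis_mult mult.commute)
  have c: "cis (- (of_int k * \<beta>)) = cnj c * cnj c" "c * cnj c = 1" "c * (cnj c * x) = x" for x
    using c1 by (simp_all flip: mult.assoc)
  have z: "M2 0 0 0 0 = 0" "e11 0 = 0" "e12 0 = 0" "e21 0 = 0" "e22 0 = 0" by (simp_all add: zero_m2_def)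
  show ?thesis
    unfolding twist_def shift_rot c_def[symmetric] unfolding rot_def
    by (simp add: distrib_left distrib_right mult_single, simp add: scl_def times_m2_def c z mult.assoc)
       (simp add: plus_m2_def flip: single_add)
qed

lemma nrm_twist:
  assumes "0 \<le> h"
  shows "nrm h (twist \<beta> k F) \<le> 8 * exp (2 * h * \<bar>real_of_int k\<bar>) * nrm h F"
proof -
  have e: "1 \<le> exp (h * \<bar>real_of_int k\<bar>)" using assms by simp
  have r: "nrm h (shift \<beta> (rot (- k))) \<le> 2 * exp (h * \<bar>real_of_int k\<bar>)" "nrm h (rot k) \<le> 2 * exp (h * \<bar>real_of_int k\<bar>)"
    using nrm_add[of h "sng (- k) (M2 1 0 0 0)" "cst (M2 0 0 0 1)"] nrm_add[of h "sng k (M2 1 0 0 0)" "cst (M2 0 0 0 1)"] e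
    by (simp_all add: rot_def nrm_sng nm_def del: one_le_exp_iff)
  have "nrm h (twist \<beta> k F) \<le> 2 * (2 * exp (h * \<bar>real_of_int k\<bar>)) * nrm h F * (2 * exp (h * \<bar>real_of_int k\<bar>))"
    unfolding twist_def
    by (rule order_trans[OF nrm_mult[OF assms] mult_mono], rule order_trans[OF nrm_mult[OF assms] mult_mono],
        rule order_trans[OF nrm_mult[OF assms] mult_mono]) (use r in \<open>auto simp: nm_scl\<close>)
  also have "\<dots> = 8 * exp (2 * h * \<bar>real_of_int k\<bar>) * nrm h F"
    by (simp add: algebra_simps flip: exp_double exp_add)
  finally show ?thesis .
qed

lemma twist_add: "twist \<beta> k (F + G) = twist \<beta> k F + twist \<beta> k G"
  by (simp add: twist_def distrib_left distrib_right)

text \<open>Up to a phase the gap of a real matrix is a real number, so that a small gap can be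
  compared with the discriminant.\<close>

lemma norm_gap_cis:
  assumes "sg A = A"
  shows "norm (gap A (cis \<theta>)) = \<bar>2 * Re (det2 A) * (1 + cos \<theta>) - (Re (tr2 A))\<^sup>2\<bar>"
proof -
  have q: "(1 + cis \<theta>)\<^sup>2 = cis \<theta> * of_real (2 * (1 + cos \<theta>))"
  proof -
    have "cis \<theta> * cis (- \<theta>) = 1" by (simp add: cis_mult)
    moreover have "of_real (2 * cos \<theta>) = cis \<theta> + cis (- \<theta>)" by (simp add: complex_eq_iff)
    ultimately show ?thesis by (simp add: power2_eq_square algebra_simps)
  qed
  have "gap A (cis \<theta>) = cis \<theta> * of_real (2 * Re (det2 A) * (1 + cos \<theta>) - (Re (tr2 A))\<^sup>2)"
  proof -
    define D t where "D = Re (det2 A)" and "t = Re (tr2 A)"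
    have "det2 A = of_real D" "tr2 A = of_real t"
      using sg_fixed_real[OF assms] by (simp_all add: D_def t_def)
    then show ?thesis by (simp add: gap_def q algebra_simps)
  qed
  then show ?thesis by (simp only: norm_mult norm_cis norm_of_real mult_1)
qed

lemma norm_one_minus_cis: "(norm (1 - cis \<theta>))\<^sup>2 = 2 - 2 * cos \<theta>"
  using sin_cos_squared_add[of \<theta>] by (simp only: cmod_power2) (simp add: power2_eq_square algebra_simps)

lemma gap_factor:
  assumes "\<mu> * cnj \<mu> = det2 A" "\<mu> + cnj \<mu> = tr2 A"
  shows "gap A q = (\<mu> - q * cnj \<mu>) * (cnj \<mu> - q * \<mu>)"
  unfolding gap_def assms[symmetric] by (simp add: power2_eq_square algebra_simps)

lemma cj_const:
  assumes "sg P = P" "det2 P = 1"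
  shows "cj \<beta> h (ev B) (ev (cst P * B * cst (adj2 P)))"
  by (rule cj_sl_on[OF sl_on_const[OF assms]]) (simp add: ev_mult mult.assoc adj2_mult assms)

context small_divisors
begin

text \<open>The rotation costs at most \<open>exp (2 * H / x\<^sup>2)\<close>. With the cutoff
  \<open>1 / x ^ 4\<close> the loss \<open>x\<close> of strip gains
  \<open>exp (- x / x ^ 4)\<close>, that is \<open>exp (- 1 / x ^ 3)\<close>, which wins by any
  power of \<open>x\<close>.\<close>

lemma resonant_step:
  assumes x: "0 < x" "x \<le> h" "h \<le> H" and B: "admissible \<tau> h x B"
    and S: "1600 * x \<le> 1" "10 * x \<le> \<kappa>\<^sup>2" "4 * 2 ^ \<tau> * x \<le> \<kappa>"
      "16 * exp (2 * H / x\<^sup>2 - 1 / x ^ 3) \<le> (x / 2) ^ (20 * \<tau> + 10)"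
    and res: "k \<noteq> 0" "\<bar>real_of_int k\<bar> * x\<^sup>2 \<le> 1" "norm (gap (cf B 0) (cis (of_int k * \<beta>))) < x ^ (8 * \<tau> + 2)"
  shows "\<exists>B'. cj \<beta> (h - x) (ev B) (ev B') \<and> admissible \<tau> (h - x) (x / 2) B'"
proof -
  define A where "A = cf B 0"
  define F where "F = B - cst A"
  define p where "p = 20 * \<tau> + 10"
  define q where "q n = cis (of_int n * \<beta>)" for n :: int
  define D where "D = Re (det2 A)"
  \<comment> \<open>One power of \<open>x\<close> below the divisors
    \<open>\<kappa> * (x ^ 4 / 2) ^ \<tau>\<close> available in the larger range of modes; its
    square is the resonance threshold for the gap.\<close>
  define d where "d = x ^ (4 * \<tau> + 1)"
  have x1: "x \<le> 1" and h0: "0 \<le> h" "0 \<le> h - x" using x S(1) by auto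
  have rlB: "rl B" and sgA: "sg A = A"
    using B unfolding admissible_def A_def rl_def by (auto dest: spec[of _ 0])
  have A: "nm A \<le> 10 - x" "1/2 + x \<le> D" "D \<le> 2 - x" and F: "nrm h F \<le> x ^ p"
    using B by (auto simp: admissible_def A_def F_def p_def D_def)
  have rlF: "rl F" unfolding F_def by (intro rl_diff rlB) (simp add: rl_cst sgA)
  have d2: "d * d = x ^ (8 * \<tau> + 2)"
    unfolding d_def power_add[symmetric] by (rule arg_cong[where f = "power x"]) simp
  have d0: "0 < d" "d \<le> 1" unfolding d_def using x(1) x1 by (intro zero_less_power power_le_one; simp)+

  define \<theta> where "\<theta> = of_int k * \<beta>"
  \<comment> \<open>A resonance forces ellipticity: \<open>4 * D\<close> minus the squared trace
    equals the small gap term plus \<open>D\<close> times the squared modulus of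
    \<open>1 - cis \<theta>\<close>, and the Diophantine bound makes the latter dominate.\<close>
  have disc: "4 * (x ^ (2 * \<tau> + 1))\<^sup>2 \<le> 4 * D - (Re (tr2 A))\<^sup>2"
  proof -
    have g: "\<bar>2 * D * (1 + cos \<theta>) - (Re (tr2 A))\<^sup>2\<bar> < x ^ (8 * \<tau> + 2)"
      using res(3) norm_gap_cis[OF sgA, of \<theta>] by (simp add: A_def D_def \<theta>_def)
    have "\<kappa> * x ^ (2 * \<tau>) \<le> norm (1 - cis \<theta>)"
      using divisor_lower_bound[of k "x\<^sup>2"] res x(1) by (simp add: \<theta>_def power_mult)
    then have "(\<kappa> * x ^ (2 * \<tau>))\<^sup>2 \<le> (norm (1 - cis \<theta>))\<^sup>2"
      using kpos x(1) by (intro power_mono) auto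
    then have "\<kappa>\<^sup>2 * (x ^ (2 * \<tau>))\<^sup>2 \<le> 2 - 2 * cos \<theta>"
      by (simp add: norm_one_minus_cis power_mult_distrib)
    then have 1: "1/2 * (\<kappa>\<^sup>2 * (x ^ (2 * \<tau>))\<^sup>2) \<le> D * (2 - 2 * cos \<theta>)"
      using A(2) x(1) by (intro mult_mono) auto
    have "10 * x * x \<le> 10 * x * 1" using x(1) x1 by (intro mult_left_mono) auto
    also have "\<dots> \<le> \<kappa>\<^sup>2" using S(2) by simp
    finally have "10 * x\<^sup>2 \<le> \<kappa>\<^sup>2" by (simp add: power2_eq_square)
    then have "10 * x\<^sup>2 * (x ^ (2 * \<tau>))\<^sup>2 \<le> \<kappa>\<^sup>2 * (x ^ (2 * \<tau>))\<^sup>2" by (intro mult_right_mono) auto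
    moreover have "x ^ (8 * \<tau> + 2) \<le> x\<^sup>2 * (x ^ (2 * \<tau>))\<^sup>2"
      unfolding power_mult[symmetric] power_add[symmetric] using x(1) x1 by (intro power_decreasing) auto
    moreover have "(x ^ (2 * \<tau> + 1))\<^sup>2 = x\<^sup>2 * (x ^ (2 * \<tau>))\<^sup>2"
      by (simp add: power_mult_distrib power2_eq_square)
    moreover have "4 * D - (Re (tr2 A))\<^sup>2 = 2 * D * (1 + cos \<theta>) - (Re (tr2 A))\<^sup>2 + D * (2 - 2 * cos \<theta>)"
      by (simp add: algebra_simps)
    ultimately show ?thesis using 1 g by linarith
  qed
  define s\<^sub>0 where "s\<^sub>0 = sqrt ((4 * D - (Re (tr2 A))\<^sup>2) / 4)"
  have s0: "x ^ (2 * \<tau> + 1) \<le> s\<^sub>0" "4 * s\<^sub>0\<^sup>2 = 4 * D - (Re (tr2 A))\<^sup>2"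
  proof -
    have "0 \<le> 4 * (x ^ (2 * \<tau> + 1))\<^sup>2" by (intro mult_nonneg_nonneg zero_le_power2) simp
    then have nn: "0 \<le> 4 * D - (Re (tr2 A))\<^sup>2" using disc by (rule order_trans)
    show "4 * s\<^sub>0\<^sup>2 = 4 * D - (Re (tr2 A))\<^sup>2"
      unfolding s\<^sub>0_def using nn by (subst real_sqrt_pow2) auto
    show "x ^ (2 * \<tau> + 1) \<le> s\<^sub>0"
      unfolding s\<^sub>0_def using disc by (intro real_le_rsqrt) (simp only: le_divide_eq_numeral1 mult.commute)
  qed
  have s0p: "0 < s\<^sub>0" using s0(1) zero_less_power[OF x(1)] by (rule less_le_trans[rotated])
  obtain P \<mu> where P: "sg P = P" "det2 P = 1" "nm P * nm P \<le> 80 / s\<^sub>0"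
    "P * A * adj2 P = M2 \<mu> 0 0 (cnj \<mu>)" and mu: "\<mu> * cnj \<mu> = det2 A" "\<mu> + cnj \<mu> = tr2 A"
  proof (rule elliptic_normal_form[OF sgA _ s0p])
    show "nm A \<le> 10" using A(1) x(1) by simp
    show "4 * s\<^sub>0\<^sup>2 = 4 * Re (det2 A) - (Re (tr2 A))\<^sup>2" using s0(2) by (simp add: D_def)
  qed (rule that)
  have "(norm \<mu>)\<^sup>2 = D"
    using arg_cong[OF mu(1), of Re] unfolding cmod_power2 by (simp add: D_def power2_eq_square)
  then have "(1/2)\<^sup>2 \<le> (norm \<mu>)\<^sup>2" "(norm \<mu>)\<^sup>2 \<le> (3/2)\<^sup>2"
    using A(2,3) x(1) by (auto simp: power2_eq_square)
  then have nmu: "1/2 \<le> norm \<mu>" "norm \<mu> \<le> 3/2"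
    by (auto intro: power2_le_imp_le)
  \<comment> \<open>The gap is a product of two eigenvalue divisors, belonging to \<open>k\<close>
    and \<open>- k\<close>. A product below \<open>d * d\<close> has a factor below
    \<open>d\<close>, which selects \<open>l\<close>.\<close>
  obtain l where l: "l \<noteq> 0" "\<bar>real_of_int l\<bar> * x\<^sup>2 \<le> 1" "norm (\<mu> - q l * cnj \<mu>) < d"
  proof (cases "norm (\<mu> - q k * cnj \<mu>) < d")
    case True
    then show ?thesis using that[of k] res by simp
  next
    case False
    have "norm (\<mu> - q k * cnj \<mu>) * norm (cnj \<mu> - q k * \<mu>) < d * d"
      using res(3) unfolding d2 A_def[symmetric] gap_factor[OF mu] q_def[symmetric] by (simp add: norm_mult)
    then have "norm (cnj \<mu> - q k * \<mu>) < d"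
      using False mult_mono[of d "norm (\<mu> - q k * cnj \<mu>)" d "norm (cnj \<mu> - q k * \<mu>)"] d0 by fastforce
    moreover have "norm (cnj \<mu> - q k * \<mu>) = norm (\<mu> - q (- k) * cnj \<mu>)"
      by (subst complex_mod_cnj[symmetric]) (simp add: q_def cis_cnj)
    ultimately show ?thesis using that[of "- k"] res by simp
  qed

  define \<Lambda> where "\<Lambda> = M2 \<mu> 0 0 (cnj \<mu>)"
  define \<epsilon> where "\<epsilon> = x ^ (18 * \<tau> + 8)"
  define F1 where "F1 = cst P * F * cst (adj2 P)"
  have B1: "cst P * B * cst (adj2 P) = cst \<Lambda> + F1"
  proof -
    have "cst P * B * cst (adj2 P) = cst P * cst A * cst (adj2 P) + F1"
      by (simp add: F1_def F_def algebra_simps)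
    then show ?thesis by (simp add: mult_single P(4) \<Lambda>_def)
  qed
  have rlF1: "rl F1"
    unfolding F1_def by (intro rl_mult rlF) (simp_all add: rl_cst P(1) sg_adj2)
  have e0: "0 < \<epsilon>" and ex: "\<epsilon> \<le> x * x"
    using power_decreasing[of 2 "18 * \<tau> + 8" x] x(1) x1 by (auto simp: \<epsilon>_def power2_eq_square)
  have xx: "1600 * (x * x) \<le> x" using mult_right_mono[OF S(1), of x] x(1) by simp
  have F1: "nrm h F1 \<le> \<epsilon>"
  proof -
    have "nrm h F1 \<le> nm P * nrm h F * nm P"
      unfolding F1_def
      by (rule order_trans[OF nrm_mult[OF h0(1)]], rule mult_mono, rule order_trans[OF nrm_mult[OF h0(1)]]) auto
    also have "\<dots> = (nm P * nm P) * nrm h F" by simp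
    also have "\<dots> \<le> (80 / s\<^sub>0) * x ^ p"
      using P(3) F s0p by (intro mult_mono) auto
    also have "\<dots> \<le> (80 / x ^ (2 * \<tau> + 1)) * x ^ p"
      using s0(1) x(1) by (intro mult_right_mono frac_le) auto
    also have "x ^ p = x ^ (2 * \<tau> + 1) * (x ^ 1 * \<epsilon>)"
      unfolding p_def \<epsilon>_def power_add[symmetric] by (rule arg_cong[where f = "power x"]) simp
    also have "80 / x ^ (2 * \<tau> + 1) * \<dots> = (80 * x) * \<epsilon>"
      using x(1) by simp
    also have "\<dots> \<le> 1 * \<epsilon>" using S(1) e0 by (intro mult_right_mono) auto
    finally show ?thesis by simp
  qed
  have "1600 * \<epsilon> \<le> d\<^sup>2"
  proof -
    have "\<epsilon> = x ^ (10 * \<tau> + 5) * (x ^ 1 * (d * d))"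
      unfolding d2 \<epsilon>_def power_add[symmetric] by (rule arg_cong[where f = "power x"]) simp
    also have "\<dots> \<le> 1 * (x ^ 1 * (d * d))"
      using x(1) x1 d0 by (intro mult_right_mono power_le_one) auto
    finally have "1600 * \<epsilon> \<le> (1600 * x) * (d * d)" by simp
    also have "\<dots> \<le> 1 * (d * d)" using S(1) d0 by (intro mult_right_mono) auto
    finally show ?thesis by (simp add: power2_eq_square)
  qed
  \<comment> \<open>The range is doubled because the bound is applied to differences of two
    modes.\<close>
  have div1: "\<kappa> * (x ^ 4 / 2) ^ \<tau> \<le> norm (1 - q n)" if "n \<noteq> 0" "\<bar>real_of_int n\<bar> * x ^ 4 \<le> 2" for n
    unfolding q_def using that x(1) by (intro divisor_lower_bound) auto
  have kd: "4 * d \<le> \<kappa> * (x ^ 4 / 2) ^ \<tau>"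
  proof -
    have "4 * d * 2 ^ \<tau> = (4 * 2 ^ \<tau> * x) * (x ^ 4) ^ \<tau>" by (simp add: d_def flip: power_mult)
    also have "\<dots> \<le> \<kappa> * (x ^ 4) ^ \<tau>" using S(3) x(1) by (intro mult_right_mono) auto
    finally show ?thesis by (simp add: power_divide le_divide_eq)
  qed
  have lx4: "\<bar>real_of_int l\<bar> * x ^ 4 \<le> 1"
  proof -
    have "\<bar>real_of_int l\<bar> * x ^ 4 \<le> \<bar>real_of_int l\<bar> * x ^ 2"
      using x(1) x1 by (intro mult_left_mono power_decreasing) auto
    then show ?thesis using l(2) by simp
  qed
  define \<pi> where "\<pi> = nonres_part l (x ^ 4)"
  have iter: "\<exists>B2. rl B2 \<and> cj \<beta> h (ev (cst \<Lambda> + F1)) (ev B2) \<and>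
    nrm h (mapc \<pi> (B2 - cst \<Lambda>)) \<le> \<epsilon> / 4 ^ j \<and> nrm h (B2 - cst \<Lambda>) \<le> 2 * \<epsilon> - \<epsilon> / 4 ^ j" for j
    unfolding \<pi>_def \<Lambda>_def
  proof (rule diagonal_iteration[OF h0(1) nmu rlF1 F1 d0 \<open>1600 * \<epsilon> \<le> d\<^sup>2\<close>])
    fix n :: int assume n: "\<bar>real_of_int n\<bar> * x ^ 4 \<le> 1"
    show "d \<le> norm (1 - cis (of_int n * \<beta>))" if "n \<noteq> 0"
      using div1[OF that] n kd d0 by (simp add: q_def)
    show "d \<le> norm (\<mu> - cis (of_int n * \<beta>) * cnj \<mu>)" if "n \<noteq> l"
    proof -
      \<comment> \<open>Uniqueness of the resonance: if \<open>n\<close> and \<open>l\<close> both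
        had small divisors, \<open>1 - q (n - l)\<close> would be small. It is at least
        \<open>4 * d\<close>; times the lower bound 1/2 for the modulus of \<mu>, minus the divisor
        at \<open>l\<close>, this leaves at least \<open>d\<close>.\<close>
      have "\<bar>real_of_int (n - l)\<bar> * x ^ 4 \<le> (\<bar>real_of_int n\<bar> + \<bar>real_of_int l\<bar>) * x ^ 4"
        using x(1) by (intro mult_right_mono) auto
      also have "\<dots> \<le> 2" using n lx4 by (simp add: distrib_right)
      finally have "4 * d \<le> norm (1 - q (n - l))" using div1[of "n - l"] that kd by simp
      then have "1/2 * (4 * d) \<le> norm \<mu> * norm (1 - q (n - l))" using nmu d0 by (intro mult_mono) auto
      also have "norm \<mu> * norm (1 - q (n - l)) = norm (q l * cnj \<mu> - q n * cnj \<mu>)"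
      proof -
        have "q n = q l * q (n - l)" by (simp add: q_def cis_mult algebra_simps)
        then have "q l * cnj \<mu> - q n * cnj \<mu> = q l * (cnj \<mu> * (1 - q (n - l)))" by (simp add: algebra_simps)
        then show ?thesis by (simp add: norm_mult q_def)
      qed
      also have "\<dots> \<le> norm (\<mu> - q n * cnj \<mu>) + norm (\<mu> - q l * cnj \<mu>)"
        using norm_triangle_ineq4[of "\<mu> - q n * cnj \<mu>" "\<mu> - q l * cnj \<mu>"] by (simp add: algebra_simps)
      finally show ?thesis using l(3) by (simp add: q_def)
    qed
  qed
  \<comment> \<open>The low nonresonant modes are removed down to the size to which the high modes
    shrink anyway.\<close>
  define E where "E = exp (- 1 / x ^ 3)"
  obtain j where j: "\<epsilon> / 4 ^ j \<le> E"
  proof -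
    obtain j where "\<epsilon> / E < 4 ^ j" using real_arch_pow[of 4 "\<epsilon> / E"] by auto
    then show ?thesis using that[of j] by (simp add: E_def field_simps)
  qed
  obtain B2 where B2: "rl B2" "cj \<beta> h (ev (cst \<Lambda> + F1)) (ev B2)"
    "nrm h (mapc \<pi> (B2 - cst \<Lambda>)) \<le> E" "nrm h (B2 - cst \<Lambda>) \<le> 2 * \<epsilon>"
    using iter[of j] j e0 by (smt (verit) divide_nonneg_pos zero_less_power)
  define G where "G = B2 - cst \<Lambda>"
  \<comment> \<open>\<open>R\<close> collects the entries left by \<pi> among the low modes, so
    \<open>U\<close> lives beyond \<open>1 / x ^ 4\<close>.\<close>
  define R where "R = cst (M2 (e11 (cf G 0)) 0 0 (e22 (cf G 0))) + sng l (M2 0 (e12 (cf G l)) 0 0)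
    + sng (- l) (M2 0 0 (e21 (cf G (- l))) 0)"
  define U where "U = G - mapc \<pi> G - R"
  define M where "M = M2 (\<mu> + e11 (cf G 0)) (e12 (cf G l)) (e21 (cf G (- l))) (cnj \<mu> + e22 (cf G 0))"
  define c where "c = cis (of_int l * \<beta> / 2)"
  define A' where "A' = M2 (cnj c * e11 M) (cnj c * e12 M) (c * e21 M) (c * e22 M)"
  define B3 where "B3 = twist \<beta> l B2"
  have U: "nrm (h - x) U \<le> exp (- x / x ^ 4) * nrm h G"
  proof (rule nrm_high_modes)
    fix n
    have cfR: "cf R n = (if n = 0 then M2 (e11 (cf G 0)) 0 0 (e22 (cf G 0)) else 0) +
      (if n = l then M2 0 (e12 (cf G l)) 0 0 else 0) + (if n = - l then M2 0 0 (e21 (cf G (- l))) 0 else 0)"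
      by (auto simp: R_def lookup_add lookup_single when_def)
    show low: "cf U n = 0" if "\<bar>real_of_int n\<bar> * x ^ 4 \<le> 1"
    proof (rule m2_eqI)
      show "e11 (cf U n) = e11 0" "e12 (cf U n) = e12 0" "e21 (cf U n) = e21 0" "e22 (cf U n) = e22 0"
        using that l(1) unfolding U_def lookup_minus cfR
        by (auto simp: cf_mapc \<pi>_def nonres_part_props(1)) (auto simp: nonres_part_def m2_defs)
    qed
    show "nm (cf U n) \<le> nm (cf G n)"
    proof (cases "\<bar>real_of_int n\<bar> * x ^ 4 \<le> 1")
      case False
      then have "n \<noteq> 0" "n \<noteq> l" "n \<noteq> - l" using lx4 by auto
      then show ?thesis using False
        by (simp add: U_def lookup_minus cfR cf_mapc \<pi>_def nonres_part_props(1)) (simp add: nonres_part_def)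
    qed (simp add: low)
  qed (use x in auto)
  have rest: "nrm (h - x) (mapc \<pi> G + U) \<le> 2 * E"
  proof -
    have 1: "exp (- x / x ^ 4) = E" using x(1) by (simp add: E_def power4_eq_xxxx power3_eq_cube)
    have "nrm h G \<le> 1" using B2(4) ex xx S(1) x(1) unfolding G_def by linarith
    then have "E * nrm h G \<le> E * 1" by (intro mult_left_mono) (simp_all add: E_def)
    then have "nrm (h - x) U \<le> E" using U unfolding 1 by simp
    moreover have "nrm (h - x) (mapc \<pi> G) \<le> E"
      using nrm_mono[of "h - x" h "mapc \<pi> G"] B2(3) x(1) by (simp add: G_def)
    ultimately show ?thesis using nrm_add[of "h - x" "mapc \<pi> G" U] by simp
  qed
  have B3: "B3 - cst A' = twist \<beta> l (mapc \<pi> G + U)"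
  proof -
    have B2': "B2 = (cst \<Lambda> + R) + (mapc \<pi> G + U)" by (simp add: U_def G_def)
    have "B3 = twist \<beta> l (cst \<Lambda> + R) + twist \<beta> l (mapc \<pi> G + U)"
      unfolding B3_def by (subst B2') (rule twist_add)
    moreover have "cst \<Lambda> + R = cst (M2 (e11 M) 0 0 (e22 M)) + sng l (M2 0 (e12 M) 0 0) + sng (- l) (M2 0 0 (e21 M) 0)"
      by (simp add: R_def M_def \<Lambda>_def plus_m2_def flip: single_add add.assoc)
    ultimately have "B3 = twist \<beta> l (cst (M2 (e11 M) 0 0 (e22 M)) + sng l (M2 0 (e12 M) 0 0) + sng (- l) (M2 0 0 (e21 M) 0))
      + twist \<beta> l (mapc \<pi> G + U)" by simp
    then show ?thesis
      unfolding twist_resonant A'_def c_def by simp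
  qed
  have r: "nrm (h - x) (B3 - cst A') \<le> 16 * exp (2 * H / x\<^sup>2 - 1 / x ^ 3)"
  proof -
    have "nrm (h - x) (B3 - cst A') \<le> 8 * exp (2 * (h - x) * \<bar>real_of_int l\<bar>) * (2 * E)"
      unfolding B3 by (intro order_trans[OF nrm_twist[OF h0(2)] mult_left_mono] rest) auto
    also have "\<dots> \<le> 8 * exp (2 * H / x\<^sup>2) * (2 * E)"
    proof -
      have "\<bar>real_of_int l\<bar> \<le> 1 / x\<^sup>2" using l(2) x(1) by (simp add: field_simps)
      then have "(2 * (h - x)) * \<bar>real_of_int l\<bar> \<le> (2 * H) * (1 / x\<^sup>2)"
        using h0 x by (intro mult_mono) auto
      then show ?thesis by (intro mult_right_mono mult_left_mono) (auto simp: E_def)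
    qed
    also have "\<dots> = 16 * exp (2 * H / x\<^sup>2 - 1 / x ^ 3)"
      by (simp add: E_def exp_diff exp_minus field_simps)
    finally show ?thesis .
  qed
  have ent: "norm (e11 (cf G n)) \<le> 2 * \<epsilon>" "norm (e12 (cf G n)) \<le> 2 * \<epsilon>" "norm (e21 (cf G n)) \<le> 2 * \<epsilon>" "norm (e22 (cf G n)) \<le> 2 * \<epsilon>" for n
    using nm_entries[of "cf G n"] nm_cf_le_nrm[OF h0(1), of G n] B2(4) unfolding G_def by linarith+
  have es: "640 * \<epsilon> \<le> x" "640 * \<epsilon> \<le> 1" using ex xx S(1) x(1) by linarith+
  have nmM: "nm (M - \<Lambda>) \<le> 8 * \<epsilon>"
    using ent[of 0] ent(2)[of l] ent(3)[of "- l"] by (simp add: M_def \<Lambda>_def minus_m2_def nm_def)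
  have nmL: "nm \<Lambda> \<le> 3" using nmu by (simp add: \<Lambda>_def nm_def)
  \<comment> \<open>The diagonal form has norm at most 3, so the norm bound is renewed here, however
    large the conjugation was.\<close>
  have nmM2: "nm M \<le> 4" using nm_add[of "M - \<Lambda>" \<Lambda>] nmM nmL es by simp
  have nc: "norm c = 1" "cnj c * c = 1" by (simp_all add: c_def cis_cnj cis_mult)
  have nmA': "nm A' = nm M" using nc(1) by (simp add: A'_def nm_def norm_mult)
  have "norm (det2 M - det2 \<Lambda>) \<le> 8 * \<epsilon> * 20"
    using e0 nmM nmM2 nmL by (intro order_trans[OF norm_det2_diff mult_mono]) auto
  moreover have "det2 A' = det2 M"
  proof -
    have "det2 A' = (cnj c * c) * det2 M" by (simp add: A'_def det2_def algebra_simps)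
    then show ?thesis by (simp add: nc)
  qed
  moreover have "det2 \<Lambda> = det2 A" using mu(1) by (simp add: \<Lambda>_def det2_def)
  ultimately have det: "\<bar>Re (det2 A') - D\<bar> \<le> x / 4"
    using abs_Re_le_cmod[of "det2 M - det2 \<Lambda>"] es(1) by (simp add: D_def)
  have "admissible \<tau> (h - x) (x / 2) B3"
  proof (rule admissible_approx[OF h0(2) _ r S(4)])
    show "rl B3" unfolding B3_def by (intro rl_twist B2)
    show "40 * (16 * exp (2 * H / x\<^sup>2 - 1 / x ^ 3)) \<le> x / 2"
      using S(1,4) x(1) small_power[of x "20 * \<tau> + 10"] by linarith
    show "nm A' \<le> 10 - 2 * (x / 2)" using nmA' nmM2 x1 by simp
    show "1/2 + 3/2 * (x / 2) \<le> Re (det2 A')" "Re (det2 A') \<le> 2 - 3/2 * (x / 2)"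
      using det A(2,3) by linarith+
  qed
  moreover have "cj \<beta> (h - x) (ev B) (ev B3)"
  proof -
    have "cj \<beta> h (ev B) (ev (cst \<Lambda> + F1))"
      using cj_const[OF P(1,2), of \<beta> h B] by (simp only: B1)
    then have "cj \<beta> h (ev B) (ev B2)" using B2(2) by (rule cj_trans)
    then have "cj \<beta> h (ev B) (ev B3)" unfolding B3_def using cj_twist by (rule cj_trans)
    then show ?thesis by (rule cj_mono) (use x(1) in simp)
  qed
  ultimately show ?thesis by blast
qed

text \<open>In the last condition \<open>1 / x ^ 3\<close> outweighs both
  \<open>2 * H / x\<^sup>2\<close> and the logarithm of a fixed power of \<open>x\<close>.\<close>

lemma eventually_small: "\<exists>x0>0. \<forall>x. 0 < x \<and> x \<le> x0 \<longrightarrow>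
   10000 / \<kappa> * x \<le> 1 \<and> 200 * 2 ^ (20 * \<tau> + 10) * x \<le> 1 \<and> exp (- 1 / x) * 2 ^ (20 * \<tau> + 11) \<le> 1 \<and>
   1600 * x \<le> 1 \<and> 10 * x \<le> \<kappa>\<^sup>2 \<and> 4 * 2 ^ \<tau> * x \<le> \<kappa> \<and>
   16 * exp (2 * H / x\<^sup>2 - 1 / x ^ 3) \<le> (x / 2) ^ (20 * \<tau> + 10)"
proof -
  have lin: "\<forall>\<^sub>F x in at_right (0::real). a * x \<le> b" if "0 < b" for a b
  proof -
    have "((\<lambda>x. a * x) \<longlongrightarrow> a * 0) (at_right 0)" by (intro tendsto_intros)
    then have "\<forall>\<^sub>F x in at_right 0. a * x < b" using that by (auto dest: order_tendstoD(2))
    then show ?thesis by eventually_elim simp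
  qed
  have e1: "\<forall>\<^sub>F x in at_right (0::real). exp (- 1 / x) * 2 ^ (20 * \<tau> + 11) \<le> 1"
  proof -
    have "((\<lambda>x::real. exp (- 1 / x)) \<longlongrightarrow> 0) (at_right 0)" by real_asymp
    then have "((\<lambda>x::real. exp (- 1 / x) * 2 ^ (20 * \<tau> + 11)) \<longlongrightarrow> 0) (at_right 0)"
      by (rule tendsto_mult_left_zero)
    then have "\<forall>\<^sub>F x in at_right (0::real). exp (- 1 / x) * 2 ^ (20 * \<tau> + 11) < 1"
      by (rule order_tendstoD(2)) simp
    then show ?thesis by eventually_elim simp
  qed
  have e2: "\<forall>\<^sub>F x in at_right (0::real). 16 * exp (2 * H / x\<^sup>2 - 1 / x ^ 3) \<le> (x / 2) ^ (20 * \<tau> + 10)"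
  proof -
    define p where "p = 20 * \<tau> + 10"
    have "((\<lambda>x::real. 16 * exp (2 * H / x\<^sup>2 - 1 / x ^ 3) / (x / 2) powr real p) \<longlongrightarrow> 0) (at_right 0)"
      by real_asymp
    then have "\<forall>\<^sub>F x in at_right (0::real). 16 * exp (2 * H / x\<^sup>2 - 1 / x ^ 3) / (x / 2) powr real p < 1"
      by (rule order_tendstoD(2)) simp
    moreover have "\<forall>\<^sub>F x in at_right (0::real). 0 < x" by (rule eventually_at_right_less)
    ultimately show ?thesis
      unfolding p_def[symmetric] by eventually_elim (simp add: powr_realpow field_simps)
  qed
  have "\<forall>\<^sub>F x in at_right (0::real). 10000 / \<kappa> * x \<le> 1 \<and> 200 * 2 ^ (20 * \<tau> + 10) * x \<le> 1 \<and>
     exp (- 1 / x) * 2 ^ (20 * \<tau> + 11) \<le> 1 \<and> 1600 * x \<le> 1 \<and> 10 * x \<le> \<kappa>\<^sup>2 \<and> 4 * 2 ^ \<tau> * x \<le> \<kappa> \<and>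
     16 * exp (2 * H / x\<^sup>2 - 1 / x ^ 3) \<le> (x / 2) ^ (20 * \<tau> + 10)"
    using kpos by (intro eventually_conj lin e1 e2) auto
  then obtain b where b: "0 < b" "\<forall>x>0. x < b \<longrightarrow> 10000 / \<kappa> * x \<le> 1 \<and> 200 * 2 ^ (20 * \<tau> + 10) * x \<le> 1 \<and>
     exp (- 1 / x) * 2 ^ (20 * \<tau> + 11) \<le> 1 \<and> 1600 * x \<le> 1 \<and> 10 * x \<le> \<kappa>\<^sup>2 \<and> 4 * 2 ^ \<tau> * x \<le> \<kappa> \<and>
     16 * exp (2 * H / x\<^sup>2 - 1 / x ^ 3) \<le> (x / 2) ^ (20 * \<tau> + 10)"
    unfolding eventually_at_right_field by auto
  then show ?thesis
    by (intro exI[of _ "b / 2"]) auto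
qed

section \<open>Iteration of the step\<close>

lemma kam_step: "\<exists>x0>0. \<forall>x h B. 0 < x \<and> x \<le> x0 \<and> x \<le> h \<and> h \<le> H \<and> admissible \<tau> h x B \<longrightarrow>
    (\<exists>B'. cj \<beta> (h - x) (ev B) (ev B') \<and> admissible \<tau> (h - x) (x / 2) B')"
proof -
  obtain x0 where x0: "0 < x0" and S: "\<And>x. 0 < x \<Longrightarrow> x \<le> x0 \<Longrightarrow>
   10000 / \<kappa> * x \<le> 1 \<and> 200 * 2 ^ (20 * \<tau> + 10) * x \<le> 1 \<and> exp (- 1 / x) * 2 ^ (20 * \<tau> + 11) \<le> 1 \<and>
   1600 * x \<le> 1 \<and> 10 * x \<le> \<kappa>\<^sup>2 \<and> 4 * 2 ^ \<tau> * x \<le> \<kappa> \<and>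
   16 * exp (2 * H / x\<^sup>2 - 1 / x ^ 3) \<le> (x / 2) ^ (20 * \<tau> + 10)"
    using eventually_small[of H] by blast
  have "\<exists>B'. cj \<beta> (h - x) (ev B) (ev B') \<and> admissible \<tau> (h - x) (x / 2) B'"
    if "0 < x" "x \<le> x0" "x \<le> h" "h \<le> H" "admissible \<tau> h x B" for x h B
  proof (cases "\<exists>k. k \<noteq> 0 \<and> \<bar>real_of_int k\<bar> * x\<^sup>2 \<le> 1 \<and> norm (gap (cf B 0) (cis (of_int k * \<beta>))) < x ^ (8 * \<tau> + 2)")
    case True
    then show ?thesis using resonant_step[of x h H B] S[OF that(1,2)] that by blast
  next
    case False
    then show ?thesis
      using S[OF that(1,2)] that by (intro nonresonant_step) (auto simp: not_less)
  qed
  then show ?thesis using x0 by blast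
qed

lemma kam:
  "\<exists>x0>0. x0 \<le> 1/100 \<and> (\<forall>B. admissible \<tau> 1 x0 B \<longrightarrow>
     (\<forall>j. \<exists>B'. cj \<beta> (1/2) (ev B) (ev B') \<and> admissible \<tau> (1/2) (x0 / 2 ^ j) B'))"
proof -
  obtain x0 where x0: "0 < x0" and step: "\<And>x h B. 0 < x \<Longrightarrow> x \<le> x0 \<Longrightarrow> x \<le> h \<Longrightarrow> h \<le> 1 \<Longrightarrow> admissible \<tau> h x B \<Longrightarrow>
    \<exists>B'. cj \<beta> (h - x) (ev B) (ev B') \<and> admissible \<tau> (h - x) (x / 2) B'"
    using kam_step[of 1] by blast
  define x where "x = min x0 (1/100)"
  have x: "0 < x" "x \<le> x0" "x \<le> 1/100" using x0 by (auto simp: x_def)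
  \<comment> \<open>One minus the partial sums of the losses \<open>x\<close>, \<open>x / 2\<close>,
    \<open>x / 4\<close> and so on; the total stays below \<open>2 * x\<close>.\<close>
  define h where "h j = 1 - 2 * x * (1 - 1 / 2 ^ j)" for j :: nat
  have h: "1/2 \<le> h j" "h j \<le> 1" for j
  proof -
    have "2 * x * (1 - 1 / 2 ^ j) \<le> 1/2 * 1" using x by (intro mult_mono) auto
    then show "1/2 \<le> h j" by (simp add: h_def)
    show "h j \<le> 1" using x by (simp add: h_def)
  qed
  have main: "\<exists>B'. cj \<beta> (h j) (ev B) (ev B') \<and> admissible \<tau> (h j) (x / 2 ^ j) B'" if B: "admissible \<tau> 1 x B" for B j
  proof (induction j)
    case 0
    then show ?case using B by (intro exI[of _ B]) (simp add: h_def cj_refl)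
  next
    case (Suc j)
    then obtain B' where B': "cj \<beta> (h j) (ev B) (ev B')" "admissible \<tau> (h j) (x / 2 ^ j) B'" by blast
    have le: "x / 2 ^ j \<le> x" using x(1) by (simp add: divide_le_eq mult_le_cancel_left1)
    have hs: "h (Suc j) = h j - x / 2 ^ j" by (simp add: h_def field_simps)
    obtain B'' where B'': "cj \<beta> (h (Suc j)) (ev B') (ev B'')" "admissible \<tau> (h (Suc j)) (x / 2 ^ j / 2) B''"
      using step[OF _ _ _ _ B'(2)] le x h(1)[of j] h(2)[of j] unfolding hs by force
    have "cj \<beta> (h (Suc j)) (ev B) (ev B'')"
      using cj_trans[OF cj_mono[OF B'(1)] B''(1)] x(1) by (simp add: hs)
    then show ?case using B''(2) by (intro exI[of _ B'']) (simp add: mult.commute)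
  qed
  have "\<exists>B'. cj \<beta> (1/2) (ev B) (ev B') \<and> admissible \<tau> (1/2) (x / 2 ^ j) B'" if B: "admissible \<tau> 1 x B" for B j
    using main[OF B, of j] cj_mono[OF _ h(1)] admissible_mono[OF _ h(1)] by blast
  then show ?thesis using x(1,3) by blast
qed

end

subsection \<open>Back to \<open>SL(2,R)\<close>\<close>

text \<open>Conjugation by the Cayley matrix with rows \<open>(1, -i)\<close> and \<open>(1, i)\<close>, in both directions.\<close>

definition to_sl :: "m2 \<Rightarrow> complex^2^2" where
  "to_sl X = mat2 ((e11 X + e22 X + e12 X + e21 X) / 2) (\<i> * (e12 X - e21 X - e11 X + e22 X) / 2)
     (\<i> * (e12 X - e21 X + e11 X - e22 X) / 2) ((e11 X + e22 X - e12 X - e21 X) / 2)"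

definition of_sl :: "complex \<Rightarrow> complex \<Rightarrow> complex \<Rightarrow> complex \<Rightarrow> m2" where
  "of_sl a b c d = M2 ((a + d + \<i> * (b - c)) / 2) ((a - d - \<i> * (b + c)) / 2)
     ((a - d + \<i> * (b + c)) / 2) ((a + d - \<i> * (b - c)) / 2)"

lemma mat2_nth [simp]: "mat2 a b c d $ 1 $ 1 = a" "mat2 a b c d $ 1 $ 2 = b"
  "mat2 a b c d $ 2 $ 1 = c" "mat2 a b c d $ 2 $ 2 = d"
  by (simp_all add: mat2_def)

lemma mat2_eqI: "M $ 1 $ 1 = N $ 1 $ 1 \<Longrightarrow> M $ 1 $ 2 = N $ 1 $ 2 \<Longrightarrow> M $ 2 $ 1 = N $ 2 $ 1 \<Longrightarrow>
    M $ 2 $ 2 = N $ 2 $ 2 \<Longrightarrow> M = (N :: 'a^2^2)"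
  by (simp add: vec_eq_iff forall_2)

lemma to_sl_of_sl: "to_sl (of_sl a b c d) = mat2 a b c d"
proof -
  have i: "\<i> * (\<i> * x) = - x" for x by (simp flip: mult.assoc)
  show ?thesis
    by (rule mat2_eqI; simp add: to_sl_def of_sl_def field_simps i)
qed

lemma of_sl_mult: "of_sl a b c d * of_sl a' b' c' d' =
    of_sl (a * a' + b * c') (a * b' + b * d') (c * a' + d * c') (c * b' + d * d')"
proof -
  have i: "\<i> * (\<i> * x) = - x" for x by (simp flip: mult.assoc)
  show ?thesis
    by (rule m2_eqI; simp add: of_sl_def times_m2_def field_simps i)
qed

lemma to_sl_mult: "to_sl (X * Y) = to_sl X ** to_sl Y"
proof -
  have i: "\<i> * (\<i> * x) = - x" for x by (simp flip: mult.assoc)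
  show ?thesis
    by (rule mat2_eqI; simp add: to_sl_def times_m2_def matrix_matrix_mult_def sum_2 field_simps i)
qed

lemma det_to_sl: "det (to_sl X) = det2 X"
proof -
  have i: "\<i> * (\<i> * x) = - x" for x by (simp flip: mult.assoc)
  show ?thesis
    by (simp add: det_2 to_sl_def det2_def field_simps i)
qed

lemma det2_of_sl: "det2 (of_sl a b c d) = a * d - b * c"
  by (simp add: to_sl_of_sl det_2 flip: det_to_sl)

lemma to_sl_scl: "to_sl (scl c * X) $ i $ j = c * to_sl X $ i $ j"
proof -
  have "to_sl (scl c * X) = (\<chi> i j. c * to_sl X $ i $ j)"
    by (rule mat2_eqI; simp add: to_sl_def scl_def times_m2_def field_simps)
  then show ?thesis by simp
qed

lemma to_sl_diff: "to_sl (X - Y) = to_sl X - to_sl Y"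
  by (rule mat2_eqI; simp add: to_sl_def minus_m2_def field_simps)

lemma norm_to_sl: "norm (to_sl X) \<le> 4 * nm X"
proof -
  have t: "norm (a + b + c + d) \<le> norm a + norm b + norm c + norm d" for a b c d :: complex
    by (meson add_right_mono norm_triangle_ineq order_trans)
  have e: "norm (to_sl X $ i $ j) \<le> nm X" for i j
  proof -
    have "norm (e11 X + e22 X + e12 X + e21 X) \<le> nm X" "norm (e12 X - e21 X - e11 X + e22 X) \<le> nm X"
      "norm (e12 X - e21 X + e11 X - e22 X) \<le> nm X" "norm (e11 X + e22 X - e12 X - e21 X) \<le> nm X"
      using t[of "e11 X" "e22 X" "e12 X" "e21 X"] t[of "e12 X" "- e21 X" "- e11 X" "e22 X"]
        t[of "e12 X" "- e21 X" "e11 X" "- e22 X"] t[of "e11 X" "e22 X" "- e12 X" "- e21 X"]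
      by (simp_all add: nm_def)
    moreover have "norm (to_sl X $ 1 $ 1) = norm (e11 X + e22 X + e12 X + e21 X) / 2"
      "norm (to_sl X $ 1 $ 2) = norm (e12 X - e21 X - e11 X + e22 X) / 2"
      "norm (to_sl X $ 2 $ 1) = norm (e12 X - e21 X + e11 X - e22 X) / 2"
      "norm (to_sl X $ 2 $ 2) = norm (e11 X + e22 X - e12 X - e21 X) / 2"
      by (simp_all add: to_sl_def norm_divide norm_mult)
    ultimately have "norm (to_sl X $ 1 $ 1) \<le> nm X" "norm (to_sl X $ 1 $ 2) \<le> nm X"
      "norm (to_sl X $ 2 $ 1) \<le> nm X" "norm (to_sl X $ 2 $ 2) \<le> nm X"
      using nm_nonneg[of X] by linarith+
    then have "\<forall>i j. norm (to_sl X $ i $ j) \<le> nm X" unfolding forall_2 by blast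
    then show ?thesis by blast
  qed
  have "norm (to_sl X) \<le> (\<Sum>i\<in>UNIV. norm (to_sl X $ i))"
    by (simp add: norm_vec_def L2_set_le_sum)
  also have "\<dots> \<le> (\<Sum>i\<in>UNIV. \<Sum>j\<in>UNIV. norm (to_sl X $ i $ j))"
    by (intro sum_mono) (simp add: norm_vec_def L2_set_le_sum)
  also have "\<dots> \<le> 4 * nm X"
    using e[of 1 1] e[of 1 2] e[of 2 1] e[of 2 2] by (simp add: sum_2)
  finally show ?thesis .
qed

lemma sg_of_sl: "sg (of_sl (of_real a) (of_real b) (of_real c) (of_real d)) =
    of_sl (of_real a) (of_real b) (of_real c) (of_real d)"
  by (simp add: sg_def of_sl_def)

lemma to_sl_real:
  assumes "sg X = X"
  shows "Im (to_sl X $ i $ j) = 0"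
proof -
  have "e22 X = cnj (e11 X)" "e21 X = cnj (e12 X)"
    by (subst assms[symmetric], simp add: sg_def)+
  then have "\<forall>i j. Im (to_sl X $ i $ j) = 0"
    by (simp add: forall_2 to_sl_def)
  then show ?thesis by blast
qed

lemma psl_analytic_to_sl:
  assumes "sl_on h Z"
  shows "psl_analytic_on_strip h (\<lambda>z. to_sl (Z z))"
proof -
  obtain r :: real where r: "r \<in> {1, -1}" "\<forall>z\<in>strip h. Z (z + 2 * of_real pi) = scl (of_real r) * Z z"
  proof -
    obtain s where s: "s \<in> {1, -1}" "\<forall>z\<in>strip h. Z (z + 2 * of_real pi) = scl s * Z z"
      using assms unfolding sl_on_def by blast
    have "of_real (Re s) = s" "Re s \<in> {1, -1}" using s(1) by auto
    with s(2) show ?thesis using that[of "Re s"] by simp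
  qed
  have hol: "(\<lambda>z. e11 (Z z)) holomorphic_on strip h" "(\<lambda>z. e12 (Z z)) holomorphic_on strip h"
    "(\<lambda>z. e21 (Z z)) holomorphic_on strip h" "(\<lambda>z. e22 (Z z)) holomorphic_on strip h"
    using assms by (auto simp: sl_on_def)
  have "\<forall>i j. (\<lambda>z. to_sl (Z z) $ i $ j) holomorphic_on strip h"
    unfolding forall_2 to_sl_def mat2_nth by (intro conjI holomorphic_intros hol) auto
  moreover have "Im (to_sl (Z (of_real x)) $ i $ j) = 0" for x i j
    using assms by (intro to_sl_real) (auto simp: sl_on_def)
  moreover have "\<forall>z\<in>strip h. det (to_sl (Z z)) = 1"
    using assms by (auto simp: sl_on_def det_to_sl)
  moreover have "\<forall>z\<in>strip h. to_sl (Z (z + of_real (2 * pi))) = r *\<^sub>R to_sl (Z z)"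
  proof -
    have "to_sl (scl (of_real r) * X) = r *\<^sub>R to_sl X" for X
      by (intro mat2_eqI, simp_all only: to_sl_scl vector_scaleR_component) (simp_all add: scaleR_conv_of_real)
    then show ?thesis using r(2) by simp
  qed
  ultimately show ?thesis unfolding psl_analytic_on_strip_def using r(1) by blast
qed

text \<open>Dividing by a root of the determinant undoes, up to sign, the scalar factor collected by
  \<open>cj\<close>.\<close>

definition det_normalise :: "complex^2^2 \<Rightarrow> complex^2^2" where
  "det_normalise M = (\<chi> i j. M $ i $ j / csqrt (det M))"

lemma isCont_det_normalise:
  assumes "det M \<notin> \<real>\<^sub>\<le>\<^sub>0"
  shows "isCont det_normalise M"
  unfolding det_normalise_def continuous_at det_2
proof (intro tendsto_vec_lambda)
  fix i j
  have "((\<lambda>N. csqrt (N $ 1 $ 1 * N $ 2 $ 2 - N $ 1 $ 2 * N $ 2 $ 1)) \<longlongrightarrow> csqrt (det M)) (at M)"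
    by (rule isCont_tendsto_compose[OF continuous_at_csqrt[OF assms]])
       (auto simp: det_2 intro!: tendsto_intros)
  then show "((\<lambda>N. N $ i $ j / csqrt (N $ 1 $ 1 * N $ 2 $ 2 - N $ 1 $ 2 * N $ 2 $ 1)) \<longlongrightarrow>
      M $ i $ j / csqrt (M $ 1 $ 1 * M $ 2 $ 2 - M $ 1 $ 2 * M $ 2 $ 1)) (at M)"
    using assms by (intro tendsto_divide tendsto_intros) (auto simp: det_2)
qed

lemma uniform_limit_const_compose:
  fixes f :: "nat \<Rightarrow> 'a \<Rightarrow> 'b::metric_space" and g :: "'b \<Rightarrow> 'c::metric_space"
  assumes "uniform_limit S f (\<lambda>_. l) F" "isCont g l"
  shows "uniform_limit S (\<lambda>n x. g (f n x)) (\<lambda>_. g l) F"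
proof (rule uniform_limitI)
  fix e :: real assume "0 < e"
  then obtain d where d: "0 < d" "\<And>y. dist y l < d \<Longrightarrow> dist (g y) (g l) < e"
    using assms(2) unfolding continuous_at_eps_delta by blast
  show "\<forall>\<^sub>F n in F. \<forall>x\<in>S. dist (g (f n x)) (g l) < e"
    using uniform_limitD[OF assms(1) d(1)] by eventually_elim (use d(2) in blast)
qed

text \<open>Conjugation by determinant-one maps preserves the determinant 1 of \<open>B\<close>.
  This determines the factor \<open>g\<close> up to sign from the determinant of the conjugated
  cocycle.\<close>

lemma almost_reducible_of_admissible:
  assumes x: "0 < x" "x \<le> 1/100"
    and det: "\<And>z. z \<in> strip (1/2) \<Longrightarrow> det2 (B z) = 1"
    and adm: "\<And>j. \<exists>B'. cj \<beta> (1/2) B (ev B') \<and> admissible \<tau> (1/2) (x / 2 ^ j) B'"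
  shows "almost_reducible \<beta> (\<lambda>z. to_sl (B z))"
proof -
  obtain C where C: "\<And>j. cj \<beta> (1/2) B (ev (C j))" "\<And>j. admissible \<tau> (1/2) (x / 2 ^ j) (C j)"
    using adm by metis
  define A where "A j = cf (C j) 0" for j
  have xj: "0 < x / 2 ^ j" "x / 2 ^ j \<le> 1/100" for j
  proof -
    have "x / 2 ^ j \<le> x / 1" using x by (intro divide_left_mono) auto
    then show "x / 2 ^ j \<le> 1/100" using x(2) unfolding div_by_1 by (rule order_trans)
    show "0 < x / 2 ^ j" using x(1) by simp
  qed
  have A: "sg (A j) = A j" "nm (A j) \<le> 10" "1/2 \<le> Re (det2 (A j))" for j
    using C(2)[of j] xj[of j] unfolding admissible_def A_def rl_def by (auto dest: spec[of _ 0])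
  have close: "nm (ev (C j) z - A j) \<le> x / 2 ^ j" if "z \<in> strip (1/2)" for j z
  proof -
    have "nm (ev (C j) z - A j) = nm (ev (C j - cst (A j)) z)" by (simp add: ev_diff)
    also have "\<dots> \<le> nrm (1/2) (C j - cst (A j))"
      using that by (intro nm_ev_le) (auto simp: strip_def)
    also have "\<dots> \<le> (x / 2 ^ j) ^ (20 * \<tau> + 10)"
      using C(2)[of j] by (simp add: admissible_def A_def)
    also have "\<dots> \<le> (x / 2 ^ j) ^ 1"
    proof -
      have "x / 2 ^ j \<le> 1" using xj(2)[of j] by linarith
      then show ?thesis by (intro power_decreasing less_imp_le[OF xj(1)]) simp_all
    qed
    finally show ?thesis by simp
  qed
  \<comment> \<open>The distance 1/100 moves the determinant by at most 21/100, less than the lower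
    bound 1/2 for the constants; so the principal root is holomorphic here.\<close>
  have detC: "0 < Re (det2 (ev (C j) z))" if "z \<in> strip (1/2)" for j z
  proof -
    have c: "nm (ev (C j) z - A j) \<le> 1/100" using close[OF that] xj(2) by (rule order_trans)
    then have "nm (ev (C j) z) \<le> 11"
      using nm_add[of "ev (C j) z - A j" "A j"] A(2)[of j] by simp
    then have "norm (det2 (ev (C j) z) - det2 (A j)) \<le> 1/100 * (11 + 10)"
      using c A(2)[of j] by (intro order_trans[OF norm_det2_diff mult_mono] add_mono) auto
    then show ?thesis
      using abs_Re_le_cmod[of "det2 (ev (C j) z) - det2 (A j)"] A(3)[of j] by simp
  qed
  have "\<exists>Z g. sl_on (1/2) Z \<and> continuous_on (strip (1/2)) g \<and>
     (\<forall>z\<in>strip (1/2). Z (z + of_real \<beta>) * B z = scl (g z) * (ev (C j) z * Z z))" for j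
    using C(1) unfolding cj_def by blast
  then obtain Z g where Z: "\<And>j. sl_on (1/2) (Z j)" "\<And>j. continuous_on (strip (1/2)) (g j)"
    "\<And>j z. z \<in> strip (1/2) \<Longrightarrow> Z j (z + of_real \<beta>) * B z = scl (g j z) * (ev (C j) z * Z j z)"
    by metis
  have detZ: "det2 (Z j z) = 1" if "z \<in> strip (1/2)" for j z
    using Z(1) that by (auto simp: sl_on_def)
  have conn: "connected (strip (1/2))"
  proof -
    have "strip (1/2) = {z. Im z < 1/2} \<inter> {z. Im z > - (1/2)}" by (auto simp: strip_def)
    then show ?thesis
      by (simp only: convex_connected convex_Int convex_halfspace_Im_lt convex_halfspace_Im_gt)
  qed
  have "\<exists>s::real. s \<in> {1, -1} \<and> (\<forall>z\<in>strip (1/2). of_real s * g j z = 1 / csqrt (det2 (ev (C j) z)))" for j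
  proof -
    \<comment> \<open>Comparing determinants gives \<open>f\<close> squared equal to 1; being
      continuous on a connected strip, \<open>f\<close> is a constant sign, which becomes the sign
      in \<open>almost_reducible\<close>.\<close>
    define f where "f z = g j z * csqrt (det2 (ev (C j) z))" for z
    have f2: "f z \<in> {1, -1}" if z: "z \<in> strip (1/2)" for z
    proof -
      have "det2 (Z j (z + of_real \<beta>) * B z) = (g j z)\<^sup>2 * det2 (ev (C j) z)"
        unfolding Z(3)[OF z] det2_scl by (simp add: det2_mult detZ z)
      then have "(f z)\<^sup>2 = 1"
        using z by (simp add: det2_mult detZ det f_def power_mult_distrib)
      then show ?thesis by (simp add: power2_eq_1_iff)
    qed
    have "(\<lambda>z. csqrt (det2 (ev (C j) z))) holomorphic_on strip (1/2)"
      using detC[of _ j] unfolding det2_def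
      by (intro holomorphic_on_csqrt' holomorphic_intros holomorphic_ev) (auto simp: complex_nonpos_Reals_iff not_le)
    then have "continuous_on (strip (1/2)) f"
      unfolding f_def by (intro continuous_on_mult Z holomorphic_on_imp_continuous_on)
    moreover have "finite (f ` strip (1/2))"
      by (rule finite_subset[of _ "{1, -1}"]) (use f2 in auto)
    ultimately obtain a where a: "\<And>z. z \<in> strip (1/2) \<Longrightarrow> f z = a"
      using continuous_finite_range_constant[OF conn] unfolding constant_on_def by blast
    have "0 \<in> strip (1/2)" by (simp add: strip_def)
    then have a1: "a \<in> {1, -1}" using f2 a by metis
    have "of_real (Re a) * g j z = 1 / csqrt (det2 (ev (C j) z))" if "z \<in> strip (1/2)" for z
    proof -
      have "csqrt (det2 (ev (C j) z)) \<noteq> 0" using detC[OF that, of j] by auto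
      moreover have "a * f z = 1" "of_real (Re a) = a" using a[OF that] a1 by auto
      ultimately show ?thesis by (simp add: f_def field_simps)
    qed
    then show ?thesis using a1 by (intro exI[of _ "Re a"]) auto
  qed
  then obtain s :: "nat \<Rightarrow> real" where s: "\<And>j. s j \<in> {1, -1}"
    "\<And>j z. z \<in> strip (1/2) \<Longrightarrow> of_real (s j) * g j z = 1 / csqrt (det2 (ev (C j) z))"
    by metis
  have conj: "s j *\<^sub>R (to_sl (Z j (z + of_real \<beta>)) ** to_sl (B z) ** matrix_inv (to_sl (Z j z))) =
      det_normalise (to_sl (ev (C j) z))" if z: "z \<in> strip (1/2)" for j z
  proof -
    have "invertible (to_sl (Z j z))"
      by (simp add: invertible_det_nz det_to_sl detZ[OF z])
    then have inv: "to_sl (Z j z) ** matrix_inv (to_sl (Z j z)) = mat 1"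
      unfolding invertible_def matrix_inv_def by (rule someI2_ex) simp
    have "to_sl (Z j (z + of_real \<beta>)) ** to_sl (B z) = to_sl (scl (g j z) * ev (C j) z) ** to_sl (Z j z)"
      unfolding to_sl_mult[symmetric] Z(3)[OF z] by (simp add: mult.assoc)
    then have "to_sl (Z j (z + of_real \<beta>)) ** to_sl (B z) ** matrix_inv (to_sl (Z j z)) =
      to_sl (scl (g j z) * ev (C j) z)"
      by (simp add: inv flip: matrix_mul_assoc)
    then show ?thesis
      unfolding det_normalise_def det_to_sl using s(2)[OF z, of j]
      by (simp add: vec_eq_iff to_sl_scl vector_scaleR_component del: scaleR_conv_of_real)
         (simp add: scaleR_conv_of_real flip: mult.assoc)
  qed
  \<comment> \<open>The constants need not converge, since a rotation changes them by an amount that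
    does not tend to 0; compactness supplies a subsequence.\<close>
  have "bounded (range (\<lambda>j. to_sl (A j)))"
    unfolding bounded_iff using norm_to_sl A(2) by (intro exI[of _ 40]) (force intro: order_trans)
  then obtain l r where r: "strict_mono r" "((\<lambda>j. to_sl (A j)) \<circ> r) \<longlonglongrightarrow> l"
    using bounded_imp_convergent_subsequence by blast
  have detl: "det l \<notin> \<real>\<^sub>\<le>\<^sub>0"
  proof -
    have "(\<lambda>j. Re (det (to_sl (A (r j))))) \<longlonglongrightarrow> Re (det l)"
      using r(2) unfolding det_2 o_def by (intro tendsto_intros)
    moreover have "1/2 \<le> Re (det (to_sl (A (r j))))" for j using A(3) by (simp add: det_to_sl)
    ultimately have "1/2 \<le> Re (det l)" by (intro LIMSEQ_le_const) auto
    then show ?thesis by (auto simp: complex_nonpos_Reals_iff)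
  qed
  have "uniform_limit (strip (1/2)) (\<lambda>j z. to_sl (ev (C (r j)) z)) (\<lambda>_. l) sequentially"
  proof (rule uniform_limitI)
    fix e :: real assume e: "0 < e"
    have "\<forall>\<^sub>F j in sequentially. dist (to_sl (A (r j))) l < e / 2"
      using tendstoD[OF r(2), of "e / 2"] e by (simp add: o_def)
    moreover have "\<forall>\<^sub>F j in sequentially. 4 * (x / 2 ^ j) < e / 2"
    proof -
      have "(\<lambda>j. 4 * (x / 2 ^ j)) \<longlonglongrightarrow> 4 * 0"
        by (intro tendsto_mult tendsto_const LIMSEQ_divide_realpow_zero) simp
      then show ?thesis by (rule order_tendstoD(2)) (use e in simp)
    qed
    ultimately show "\<forall>\<^sub>F j in sequentially. \<forall>z\<in>strip (1/2). dist (to_sl (ev (C (r j)) z)) l < e"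
    proof eventually_elim
      case (elim j)
      have "x / 2 ^ r j \<le> x / 2 ^ j"
        using x seq_suble[OF r(1), of j] by (intro divide_left_mono power_increasing) auto
      then have "dist (to_sl (ev (C (r j)) z)) (to_sl (A (r j))) < e / 2" if "z \<in> strip (1/2)" for z
        using norm_to_sl[of "ev (C (r j)) z - A (r j)"] close[OF that, of "r j"] elim
        by (simp add: dist_norm flip: to_sl_diff)
      then show ?case using elim(1) by (auto intro: dist_triangle_half_r simp: dist_commute)
    qed
  qed
  then have lim: "uniform_limit (strip (1/2)) (\<lambda>j z. det_normalise (to_sl (ev (C (r j)) z)))
      (\<lambda>_. det_normalise l) sequentially"
    by (rule uniform_limit_const_compose[OF _ isCont_det_normalise[OF detl]])
  have "uniform_limit (strip (1/2)) (\<lambda>n z. s (r n) *\<^sub>R (to_sl (Z (r n) (z + of_real \<beta>)) ** to_sl (B z) **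
        matrix_inv (to_sl (Z (r n) z)))) (\<lambda>z. det_normalise l) sequentially"
    using lim unfolding uniform_limit_iff by (simp add: conj)
  moreover have "\<forall>n. psl_analytic_on_strip (1/2) (\<lambda>z. to_sl (Z (r n) z))"
    using psl_analytic_to_sl[OF Z(1)] by blast
  moreover have "\<forall>n. s (r n) \<in> {1, -1}" using s(1) by blast
  moreover have "0 < (1/2 :: real)" by simp
  ultimately show ?thesis
    unfolding almost_reducible_def
    by (intro exI[of _ "1/2 :: real"] exI[of _ "\<lambda>n z. to_sl (Z (r n) z)"] exI[of _ "det_normalise l"]
        exI[of _ "\<lambda>n. s (r n)"] conjI)
qed

subsection \<open>The Diophantine condition\<close>

text \<open>For arguments up to 2 the cubic Taylor remainder is at most two thirds of the linear
  term; the range includes \<open>pi / 2\<close>.\<close>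

lemma abs_sin_ge:
  fixes x :: real
  assumes "\<bar>x\<bar> \<le> 2"
  shows "\<bar>x\<bar> / 3 \<le> \<bar>sin x\<bar>"
proof -
  have "\<bar>sin x - x\<bar> \<le> \<bar>x\<bar> ^ 3 / 6"
    using Maclaurin_sin_bound[of x 3] by (simp add: numeral_3_eq_3 sin_coeff_def fact_numeral field_simps)
  also have "\<bar>x\<bar> ^ 3 / 6 = \<bar>x\<bar> * \<bar>x\<bar>\<^sup>2 / 6" by (simp add: power3_eq_cube power2_eq_square)
  also have "\<dots> \<le> \<bar>x\<bar> * 2\<^sup>2 / 6"
    using assms by (intro divide_right_mono mult_left_mono power_mono) auto
  finally show ?thesis by (simp add: abs_if split: if_splits)
qed

lemma diophantine_small_divisors:
  assumes "diophantine (\<omega> / (2 * pi))"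
  obtains \<kappa> \<tau> where "small_divisors (2 * \<omega>) \<kappa> \<tau>"
proof -
  obtain \<gamma> t where g: "0 < \<gamma>" "0 < t" and d: "\<And>p q::int. q \<noteq> 0 \<Longrightarrow>
      \<gamma> * \<bar>real_of_int q\<bar> powr (- t) \<le> \<bar>real_of_int q * (\<omega> / (2 * pi)) - real_of_int p\<bar>"
    using assms unfolding diophantine_def by blast
  \<comment> \<open>The base rotation is \<open>2 * \<omega>\<close>, so mode \<open>n\<close> uses
    the Diophantine inequality at the denominator \<open>2 * n\<close>; hence the factor
    \<open>2 powr (- t)\<close>.\<close>
  define \<kappa> where "\<kappa> = \<gamma> * 2 powr (- t)"
  define \<tau> where "\<tau> = nat \<lceil>t\<rceil>"
  have "\<kappa> \<le> norm (1 - cis (of_int n * (2 * \<omega>))) * \<bar>real_of_int n\<bar> ^ \<tau>" if n: "n \<noteq> 0" for n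
  proof -
    define v where "v = real_of_int (2 * n) * (\<omega> / (2 * pi))"
    \<comment> \<open>Signed distance to the nearest integer; the divisor is the chord of length
      twice the modulus of \<open>sin (pi * u)\<close>.\<close>
    define u where "u = v - of_int (round v)"
    have u: "\<bar>u\<bar> \<le> 1/2" using of_int_round_abs_le[of v] by (simp add: u_def abs_minus_commute)
    have n1: "1 \<le> \<bar>real_of_int n\<bar>" using n by linarith
    have "\<kappa> * \<bar>real_of_int n\<bar> powr (- t) = \<gamma> * \<bar>real_of_int (2 * n)\<bar> powr (- t)"
      by (simp add: \<kappa>_def abs_mult powr_mult)
    also have "\<dots> \<le> \<bar>u\<bar>" using d[of "2 * n" "round v"] n by (simp add: u_def v_def)
    also have "\<dots> \<le> 2 * (\<bar>pi * u\<bar> / 3)"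
    proof -
      have "2 * \<bar>u\<bar> \<le> pi * \<bar>u\<bar>" using pi_ge_two by (intro mult_right_mono) auto
      then show ?thesis by (simp add: abs_mult)
    qed
    also have "\<dots> \<le> 2 * \<bar>sin (pi * u)\<bar>"
    proof -
      have "pi * \<bar>u\<bar> \<le> 4 * (1/2)" using pi_less_4 u by (intro mult_mono) auto
      then show ?thesis using abs_sin_ge[of "pi * u"] by (simp add: abs_mult)
    qed
    also have "\<dots> = norm (1 - cis (2 * (pi * u)))"
    proof (rule power2_eq_imp_eq)
      show "(2 * \<bar>sin (pi * u)\<bar>)\<^sup>2 = (norm (1 - cis (2 * (pi * u))))\<^sup>2"
        unfolding norm_one_minus_cis cos_double_sin by (simp add: power_mult_distrib)
    qed auto
    also have "cis (2 * (pi * u)) = cis (of_int n * (2 * \<omega>))"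
    proof -
      have "2 * (pi * u) = of_int n * (2 * \<omega>) + 2 * pi * of_int (- round v)"
        by (simp add: u_def v_def field_simps)
      then have "cis (2 * (pi * u)) = cis (of_int n * (2 * \<omega>)) * cis (2 * pi * of_int (- round v))"
        by (simp only: cis_mult)
      also have "cis (2 * pi * of_int (- round v)) = 1"
        by (rule cis_multiple_2pi) simp
      finally show ?thesis by simp
    qed
    finally have *: "\<kappa> * \<bar>real_of_int n\<bar> powr (- t) \<le> norm (1 - cis (of_int n * (2 * \<omega>)))" .
    have "\<kappa> = \<kappa> * \<bar>real_of_int n\<bar> powr (- t) * \<bar>real_of_int n\<bar> powr t"
      using n by (simp add: mult.assoc flip: powr_add)
    also have "\<dots> \<le> norm (1 - cis (of_int n * (2 * \<omega>))) * \<bar>real_of_int n\<bar> powr t"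
      using * by (intro mult_right_mono) auto
    also have "\<dots> \<le> norm (1 - cis (of_int n * (2 * \<omega>))) * \<bar>real_of_int n\<bar> powr real \<tau>"
      using n1 by (intro mult_left_mono powr_mono) (auto simp: \<tau>_def real_nat_ceiling_ge)
    also have "\<bar>real_of_int n\<bar> powr real \<tau> = \<bar>real_of_int n\<bar> ^ \<tau>"
      using n by (simp add: powr_realpow)
    finally show ?thesis .
  qed
  then have "small_divisors (2 * \<omega>) \<kappa> \<tau>"
    unfolding small_divisors_def using g by (auto simp: \<kappa>_def)
  then show ?thesis by (rule that)
qed

subsection \<open>The cocycle near zero energy\<close>

lemma Bmat_of_sl: "Bmat t1 \<omega> E z = to_sl (of_sl
    (E * (E - t1 * cos (z + \<omega>)) - 1) (t1 * cos (z + \<omega>) - E) E (- 1))"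
  unfolding to_sl_of_sl Bmat_def Amat_def
  by (rule mat2_eqI; simp add: Tseq_def matrix_matrix_mult_def sum_2 algebra_simps)

theorem theorem9:
  fixes t1 \<omega> :: real
  assumes "diophantine (\<omega> / (2 * pi))"
  shows "\<exists>\<epsilon>>0. \<forall>E \<in> {-\<epsilon>..\<epsilon>}. almost_reducible (2 * \<omega>) (Bmat t1 \<omega> E)"
proof -
  obtain \<kappa> \<tau> where sd: "small_divisors (2 * \<omega>) \<kappa> \<tau>"
    using diophantine_small_divisors[OF assms] .
  interpret small_divisors "2 * \<omega>" \<kappa> \<tau> by (rule sd)
  obtain x where x: "0 < x" "x \<le> 1/100" and kam: "\<And>B j. admissible \<tau> 1 x B \<Longrightarrow>
     \<exists>B'. cj (2 * \<omega>) (1/2) (ev B) (ev B') \<and> admissible \<tau> (1/2) (x / 2 ^ j) B'"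
    using kam by blast
  \<comment> \<open>Needed to divide by \<open>2 * sin \<omega>\<close> in the cohomological
    equation; it is the small divisor at mode 1.\<close>
  have sin: "sin \<omega> \<noteq> 0"
  proof
    assume "sin \<omega> = 0"
    then have "cis (2 * \<omega>) = 1" by (simp add: complex_eq_iff sin_double cos_double_sin)
    then show False using small_divisor[of 1] kpos by simp
  qed
  define a where "a = - \<i> * of_real t1 / (4 * of_real (sin \<omega>))"
  \<comment> \<open>Solves \<open>f (z + 2 * \<omega>) - f z = t1 * cos (z + \<omega>)\<close>, so
    the unipotent matrix with entry \<open>f\<close> conjugates the cocycle at \<open>E = 0\<close>
    to minus the identity. \<open>a\<close> is its Fourier coefficient at mode 1, and
    \<open>P\<close> is \<open>f\<close> as a Laurent polynomial.\<close>
  define f where "f z = of_real t1 * sin z / (2 * of_real (sin \<omega>))" for z :: complex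
  define P where "P = sng 1 (scl a) + sng (- 1) (scl (- a))"
  have evP: "ev P z = scl (f z)" for z
  proof -
    have "exp (\<i> * z) * a - exp (- (\<i> * z)) * a = f z"
      unfolding f_def a_def sin_exp_eq'[of z] using sin by (simp add: divide_simps) (simp add: algebra_simps)
    then show ?thesis
      by (simp add: P_def ev_add ev_sng scl_mult flip: scl_add)
  qed
  have rlP: "rl P"
    by (simp add: P_def rl_iff_br br_add sg_scl a_def)
  \<comment> \<open>\<open>G0\<close> and \<open>G1\<close> are, up to sign, the coefficients of
    \<open>E\<close> and of its square in the conjugated cocycle.\<close>
  define G0 where "G0 = cst (of_sl 0 1 (- 1) 0) + P * cst (of_sl (- 1) 0 0 1) + P * P * cst (of_sl 0 1 0 0)"
  define G1 where "G1 = cst (of_sl (- 1) 0 0 0) + P * cst (of_sl 0 1 0 0)"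
  define B0 where "B0 E = - 1 - cst (scl (of_real E)) * (G0 + cst (scl (of_real E)) * G1)" for E :: real
  define K where "K = nrm 1 G0 + 2 * nrm 1 G1"
  have K: "0 \<le> K" by (simp add: K_def)
  \<comment> \<open>The two size requirements of \<open>admissible_approx\<close> around the
    constant \<open>- 1\<close>, whose norm 2 and determinant 1 lie well inside the window.\<close>
  define r where "r = min (x ^ (20 * \<tau> + 10)) (x / 40)"
  have r: "0 < r" using x by (simp add: r_def)
  define \<epsilon> where "\<epsilon> = min 1 (r / (2 * K + 1))"
  have eps: "0 < \<epsilon>" using r K by (simp add: \<epsilon>_def)
  have "almost_reducible (2 * \<omega>) (Bmat t1 \<omega> E)" if E: "E \<in> {-\<epsilon>..\<epsilon>}" for E
  proof -
    have aE: "\<bar>E\<bar> \<le> 1" "\<bar>E\<bar> \<le> r / (2 * K + 1)" using E by (auto simp: \<epsilon>_def)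
    define B where "B z = of_sl (E * (E - t1 * cos (z + \<omega>)) - 1) (t1 * cos (z + \<omega>) - E) E (- 1)" for z :: complex
    have "nrm 1 (B0 E - cst (- 1)) \<le> r"
    proof -
      define c where "c = cst (scl (of_real E))"
      have c: "nrm 1 c = 2 * \<bar>E\<bar>" by (simp add: c_def nm_scl)
      have "nrm 1 (G0 + c * G1) \<le> nrm 1 G0 + (2 * \<bar>E\<bar>) * nrm 1 G1"
        using nrm_add[of 1 G0 "c * G1"] nrm_mult[of 1 c G1] unfolding c by simp
      then have "(2 * \<bar>E\<bar>) * nrm 1 (G0 + c * G1) \<le> (2 * \<bar>E\<bar>) * (nrm 1 G0 + (2 * \<bar>E\<bar>) * nrm 1 G1)"
        by (intro mult_left_mono) auto
      moreover have "B0 E - cst (- 1) = - (c * (G0 + c * G1))"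
        by (simp add: B0_def c_def single_uminus)
      ultimately have "nrm 1 (B0 E - cst (- 1)) \<le> (2 * \<bar>E\<bar>) * (nrm 1 G0 + (2 * \<bar>E\<bar>) * nrm 1 G1)"
        using nrm_mult[of 1 c "G0 + c * G1"] unfolding c by simp
      also have "\<dots> \<le> (2 * \<bar>E\<bar>) * K"
        unfolding K_def using aE by (intro mult_left_mono add_left_mono mult_right_mono) auto
      also have "\<dots> \<le> \<bar>E\<bar> * (2 * K + 1)" by (simp add: algebra_simps)
      also have "\<dots> \<le> r" using aE(2) K by (simp add: field_simps)
      finally show ?thesis .
    qed
    moreover have "rl (B0 E)"
      unfolding B0_def G0_def G1_def
      by (intro rl_diff rl_minus rl_add rl_mult rlP rl_1)
         (use sg_of_sl[of 0 1 "-1" 0] sg_of_sl[of "-1" 0 0 1] sg_of_sl[of 0 1 0 0] sg_of_sl[of "-1" 0 0 0] in \<open>simp_all add: rl_cst sg_scl\<close>)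
    ultimately have adm: "admissible \<tau> 1 x (B0 E)"
      using x by (intro admissible_approx[of 1 "B0 E" "- 1" r]) (auto simp: r_def det2_def uminus_m2_def one_m2_def nm_def)
    have cjB: "cj (2 * \<omega>) 1 B (ev (B0 E))"
    proof (rule cj_sl_on)
      show "sl_on 1 (\<lambda>z. of_sl 1 (f z) 0 1)"
        unfolding sl_on_def
      proof (intro conjI ballI allI)
        show "(\<lambda>z. e11 (of_sl 1 (f z) 0 1)) holomorphic_on strip 1" "(\<lambda>z. e12 (of_sl 1 (f z) 0 1)) holomorphic_on strip 1"
          "(\<lambda>z. e21 (of_sl 1 (f z) 0 1)) holomorphic_on strip 1" "(\<lambda>z. e22 (of_sl 1 (f z) 0 1)) holomorphic_on strip 1"
          unfolding of_sl_def f_def m2.sel by (intro holomorphic_intros; use sin in simp)+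
        have fx: "f (of_real y) = of_real (t1 * sin y / (2 * sin \<omega>))" for y
          by (simp add: f_def sin_of_real)
        show "sg (of_sl 1 (f (of_real y)) 0 1) = of_sl 1 (f (of_real y)) 0 1" for y
          unfolding fx using sg_of_sl[of 1 "t1 * sin y / (2 * sin \<omega>)" 0 1] by simp
        show "det2 (of_sl 1 (f z) 0 1) = 1" for z by (simp add: det2_of_sl)
        have "f (z + 2 * of_real pi) = f z" for z by (simp add: f_def sin_add)
        then show "\<exists>s\<in>{1, -1}. \<forall>z\<in>strip 1. of_sl 1 (f (z + 2 * of_real pi)) 0 1 = scl s * of_sl 1 (f z) 0 1"
          by (intro bexI[of _ 1]) auto
      qed
      fix z :: complex
      have shift: "f (z + of_real (2 * \<omega>)) = f z + of_real t1 * cos (z + of_real \<omega>)"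
      proof -
        have "sin (z + of_real (2 * \<omega>)) - sin z = 2 * of_real (sin \<omega>) * cos (z + of_real \<omega>)"
          using sin_diff_sin[of "z + of_real (2 * \<omega>)" z] by (simp add: sin_of_real field_simps add_divide_distrib)
        then show ?thesis using sin by (simp add: f_def field_simps)
      qed
      have "ev (B0 E) z = - of_sl (1 - E * f z - E\<^sup>2) (E * (1 + (f z)\<^sup>2 + E * f z)) (- E) (1 + E * f z)"
        unfolding B0_def G0_def G1_def
        by (simp add: ev_diff ev_minus ev_add ev_mult evP, rule m2_eqI)
           (simp_all add: m2_defs scl_def of_sl_def power2_eq_square field_simps)
      moreover have "- of_sl u v w y = of_sl (- u) (- v) (- w) (- y)" for u v w y
        by (rule m2_eqI; simp add: m2_defs of_sl_def field_simps)
      ultimately have ev: "ev (B0 E) z = of_sl (- (1 - E * f z - E\<^sup>2)) (- (E * (1 + (f z)\<^sup>2 + E * f z))) E (- (1 + E * f z))"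
        by simp
      show "of_sl 1 (f (z + of_real (2 * \<omega>))) 0 1 * B z = ev (B0 E) z * of_sl 1 (f z) 0 1"
        unfolding ev shift B_def of_sl_mult
        by (simp add: power2_eq_square algebra_simps)
    qed
    have red: "\<exists>B'. cj (2 * \<omega>) (1/2) B (ev B') \<and> admissible \<tau> (1/2) (x / 2 ^ j) B'" for j
    proof -
      obtain B' where B': "cj (2 * \<omega>) (1/2) (ev (B0 E)) (ev B')" "admissible \<tau> (1/2) (x / 2 ^ j) B'"
        using kam[OF adm] by blast
      have "cj (2 * \<omega>) (1/2) B (ev (B0 E))" by (rule cj_mono[OF cjB]) simp
      then have "cj (2 * \<omega>) (1/2) B (ev B')" using B'(1) by (rule cj_trans)
      with B'(2) show ?thesis by blast
    qed
    have "almost_reducible (2 * \<omega>) (\<lambda>z. to_sl (B z))"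
      by (rule almost_reducible_of_admissible[OF x _ red]) (simp add: B_def det2_of_sl algebra_simps)
    then show ?thesis
      by (simp add: B_def Bmat_of_sl[abs_def])
  qed
  then show ?thesis using eps by blast
qed

end
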